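(* Let $R_{abcd}$ be the Riemann curvature tensor of the $D=2n+\varepsilon$ dimensional (off-shell, Euclidean signature) Kerr-NUT-(A)dS metric $g$ with Darboux coframe $e^\mu,\hat e^\mu$ ($\mu=1,\dots,n$) and, if $\varepsilon=1$, $\hat e^0$, and with principal tensor $h=\sum_\mu x_\mu\, e^\mu\wedge\hat e^\mu$. Then $R_{abcd}$ belongs to the subspace of totally zero weight Riemann-symmetric tensors; namely $$R=\sum_{\mu<\nu}\left[\Omega_{\mu\nu}(h_\mu\odot h_\nu)+\alpha_{\mu\nu}(Q_\mu\odot Q_\nu)\right]+\sum_\mu\left[\tfrac12\Omega_{\mu\mu}(h_\mu\odot h_\mu)+\alpha^{(\epsilon)}_\mu(Q_\mu\odot Q_\epsilon)\right],$$ where the coefficients are given, for $\mu\neq\nu$, by $$\Omega_{\mu\mu}=\tfrac83\left(D_\mu-2\varepsilon E_\mu\right),\qquad \Omega_{\mu\nu}=8F_{\mu\nu},\qquad \alpha_{\mu\nu}=-8S_{\mu\nu}+8\varepsilon(E_\mu+E_\nu),\qquad \alpha^{(\epsilon)}_\mu=-8\varepsilon E_\mu .$$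
   Context: Greek indices run over $1,\dots,n$, and repeated Greek indices are never summed unless a sum is written. $\varepsilon\in\{0,1\}$, $D=2n+\varepsilon$. Metric. In coordinates $x_1,\dots,x_n$ and $\psi_0,\dots,\psi_{n-1+\varepsilon}$, $$g=\sum_{\mu=1}^n\left[\frac{U_\mu}{X_\mu}dx_\mu^2+\frac{X_\mu}{U_\mu}\Big(\sum_{k=0}^{n-1}A^{(k)}_\mu d\psi_k\Big)^2\right]+\varepsilon\frac{c}{A^{(n)}}\Big(\sum_{k=0}^nA^{(k)}d\psi_k\Big)^2,$$ $$A^{(k)}=\sum_{\nu_1<\dots<\nu_k}x_{\nu_1}^2\cdots x_{\nu_k}^2,\quad A^{(k)}_\mu=\sum_{\nu_1<\dots<\nu_k,\ \nu_i\neq\mu}x_{\nu_1}^2\cdots x_{\nu_k}^2,\quad U_\mu=\prod_{\nu\neq\mu}(x_\nu^2-x_\mu^2),$$ where $c$ is a constant and each $X_\mu=X_\mu(x_\mu)$ is an arbitrary smooth function of the single variable $x_\mu$; the coordinates are restricted to a range where the expressions are defined and $g$ is positive definite. Darboux coframe (orthonormal): $e^\mu=\sqrt{U_\mu/X_\mu}\,dx_\mu$, $\hat e^\mu=\sqrt{X_\mu/U_\mu}\sum_{k=0}^{n-1}A^{(k)}_\mu d\psi_k$, and, for $\varepsilon=1$, $\hat e^0=\sqrt{c/A^{(n)}}\sum_{k=0}^nA^{(k)}d\psi_k$. Curvature convention: $R_{abcd}=R_{[ab][cd]}$ with $[\nabla_a,\nabla_b]v^c=R^c{}_{dab}v^d$,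 so a unit round sphere has $R_{abcd}=g_{ac}g_{bd}-g_{ad}g_{bc}$. Tensors. $h_\mu=e^\mu\wedge\hat e^\mu=e^\mu\otimes\hat e^\mu-\hat e^\mu\otimes e^\mu$, $Q_\mu=e^\mu\otimes e^\mu+\hat e^\mu\otimes\hat e^\mu$, $Q_\epsilon=\varepsilon g$. For antisymmetric $h,f$: $$(h\odot f)_{abcd}=\tfrac14h_{ab}f_{cd}+\tfrac14f_{ab}h_{cd}+\tfrac18h_{ac}f_{bd}+\tfrac18f_{ac}h_{bd}-\tfrac18h_{ad}f_{bc}-\tfrac18f_{ad}h_{bc};$$ for symmetric $Q,k$: $$(Q\odot k)_{abcd}=\tfrac18Q_{ad}k_{bc}+\tfrac18k_{ad}Q_{bc}-\tfrac18Q_{ac}k_{bd}-\tfrac18k_{ac}Q_{bd}.$$ Riemann-symmetric tensors and weights. A Riemann-symmetric tensor is a 4-tensor with $r_{abcd}=r_{[ab][cd]}=r_{cdab}$ and $r_{a[bcd]}=0$. Put $e^{\pm\mu}=e^\mu\pm i\hat e^\mu$. A tensor has totally zero weight if it is a linear combination of tensor monomials in $e^{\pm\mu},\hat e^0$ in which, for each $\mu$, the number of factors $e^{+\mu}$ equals the number of factors $e^{-\mu}$ (factors of $\hat e^0$ are unrestricted). Functions. With $\mathsf M=\sum_{\mu=1}^n\frac{X_\mu}{U_\mu}+\varepsilon\frac{c}{A^{(n)}}$ and $\partial_\mu=\partial/\partial x_\mu$, $$S_{\mu\nu}=-\frac{x_\mu\partial_\mu\mathsf M-x_\nu\partial_\nu\mathsf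 M}{2(x_\mu^2-x_\nu^2)},\quad F_{\mu\nu}=\frac{x_\mu\partial_\nu\mathsf M-x_\nu\partial_\mu\mathsf M}{2(x_\mu^2-x_\nu^2)},\quad D_\mu=-\tfrac12\partial_\mu^2\mathsf M,\quad E_\mu=-\frac{1}{2x_\mu}\partial_\mu\mathsf M .$$ *)

theory Defs
  imports "HOL-Analysis.Analysis"
begin

section \<open>Coordinate tensor calculus over a finite index set\<close>

text \<open>
  A point is a function \<open>p :: 'i \<Rightarrow> real\<close> on coordinate labels, and \<open>I\<close> is the finite set of labels
  that are actual coordinates. A tensor at \<open>p\<close> is its array of components; only the components with
  all indices in \<open>I\<close> are meaningful.
\<close>

definition partial :: "'i \<Rightarrow> (('i \<Rightarrow> real) \<Rightarrow> real) \<Rightarrow> ('i \<Rightarrow> real) \<Rightarrow> real" where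
  "partial i f p = deriv (\<lambda>t. f (p(i := t))) (p i)"

definition pos_def :: "'i set \<Rightarrow> ('i \<Rightarrow> 'i \<Rightarrow> real) \<Rightarrow> bool" where
  "pos_def I G \<longleftrightarrow> (\<forall>v. (\<exists>a\<in>I. v a \<noteq> 0) \<longrightarrow> (\<Sum>a\<in>I. \<Sum>b\<in>I. G a b * v a * v b) > 0)"

text \<open>The inverse matrix; the entries outside \<open>I\<close> are set to 0 to make it unique.\<close>

definition metric_inverse :: "'i set \<Rightarrow> ('i \<Rightarrow> 'i \<Rightarrow> real) \<Rightarrow> 'i \<Rightarrow> 'i \<Rightarrow> real" where
  "metric_inverse I G = (THE H.
     (\<forall>a b. a \<notin> I \<or> b \<notin> I \<longrightarrow> H a b = 0) \<and>
     (\<forall>a\<in>I. \<forall>b\<in>I. (\<Sum>d\<in>I. G a d * H d b) = (if a = b then 1 else 0)) \<and>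
     (\<forall>a\<in>I. \<forall>b\<in>I. (\<Sum>d\<in>I. H a d * G d b) = (if a = b then 1 else 0)))"

text \<open>In the following, \<open>g p a b\<close> is the component \<open>g\<^sub>a\<^sub>b\<close> of the metric at \<open>p\<close>.
  \<open>christoffel I g k a b\<close> has upper index \<open>k\<close>.\<close>

definition christoffel ::
  "'i set \<Rightarrow> (('i \<Rightarrow> real) \<Rightarrow> 'i \<Rightarrow> 'i \<Rightarrow> real) \<Rightarrow> 'i \<Rightarrow> 'i \<Rightarrow> 'i \<Rightarrow> ('i \<Rightarrow> real) \<Rightarrow> real" where
  "christoffel I g k a b p =
     (\<Sum>e\<in>I. metric_inverse I (g p) k e / 2 *
        (partial a (\<lambda>q. g q e b) p + partial b (\<lambda>q. g q e a) p - partial e (\<lambda>q. g q a b) p))"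

text \<open>\<open>nabla I g v a k\<close> is the component \<open>\<nabla>\<^sub>a v\<^sup>k\<close>, and \<open>nabla2 I g v a b k\<close> the component
  \<open>\<nabla>\<^sub>a \<nabla>\<^sub>b v\<^sup>k\<close> of the second covariant derivative.\<close>

definition nabla ::
  "'i set \<Rightarrow> (('i \<Rightarrow> real) \<Rightarrow> 'i \<Rightarrow> 'i \<Rightarrow> real) \<Rightarrow> (('i \<Rightarrow> real) \<Rightarrow> 'i \<Rightarrow> real) \<Rightarrow>
    'i \<Rightarrow> 'i \<Rightarrow> ('i \<Rightarrow> real) \<Rightarrow> real" where
  "nabla I g v a k p = partial a (\<lambda>q. v q k) p + (\<Sum>e\<in>I. christoffel I g k a e p * v p e)"

definition nabla2 ::
  "'i set \<Rightarrow> (('i \<Rightarrow> real) \<Rightarrow> 'i \<Rightarrow> 'i \<Rightarrow> real) \<Rightarrow> (('i \<Rightarrow> real) \<Rightarrow> 'i \<Rightarrow> real) \<Rightarrow>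
    'i \<Rightarrow> 'i \<Rightarrow> 'i \<Rightarrow> ('i \<Rightarrow> real) \<Rightarrow> real" where
  "nabla2 I g v a b k p =
     partial a (nabla I g v b k) p
     + (\<Sum>e\<in>I. christoffel I g k a e p * nabla I g v b e p)
     - (\<Sum>e\<in>I. christoffel I g e a b p * nabla I g v e k p)"

definition coord_field :: "'i \<Rightarrow> ('i \<Rightarrow> real) \<Rightarrow> 'i \<Rightarrow> real" where
  "coord_field d p k = (if k = d then 1 else 0)"

text \<open>\<open>riemann_up I g k d a b\<close> is \<open>R\<^sup>k\<^sub>d\<^sub>a\<^sub>b\<close> in the convention
  \<open>[\<nabla>\<^sub>a, \<nabla>\<^sub>b] v\<^sup>k = R\<^sup>k\<^sub>d\<^sub>a\<^sub>b v\<^sup>d\<close>, read off from the coordinate fields \<open>v = \<partial>\<^sub>d\<close>.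
  With this convention the unit round sphere has \<open>R\<^sub>a\<^sub>b\<^sub>c\<^sub>d = g\<^sub>a\<^sub>c g\<^sub>b\<^sub>d - g\<^sub>a\<^sub>d g\<^sub>b\<^sub>c\<close>.\<close>

definition riemann_up ::
  "'i set \<Rightarrow> (('i \<Rightarrow> real) \<Rightarrow> 'i \<Rightarrow> 'i \<Rightarrow> real) \<Rightarrow> 'i \<Rightarrow> 'i \<Rightarrow> 'i \<Rightarrow> 'i \<Rightarrow> ('i \<Rightarrow> real) \<Rightarrow> real" where
  "riemann_up I g k d a b p =
     nabla2 I g (coord_field d) a b k p - nabla2 I g (coord_field d) b a k p"

definition riemann ::
  "'i set \<Rightarrow> (('i \<Rightarrow> real) \<Rightarrow> 'i \<Rightarrow> 'i \<Rightarrow> real) \<Rightarrow> ('i \<Rightarrow> real) \<Rightarrow> 'i \<Rightarrow> 'i \<Rightarrow> 'i \<Rightarrow> 'i \<Rightarrow> real" where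
  "riemann I g p i j k l = (\<Sum>e\<in>I. g p i e * riemann_up I g e j k l p)"

lemma nabla_coord_field:
  assumes "finite I" "d \<in> I"
  shows "nabla I g (coord_field d) b k = christoffel I g k b d"
proof
  fix p
  have "(\<Sum>e\<in>I. christoffel I g k b e p * coord_field d p e) =
      (\<Sum>e\<in>I. if e = d then christoffel I g k b e p else 0)"
    by (intro sum.cong) (auto simp: coord_field_def)
  then show "nabla I g (coord_field d) b k p = christoffel I g k b d p"
    using assms by (simp add: nabla_def coord_field_def partial_def)
qed

lemma christoffel_sym:
  assumes "\<And>q e f. g q e f = g q f e"
  shows "christoffel I g k a b = christoffel I g k b a"
proof
  fix p
  have "(\<lambda>q. g q a b) = (\<lambda>q. g q b a)" using assms by auto
  then show "christoffel I g k a b p = christoffel I g k b a p"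
    unfolding christoffel_def by (simp add: add.commute)
qed

lemma riemann_up_christoffel:
  assumes "finite I" "d \<in> I" "\<And>q e f. g q e f = g q f e"
  shows "riemann_up I g k d a b p =
     partial a (christoffel I g k b d) p - partial b (christoffel I g k a d) p
     + (\<Sum>e\<in>I. christoffel I g k a e p * christoffel I g e b d p)
     - (\<Sum>e\<in>I. christoffel I g k b e p * christoffel I g e a d p)"
  using christoffel_sym[of g I _ a b] assms
  by (simp add: riemann_up_def nabla2_def nabla_coord_field)


section \<open>Algebra of 4-tensors\<close>

definition riemann_symmetric :: "'i set \<Rightarrow> ('i \<Rightarrow> 'i \<Rightarrow> 'i \<Rightarrow> 'i \<Rightarrow> real) \<Rightarrow> bool" where
  "riemann_symmetric I r \<longleftrightarrow> (\<forall>a\<in>I. \<forall>b\<in>I. \<forall>c\<in>I. \<forall>d\<in>I.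
     r a b c d = (r a b c d - r b a c d - r a b d c + r b a d c) / 4 \<and>
     r a b c d = r c d a b \<and>
     (r a b c d + r a c d b + r a d b c - r a b d c - r a c b d - r a d c b) / 6 = 0)"

definition odot_antisym ::
  "('i \<Rightarrow> 'i \<Rightarrow> real) \<Rightarrow> ('i \<Rightarrow> 'i \<Rightarrow> real) \<Rightarrow> 'i \<Rightarrow> 'i \<Rightarrow> 'i \<Rightarrow> 'i \<Rightarrow> real" where
  "odot_antisym h f a b c d =
     1/4 * h a b * f c d + 1/4 * f a b * h c d
     + 1/8 * h a c * f b d + 1/8 * f a c * h b d
     - 1/8 * h a d * f b c - 1/8 * f a d * h b c"

definition odot_sym ::
  "('i \<Rightarrow> 'i \<Rightarrow> real) \<Rightarrow> ('i \<Rightarrow> 'i \<Rightarrow> real) \<Rightarrow> 'i \<Rightarrow> 'i \<Rightarrow> 'i \<Rightarrow> 'i \<Rightarrow> real" where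
  "odot_sym Q k a b c d =
     1/8 * Q a d * k b c + 1/8 * k a d * Q b c
     - 1/8 * Q a c * k b d - 1/8 * k a c * Q b d"


section \<open>The off-shell Kerr-NUT-(A)dS metric\<close>

text \<open>\<open>XC \<mu>\<close> labels the coordinate \<open>x\<^sub>\<mu>\<close> and \<open>PsiC k\<close> the coordinate \<open>\<psi>\<^sub>k\<close>. The dimension is
  \<open>2 * n + \<epsilon>\<close> with \<open>\<epsilon> \<in> {0, 1}\<close>.\<close>

datatype coord = XC nat | PsiC nat

definition coords :: "nat \<Rightarrow> nat \<Rightarrow> coord set" where
  "coords n \<epsilon> = XC ` {1..n} \<union> PsiC ` {..<n + \<epsilon>}"

definition dx :: "nat \<Rightarrow> coord \<Rightarrow> real" where
  "dx \<mu> a = (if a = XC \<mu> then 1 else 0)"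

definition dpsi :: "nat \<Rightarrow> coord \<Rightarrow> real" where
  "dpsi k a = (if a = PsiC k then 1 else 0)"

definition A_sym :: "nat \<Rightarrow> nat \<Rightarrow> (coord \<Rightarrow> real) \<Rightarrow> real" where
  "A_sym n k p = (\<Sum>S | S \<subseteq> {1..n} \<and> card S = k. \<Prod>\<nu>\<in>S. (p (XC \<nu>))\<^sup>2)"

definition A_sub :: "nat \<Rightarrow> nat \<Rightarrow> nat \<Rightarrow> (coord \<Rightarrow> real) \<Rightarrow> real" where
  "A_sub n k \<mu> p = (\<Sum>S | S \<subseteq> {1..n} - {\<mu>} \<and> card S = k. \<Prod>\<nu>\<in>S. (p (XC \<nu>))\<^sup>2)"

definition U_fun :: "nat \<Rightarrow> nat \<Rightarrow> (coord \<Rightarrow> real) \<Rightarrow> real" where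
  "U_fun n \<mu> p = (\<Prod>\<nu>\<in>{1..n} - {\<mu>}. (p (XC \<nu>))\<^sup>2 - (p (XC \<mu>))\<^sup>2)"

definition kerr_metric ::
  "nat \<Rightarrow> nat \<Rightarrow> real \<Rightarrow> (nat \<Rightarrow> real \<Rightarrow> real) \<Rightarrow> (coord \<Rightarrow> real) \<Rightarrow> coord \<Rightarrow> coord \<Rightarrow> real" where
  "kerr_metric n \<epsilon> c X p a b =
     (\<Sum>\<mu>=1..n.
        U_fun n \<mu> p / X \<mu> (p (XC \<mu>)) * (dx \<mu> a * dx \<mu> b)
        + X \<mu> (p (XC \<mu>)) / U_fun n \<mu> p *
          ((\<Sum>k<n. A_sub n k \<mu> p * dpsi k a) * (\<Sum>k<n. A_sub n k \<mu> p * dpsi k b)))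
     + real \<epsilon> * (c / A_sym n n p) *
          ((\<Sum>k\<le>n. A_sym n k p * dpsi k a) * (\<Sum>k\<le>n. A_sym n k p * dpsi k b))"

definition smooth_fun_on :: "real set \<Rightarrow> (real \<Rightarrow> real) \<Rightarrow> bool" where
  "smooth_fun_on J f \<longleftrightarrow> (\<forall>m. \<forall>t\<in>J. (deriv ^^ m) f field_differentiable at t)"

text \<open>The coordinate range, where \<open>X\<^sub>\<mu>\<close> is a function on \<open>J \<mu>\<close>.\<close>

definition kerr_domain ::
  "nat \<Rightarrow> nat \<Rightarrow> real \<Rightarrow> (nat \<Rightarrow> real \<Rightarrow> real) \<Rightarrow> (nat \<Rightarrow> real set) \<Rightarrow> (coord \<Rightarrow> real) set" where
  "kerr_domain n \<epsilon> c X J = {p.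
     (\<forall>\<mu>\<in>{1..n}. p (XC \<mu>) \<in> J \<mu> \<and> U_fun n \<mu> p \<noteq> 0 \<and> X \<mu> (p (XC \<mu>)) \<noteq> 0) \<and>
     (\<epsilon> = 1 \<longrightarrow> A_sym n n p \<noteq> 0) \<and>
     pos_def (coords n \<epsilon>) (kerr_metric n \<epsilon> c X p)}"

text \<open>Darboux coframe.\<close>

definition e_frame ::
  "nat \<Rightarrow> (nat \<Rightarrow> real \<Rightarrow> real) \<Rightarrow> nat \<Rightarrow> (coord \<Rightarrow> real) \<Rightarrow> coord \<Rightarrow> real" where
  "e_frame n X \<mu> p a = sqrt (U_fun n \<mu> p / X \<mu> (p (XC \<mu>))) * dx \<mu> a"

definition ehat_frame ::
  "nat \<Rightarrow> (nat \<Rightarrow> real \<Rightarrow> real) \<Rightarrow> nat \<Rightarrow> (coord \<Rightarrow> real) \<Rightarrow> coord \<Rightarrow> real" where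
  "ehat_frame n X \<mu> p a =
     sqrt (X \<mu> (p (XC \<mu>)) / U_fun n \<mu> p) * (\<Sum>k<n. A_sub n k \<mu> p * dpsi k a)"

definition ehat0_frame :: "nat \<Rightarrow> real \<Rightarrow> (coord \<Rightarrow> real) \<Rightarrow> coord \<Rightarrow> real" where
  "ehat0_frame n c p a = sqrt (c / A_sym n n p) * (\<Sum>k\<le>n. A_sym n k p * dpsi k a)"

definition h_form ::
  "nat \<Rightarrow> (nat \<Rightarrow> real \<Rightarrow> real) \<Rightarrow> nat \<Rightarrow> (coord \<Rightarrow> real) \<Rightarrow> coord \<Rightarrow> coord \<Rightarrow> real" where
  "h_form n X \<mu> p a b =
     e_frame n X \<mu> p a * ehat_frame n X \<mu> p b - ehat_frame n X \<mu> p a * e_frame n X \<mu> p b"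

definition Q_form ::
  "nat \<Rightarrow> (nat \<Rightarrow> real \<Rightarrow> real) \<Rightarrow> nat \<Rightarrow> (coord \<Rightarrow> real) \<Rightarrow> coord \<Rightarrow> coord \<Rightarrow> real" where
  "Q_form n X \<mu> p a b =
     e_frame n X \<mu> p a * e_frame n X \<mu> p b + ehat_frame n X \<mu> p a * ehat_frame n X \<mu> p b"

definition Q_eps ::
  "nat \<Rightarrow> nat \<Rightarrow> real \<Rightarrow> (nat \<Rightarrow> real \<Rightarrow> real) \<Rightarrow> (coord \<Rightarrow> real) \<Rightarrow> coord \<Rightarrow> coord \<Rightarrow> real" where
  "Q_eps n \<epsilon> c X p a b = real \<epsilon> * kerr_metric n \<epsilon> c X p a b"


section \<open>Totally zero weight\<close>

text \<open>Labels of the complex frame covectors. \<open>Zero\<close> (the label of \<open>ehat0_frame\<close>) exists only if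
  \<open>\<epsilon> = 1\<close>.\<close>

datatype leg = Plus nat | Minus nat | Zero

definition legs :: "nat \<Rightarrow> nat \<Rightarrow> leg set" where
  "legs n \<epsilon> = Plus ` {1..n} \<union> Minus ` {1..n} \<union> (if \<epsilon> = 1 then {Zero} else {})"

fun leg_form ::
  "nat \<Rightarrow> real \<Rightarrow> (nat \<Rightarrow> real \<Rightarrow> real) \<Rightarrow> (coord \<Rightarrow> real) \<Rightarrow> leg \<Rightarrow> coord \<Rightarrow> complex" where
  "leg_form n c X p (Plus \<mu>) a = of_real (e_frame n X \<mu> p a) + \<i> * of_real (ehat_frame n X \<mu> p a)"
| "leg_form n c X p (Minus \<mu>) a = of_real (e_frame n X \<mu> p a) - \<i> * of_real (ehat_frame n X \<mu> p a)"
| "leg_form n c X p Zero a = of_real (ehat0_frame n c p a)"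

definition balanced :: "nat \<Rightarrow> leg list \<Rightarrow> bool" where
  "balanced n w \<longleftrightarrow> (\<forall>\<mu>\<in>{1..n}. count_list w (Plus \<mu>) = count_list w (Minus \<mu>))"

text \<open>A word of four legs is a rank 4 tensor monomial; \<open>C\<close> collects the coefficients of a linear
  combination.\<close>

definition totally_zero_weight ::
  "nat \<Rightarrow> nat \<Rightarrow> real \<Rightarrow> (nat \<Rightarrow> real \<Rightarrow> real) \<Rightarrow> (coord \<Rightarrow> real) \<Rightarrow>
    (coord \<Rightarrow> coord \<Rightarrow> coord \<Rightarrow> coord \<Rightarrow> complex) \<Rightarrow> bool" where
  "totally_zero_weight n \<epsilon> c X p T \<longleftrightarrow>
     (\<exists>C :: leg list \<Rightarrow> complex.
        \<forall>i\<in>coords n \<epsilon>. \<forall>j\<in>coords n \<epsilon>. \<forall>k\<in>coords n \<epsilon>. \<forall>l\<in>coords n \<epsilon>.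
          T i j k l =
            (\<Sum>w | length w = 4 \<and> set w \<subseteq> legs n \<epsilon> \<and> balanced n w.
               C w * leg_form n c X p (w ! 0) i * leg_form n c X p (w ! 1) j
                   * leg_form n c X p (w ! 2) k * leg_form n c X p (w ! 3) l))"


section \<open>Curvature coefficients\<close>

definition M_fun ::
  "nat \<Rightarrow> nat \<Rightarrow> real \<Rightarrow> (nat \<Rightarrow> real \<Rightarrow> real) \<Rightarrow> (coord \<Rightarrow> real) \<Rightarrow> real" where
  "M_fun n \<epsilon> c X p = (\<Sum>\<mu>=1..n. X \<mu> (p (XC \<mu>)) / U_fun n \<mu> p) + real \<epsilon> * (c / A_sym n n p)"

definition S_fun ::
  "nat \<Rightarrow> nat \<Rightarrow> real \<Rightarrow> (nat \<Rightarrow> real \<Rightarrow> real) \<Rightarrow> nat \<Rightarrow> nat \<Rightarrow> (coord \<Rightarrow> real) \<Rightarrow> real" where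
  "S_fun n \<epsilon> c X \<mu> \<nu> p =
     - ((p (XC \<mu>) * partial (XC \<mu>) (M_fun n \<epsilon> c X) p - p (XC \<nu>) * partial (XC \<nu>) (M_fun n \<epsilon> c X) p)
        / (2 * ((p (XC \<mu>))\<^sup>2 - (p (XC \<nu>))\<^sup>2)))"

definition F_fun ::
  "nat \<Rightarrow> nat \<Rightarrow> real \<Rightarrow> (nat \<Rightarrow> real \<Rightarrow> real) \<Rightarrow> nat \<Rightarrow> nat \<Rightarrow> (coord \<Rightarrow> real) \<Rightarrow> real" where
  "F_fun n \<epsilon> c X \<mu> \<nu> p =
     (p (XC \<mu>) * partial (XC \<nu>) (M_fun n \<epsilon> c X) p - p (XC \<nu>) * partial (XC \<mu>) (M_fun n \<epsilon> c X) p)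
        / (2 * ((p (XC \<mu>))\<^sup>2 - (p (XC \<nu>))\<^sup>2))"

definition D_fun ::
  "nat \<Rightarrow> nat \<Rightarrow> real \<Rightarrow> (nat \<Rightarrow> real \<Rightarrow> real) \<Rightarrow> nat \<Rightarrow> (coord \<Rightarrow> real) \<Rightarrow> real" where
  "D_fun n \<epsilon> c X \<mu> p = - (1/2) * partial (XC \<mu>) (partial (XC \<mu>) (M_fun n \<epsilon> c X)) p"

text \<open>\<open>E_fun\<close> is only used with the factor \<open>\<epsilon>\<close>; for \<open>\<epsilon> = 1\<close> all \<open>x\<^sub>\<mu>\<close> are nonzero on the domain.\<close>

definition E_fun ::
  "nat \<Rightarrow> nat \<Rightarrow> real \<Rightarrow> (nat \<Rightarrow> real \<Rightarrow> real) \<Rightarrow> nat \<Rightarrow> (coord \<Rightarrow> real) \<Rightarrow> real" where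
  "E_fun n \<epsilon> c X \<mu> p = - (1 / (2 * p (XC \<mu>))) * partial (XC \<mu>) (M_fun n \<epsilon> c X) p"

definition Omega ::
  "nat \<Rightarrow> nat \<Rightarrow> real \<Rightarrow> (nat \<Rightarrow> real \<Rightarrow> real) \<Rightarrow> nat \<Rightarrow> nat \<Rightarrow> (coord \<Rightarrow> real) \<Rightarrow> real" where
  "Omega n \<epsilon> c X \<mu> \<nu> p =
     (if \<mu> = \<nu> then 8/3 * (D_fun n \<epsilon> c X \<mu> p - 2 * real \<epsilon> * E_fun n \<epsilon> c X \<mu> p)
      else 8 * F_fun n \<epsilon> c X \<mu> \<nu> p)"

definition alpha ::
  "nat \<Rightarrow> nat \<Rightarrow> real \<Rightarrow> (nat \<Rightarrow> real \<Rightarrow> real) \<Rightarrow> nat \<Rightarrow> nat \<Rightarrow> (coord \<Rightarrow> real) \<Rightarrow> real" where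
  "alpha n \<epsilon> c X \<mu> \<nu> p =
     - 8 * S_fun n \<epsilon> c X \<mu> \<nu> p + 8 * real \<epsilon> * (E_fun n \<epsilon> c X \<mu> p + E_fun n \<epsilon> c X \<nu> p)"

definition alpha_eps ::
  "nat \<Rightarrow> nat \<Rightarrow> real \<Rightarrow> (nat \<Rightarrow> real \<Rightarrow> real) \<Rightarrow> nat \<Rightarrow> (coord \<Rightarrow> real) \<Rightarrow> real" where
  "alpha_eps n \<epsilon> c X \<mu> p = - 8 * real \<epsilon> * E_fun n \<epsilon> c X \<mu> p"

end

theory Submission
  imports Defs
begin

text \<open>
  Write \<open>K = {1..n}\<close>, \<open>N = K\<close> if \<open>\<epsilon> = 0\<close> and \<open>N = {0} \<union> K\<close> with \<open>x\<^sub>0 = 0\<close> if \<open>\<epsilon> = 1\<close>. With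
  \<open>\<lambda>\<^sub>\<mu> = X\<^sub>\<mu> / U\<^sub>\<mu>\<close>, \<open>\<lambda>\<^sub>0 = c / A\<^sup>(\<^sup>n\<^sup>)\<close>, and \<open>w\<^sub>A\<close> the covector whose \<open>d\<psi>\<^sub>k\<close> component is the \<open>k\<close>-th
  elementary symmetric function of the \<open>x\<^sub>\<nu>\<^sup>2\<close>, \<open>\<nu> \<in> N - {A}\<close>, the metric is
  \<open>\<Sum>\<^sub>\<mu>\<^sub>\<in>\<^sub>K dx\<^sub>\<mu>\<^sup>2 / \<lambda>\<^sub>\<mu> + \<Sum>\<^sub>A\<^sub>\<in>\<^sub>N \<lambda>\<^sub>A w\<^sub>A\<^sup>2\<close>, and \<open>M = \<Sum>\<^sub>A\<^sub>\<in>\<^sub>N \<lambda>\<^sub>A\<close>. Thus the odd-dimensional metric has the shape of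
  an even-dimensional one with one more label, restricted to \<open>x\<^sub>0 = 0\<close>; both parities are treated
  together, and the term \<open>E\<^sub>\<mu>\<close> of the odd case is nothing but \<open>S\<^sub>\<mu>\<^sub>0\<close>.

  The proof rests on the fact that differentiation closes up on these objects. With
  \<open>\<kappa>\<^sub>\<mu>\<^sub>A = 2 x\<^sub>\<mu> / (x\<^sub>\<mu>\<^sup>2 - x\<^sub>A\<^sup>2)\<close> one has \<open>\<partial>\<^sub>\<mu> w\<^sub>A = \<kappa>\<^sub>\<mu>\<^sub>A (w\<^sub>A - w\<^sub>\<mu>)\<close> and \<open>\<partial>\<^sub>\<mu> \<lambda>\<^sub>A = - \<kappa>\<^sub>\<mu>\<^sub>A \<lambda>\<^sub>A\<close> for
  \<open>A \<noteq> \<mu>\<close> (lemmas \<open>w_partial\<close>, \<open>lam_partial\<close>); derivatives of \<open>X\<^sub>\<mu>\<close> occur only in \<open>\<partial>\<^sub>\<mu> \<lambda>\<^sub>\<mu>\<close> and \<open>\<partial>\<^sub>\<mu>\<^sup>2 \<lambda>\<^sub>\<mu>\<close>. Hence the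
  first and second derivatives of the metric at a point, contracted with the vectors dual to
  \<open>dx\<^sub>\<mu>\<close> and \<open>w\<^sub>A\<close> at that point, are explicit and mostly zero: \<open>\<partial>\<^sub>\<mu>\<close> of the \<open>\<psi>\<close>-block is an arrow
  matrix with its head in row and column \<open>\<mu>\<close> (\<open>hd1_diag\<close>, \<open>hd1_off\<close>).

  Since the dual vectors are kept constant, the curvature is obtained from these
  arrays by the classical formula with second derivatives of the metric and products of Christoffel
  symbols of the first kind (\<open>riemann_eq_chris1\<close>, \<open>riemann_contracted\<close>). The components are then
  computed one by one. Contributions of three different labels cancel by the identity
  \<open>\<kappa>\<^sub>a\<^sub>b \<kappa>\<^sub>a\<^sub>c + \<kappa>\<^sub>b\<^sub>a \<kappa>\<^sub>b\<^sub>c + \<kappa>\<^sub>c\<^sub>a \<kappa>\<^sub>c\<^sub>b = 0\<close>, and the remaining sums \<open>\<Sum>\<^sub>C \<kappa>\<^sub>a\<^sub>C \<lambda>\<^sub>C\<close> combine with \<open>\<partial>\<^sub>a \<lambda>\<^sub>a\<close> to \<open>\<partial>\<^sub>a M\<close>,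
  which is how \<open>S\<close>, \<open>F\<close> and \<open>D\<close> arise. The symmetries of the curvature and the Bianchi identity leave
  only the index types \<open>xxxx\<close>, \<open>x\<psi>x\<psi>\<close> and \<open>\<psi>\<psi>\<psi>\<psi>\<close> to be examined (\<open>curvature_like_eqI_split\<close>, \<open>R_eq_T\<close>).

  The outcome is \<open>riemann_eq_zero_weight_curvature\<close>: the curvature is a combination of products of two
  forms \<open>h\<^sub>a\<close> and of two forms \<open>Q\<^sub>a\<close>. Riemann symmetry is read off from this shape, and so is the zero
  weight, because \<open>h\<^sub>a\<close> and \<open>Q\<^sub>a\<close> only pair a leg with its conjugate. The formula with
  \<open>\<Omega>\<close> and \<open>\<alpha>\<close> is a regrouping (\<open>riemann_formula\<close>): as \<open>g\<close> is the sum of all \<open>Q\<^sub>A\<close>, the terms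
  \<open>Q\<^sub>\<mu> \<odot> g\<close> contribute the wanted \<open>Q\<^sub>\<mu> \<odot> Q\<^sub>0\<close> and unwanted terms \<open>Q\<^sub>\<mu> \<odot> Q\<^sub>\<nu>\<close>, which the \<open>E\<close>-parts of
  \<open>\<alpha>\<^sub>\<mu>\<^sub>\<nu>\<close> and \<open>\<Omega>\<^sub>\<mu>\<^sub>\<mu>\<close> remove.
\<close>

section \<open>Partial derivatives along coordinate lines\<close>

text \<open>
  The value of \<open>partial\<close> is only meaningful for differentiable functions; this relation records
  differentiability along the coordinate line together with the derivative, so that it can be
  propagated by rules.
\<close>

definition has_partial :: "(('i \<Rightarrow> real) \<Rightarrow> real) \<Rightarrow> real \<Rightarrow> 'i \<Rightarrow> ('i \<Rightarrow> real) \<Rightarrow> bool" where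
  "has_partial f D a q \<longleftrightarrow> ((\<lambda>t. f (q(a := t))) has_real_derivative D) (at (q a))"

lemma has_partial_imp_partial: "has_partial f D a q \<Longrightarrow> partial a f q = D"
  by (simp add: has_partial_def partial_def DERIV_imp_deriv)

lemma has_partial_const: "has_partial (\<lambda>r. k) 0 a q"
  by (simp add: has_partial_def)

lemma has_partial_add:
  "has_partial f D a q \<Longrightarrow> has_partial g D' a q \<Longrightarrow> has_partial (\<lambda>r. f r + g r) (D + D') a q"
  unfolding has_partial_def by (rule DERIV_add)

lemma has_partial_diff:
  "has_partial f D a q \<Longrightarrow> has_partial g D' a q \<Longrightarrow> has_partial (\<lambda>r. f r - g r) (D - D') a q"
  unfolding has_partial_def by (rule DERIV_diff)

lemma has_partial_minus: "has_partial f D a q \<Longrightarrow> has_partial (\<lambda>r. - f r) (- D) a q"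
  unfolding has_partial_def by (rule DERIV_minus)

lemma has_partial_mult:
  "has_partial f D a q \<Longrightarrow> has_partial g D' a q \<Longrightarrow>
    has_partial (\<lambda>r. f r * g r) (D * g q + D' * f q) a q"
  unfolding has_partial_def by (drule (1) DERIV_mult) simp

lemma has_partial_cmult: "has_partial f D a q \<Longrightarrow> has_partial (\<lambda>r. k * f r) (k * D) a q"
  using has_partial_mult[OF has_partial_const, of f D a q k] by (simp add: mult.commute)

lemma has_partial_sum:
  "(\<And>s. s \<in> S \<Longrightarrow> has_partial (f s) (D s) a q) \<Longrightarrow>
    has_partial (\<lambda>r. \<Sum>s\<in>S. f s r) (\<Sum>s\<in>S. D s) a q"
  unfolding has_partial_def by (rule DERIV_sum)

lemma has_partial_divide:
  "has_partial f D a q \<Longrightarrow> has_partial g D' a q \<Longrightarrow> g q \<noteq> 0 \<Longrightarrow>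
    has_partial (\<lambda>r. f r / g r) ((D * g q - f q * D') / (g q * g q)) a q"
  unfolding has_partial_def by (drule (1) DERIV_divide) auto

lemma has_partial_inverse:
  "has_partial f D a q \<Longrightarrow> f q \<noteq> 0 \<Longrightarrow> has_partial (\<lambda>r. 1 / f r) (- D / (f q * f q)) a q"
  using has_partial_divide[OF has_partial_const, of f D a q 1] by simp

lemma has_partial_power2:
  "has_partial f D a q \<Longrightarrow> has_partial (\<lambda>r. (f r)\<^sup>2) (2 * f q * D) a q"
  using has_partial_mult[of f D a q f D] by (simp add: power2_eq_square algebra_simps)

lemma has_partial_eq: "has_partial f D a q \<Longrightarrow> D = D' \<Longrightarrow> has_partial f D' a q"
  by simp

text \<open>
  Partial derivatives only see a function along coordinate lines, so this weak form of openness is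
  enough to replace a function by one that agrees with it on \<open>\<D>\<close>.
\<close>

definition line_open :: "('i \<Rightarrow> real) set \<Rightarrow> bool" where
  "line_open \<D> \<longleftrightarrow> (\<forall>q\<in>\<D>. \<forall>a. \<forall>\<^sub>F t in nhds (q a). q(a := t) \<in> \<D>)"

lemma has_partial_cong_on:
  assumes "line_open \<D>" "q \<in> \<D>" "\<And>r. r \<in> \<D> \<Longrightarrow> f r = g r" "has_partial f D a q"
  shows "has_partial g D a q"
proof -
  have "\<forall>\<^sub>F t in nhds (q a). q(a := t) \<in> \<D>"
    using assms(1,2) unfolding line_open_def by blast
  then have "\<forall>\<^sub>F t in nhds (q a). f (q(a := t)) = g (q(a := t))"
    by (rule eventually_mono) (rule assms(3))
  then show ?thesis
    using assms(4) unfolding has_partial_def by (subst DERIV_cong_ev[OF refl _ refl]) (auto simp: eq_commute)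
qed

text \<open>
  Contraction of one tensor index with a vector. The rules below push contractions through sums
  and products; \<open>ctr_swap\<close> is applied only to explicit pairs of vectors, since it does not terminate
  as a rewrite rule.
\<close>

definition ctr :: "'i set \<Rightarrow> ('i \<Rightarrow> real) \<Rightarrow> ('i \<Rightarrow> real) \<Rightarrow> real" where
  "ctr I v f = (\<Sum>i\<in>I. v i * f i)"

lemma ctr_add: "ctr I v (\<lambda>i. f i + g i) = ctr I v f + ctr I v g"
  by (simp add: ctr_def algebra_simps sum.distrib)
lemma ctr_diff: "ctr I v (\<lambda>i. f i - g i) = ctr I v f - ctr I v g"
  by (simp add: ctr_def algebra_simps sum_subtractf)
lemma ctr_mult_left: "ctr I v (\<lambda>i. k * f i) = k * ctr I v f"
  unfolding ctr_def sum_distrib_left by (simp add: mult.left_commute)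
lemma ctr_mult_right: "ctr I v (\<lambda>i. f i * k) = ctr I v f * k"
  unfolding ctr_def sum_distrib_right by (simp add: mult.assoc)
lemma ctr_divide: "ctr I v (\<lambda>i. f i / k) = ctr I v f / k"
  by (simp add: ctr_def sum_divide_distrib)
lemma ctr_sum: "ctr I v (\<lambda>i. \<Sum>s\<in>S. f s i) = (\<Sum>s\<in>S. ctr I v (f s))"
  unfolding ctr_def sum_distrib_left by (rule sum.swap)
lemma ctr_zero: "ctr I v (\<lambda>i. 0) = 0"
  by (simp add: ctr_def)
lemma ctr_swap: "ctr I v (\<lambda>i. ctr I w (\<lambda>j. f i j)) = ctr I w (\<lambda>j. ctr I v (\<lambda>i. f i j))"
  unfolding ctr_def sum_distrib_left by (subst sum.swap) (simp add: mult.left_commute)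

lemmas ctr_simps = ctr_add ctr_diff ctr_mult_left ctr_mult_right ctr_divide ctr_sum ctr_zero

lemma metric_inverse_unique:
  assumes fin: "finite I"
    and off: "\<And>a b. a \<notin> I \<or> b \<notin> I \<Longrightarrow> H a b = 0"
    and left: "\<And>a b. a \<in> I \<Longrightarrow> b \<in> I \<Longrightarrow> (\<Sum>d\<in>I. G a d * H d b) = (if a = b then 1 else 0)"
    and right: "\<And>a b. a \<in> I \<Longrightarrow> b \<in> I \<Longrightarrow> (\<Sum>d\<in>I. H a d * G d b) = (if a = b then 1 else 0)"
  shows "metric_inverse I G = H"
  unfolding metric_inverse_def
proof (rule the_equality)
  show "(\<forall>a b. a \<notin> I \<or> b \<notin> I \<longrightarrow> H a b = 0) \<and>
     (\<forall>a\<in>I. \<forall>b\<in>I. (\<Sum>d\<in>I. G a d * H d b) = (if a = b then 1 else 0)) \<and>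
     (\<forall>a\<in>I. \<forall>b\<in>I. (\<Sum>d\<in>I. H a d * G d b) = (if a = b then 1 else 0))"
    using off left right by auto
next
  fix H'
  assume H': "(\<forall>a b. a \<notin> I \<or> b \<notin> I \<longrightarrow> H' a b = 0) \<and>
     (\<forall>a\<in>I. \<forall>b\<in>I. (\<Sum>d\<in>I. G a d * H' d b) = (if a = b then 1 else 0)) \<and>
     (\<forall>a\<in>I. \<forall>b\<in>I. (\<Sum>d\<in>I. H' a d * G d b) = (if a = b then 1 else 0))"
  have "H' a b = H a b" if "a \<in> I" "b \<in> I" for a b
  proof -
    have "H' a b = (\<Sum>d\<in>I. H' a d * (if d = b then 1 else 0))"
      using fin that by (simp add: if_distrib[of "\<lambda>t. _ * t"] cong: if_cong)
    also have "\<dots> = (\<Sum>d\<in>I. H' a d * (\<Sum>e\<in>I. G d e * H e b))"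
      using left that by (intro sum.cong) auto
    also have "\<dots> = (\<Sum>e\<in>I. (\<Sum>d\<in>I. H' a d * G d e) * H e b)"
      unfolding sum_distrib_left sum_distrib_right
      by (subst sum.swap) (simp add: mult.assoc)
    also have "\<dots> = (\<Sum>e\<in>I. (if a = e then 1 else 0) * H e b)"
      using H' that by (intro sum.cong) auto
    also have "\<dots> = H a b"
      using fin that by (simp add: if_distrib[of "\<lambda>t. t * _"] cong: if_cong)
    finally show ?thesis .
  qed
  then show "H' = H" using H' off by (intro ext) metis
qed

text \<open>
  The metric comes with explicit arrays for its inverse and its first two derivatives. Of the
  derivatives of the inverse only the existence matters: \<open>christoffel\<close> has to be differentiable, but these
  derivatives cancel from the curvature.
\<close>

locale metric_chart =
  fixes I :: "'i set" and \<D> :: "('i \<Rightarrow> real) set" and g :: "('i \<Rightarrow> real) \<Rightarrow> 'i \<Rightarrow> 'i \<Rightarrow> real"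
    and ginv :: "('i \<Rightarrow> real) \<Rightarrow> 'i \<Rightarrow> 'i \<Rightarrow> real"
    and dg :: "('i \<Rightarrow> real) \<Rightarrow> 'i \<Rightarrow> 'i \<Rightarrow> 'i \<Rightarrow> real"
    and d2g :: "('i \<Rightarrow> real) \<Rightarrow> 'i \<Rightarrow> 'i \<Rightarrow> 'i \<Rightarrow> 'i \<Rightarrow> real"
  assumes fin: "finite I" and op: "line_open \<D>"
    and g_sym: "g q a b = g q b a"
    and dg: "q \<in> \<D> \<Longrightarrow> a \<in> I \<Longrightarrow> has_partial (\<lambda>r. g r i j) (dg q a i j) a q"
    and d2g: "q \<in> \<D> \<Longrightarrow> a \<in> I \<Longrightarrow> b \<in> I \<Longrightarrow> has_partial (\<lambda>r. dg r b i j) (d2g q a b i j) a q"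
    and ginv_off: "a \<notin> I \<or> b \<notin> I \<Longrightarrow> ginv q a b = 0"
    and ginv_sym: "ginv q a b = ginv q b a"
    and g_ginv: "q \<in> \<D> \<Longrightarrow> a \<in> I \<Longrightarrow> b \<in> I \<Longrightarrow>
          (\<Sum>d\<in>I. g q a d * ginv q d b) = (if a = b then 1 else 0)"
    and ginv_diff: "q \<in> \<D> \<Longrightarrow> a \<in> I \<Longrightarrow> b \<in> I \<Longrightarrow> k \<in> I \<Longrightarrow> \<exists>D. has_partial (\<lambda>r. ginv r a b) D k q"
begin

text \<open>
  Christoffel symbols of the first kind; the first index is the lowered one.
\<close>

definition chris1 :: "('i \<Rightarrow> real) \<Rightarrow> 'i \<Rightarrow> 'i \<Rightarrow> 'i \<Rightarrow> real" where
  "chris1 q e a b = (dg q a e b + dg q b e a - dg q e a b) / 2"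

definition chris1_deriv :: "('i \<Rightarrow> real) \<Rightarrow> 'i \<Rightarrow> 'i \<Rightarrow> 'i \<Rightarrow> 'i \<Rightarrow> real" where
  "chris1_deriv q k e a b = (d2g q k a e b + d2g q k b e a - d2g q k e a b) / 2"

lemma metric_inverse_eq: "q \<in> \<D> \<Longrightarrow> metric_inverse I (g q) = ginv q"
proof (rule metric_inverse_unique[OF fin ginv_off])
  fix a b assume *: "q \<in> \<D>" "a \<in> I" "b \<in> I"
  show "(\<Sum>d\<in>I. g q a d * ginv q d b) = (if a = b then 1 else 0)" using g_ginv * .
  have "(\<Sum>d\<in>I. ginv q a d * g q d b) = (\<Sum>d\<in>I. g q b d * ginv q d a)"
    by (intro sum.cong refl) (metis g_sym ginv_sym mult.commute)
  then show "(\<Sum>d\<in>I. ginv q a d * g q d b) = (if a = b then 1 else 0)"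
    using g_ginv[of q b a] * by simp
qed

lemma christoffel_eq:
  assumes "q \<in> \<D>" "a \<in> I" "b \<in> I"
  shows "christoffel I g k a b q = (\<Sum>e\<in>I. ginv q k e * chris1 q e a b)"
  unfolding christoffel_def metric_inverse_eq[OF assms(1)]
  using assms by (intro sum.cong)
    (auto simp: chris1_def has_partial_imp_partial[OF dg])

lemma lower_christoffel:
  assumes "q \<in> \<D>" "i \<in> I" "a \<in> I" "b \<in> I"
  shows "(\<Sum>k\<in>I. g q i k * christoffel I g k a b q) = chris1 q i a b"
proof -
  have "(\<Sum>k\<in>I. g q i k * christoffel I g k a b q) =
        (\<Sum>e\<in>I. (\<Sum>k\<in>I. g q i k * ginv q k e) * chris1 q e a b)"
    unfolding sum_distrib_left sum_distrib_right christoffel_eq[OF assms(1,3,4)]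
    by (subst sum.swap) (simp add: mult.assoc)
  also have "\<dots> = (\<Sum>e\<in>I. (if i = e then 1 else 0) * chris1 q e a b)"
    using assms by (intro sum.cong) (auto simp: g_ginv)
  also have "\<dots> = chris1 q i a b"
    using fin assms by (simp add: if_distrib[of "\<lambda>t. t * _"] cong: if_cong)
  finally show ?thesis .
qed

lemma chris1_partial:
  assumes "q \<in> \<D>" "k \<in> I" "e \<in> I" "a \<in> I" "b \<in> I"
  shows "has_partial (\<lambda>r. chris1 r e a b) (chris1_deriv q k e a b) k q"
proof -
  have "has_partial (\<lambda>r. (1/2) * (dg r a e b + dg r b e a - dg r e a b))
     ((1/2) * (d2g q k a e b + d2g q k b e a - d2g q k e a b)) k q"
    by (intro has_partial_cmult has_partial_add has_partial_diff d2g assms)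
  then show ?thesis by (simp add: chris1_def chris1_deriv_def)
qed

lemma christoffel_diff:
  assumes "q \<in> \<D>" "k \<in> I" "e \<in> I" "a \<in> I" "b \<in> I"
  shows "has_partial (christoffel I g e a b) (partial k (christoffel I g e a b) q) k q"
proof -
  have "\<exists>D. has_partial (\<lambda>r. \<Sum>f\<in>I. ginv r e f * chris1 r f a b) D k q"
  proof -
    obtain D where D: "\<And>f. f \<in> I \<Longrightarrow> has_partial (\<lambda>r. ginv r e f) (D f) k q"
      using bchoice[of I "\<lambda>f D. has_partial (\<lambda>r. ginv r e f) D k q"]
        ginv_diff[OF assms(1,3) _ assms(2)] by blast
    have "has_partial (\<lambda>r. \<Sum>f\<in>I. ginv r e f * chris1 r f a b)
       (\<Sum>f\<in>I. D f * chris1 q f a b + chris1_deriv q k f a b * ginv q e f) k q"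
      by (intro has_partial_sum has_partial_mult D chris1_partial assms)
    then show ?thesis by blast
  qed
  then obtain D where "has_partial (\<lambda>r. \<Sum>f\<in>I. ginv r e f * chris1 r f a b) D k q" by blast
  then have "has_partial (christoffel I g e a b) D k q"
    by (rule has_partial_cong_on[OF op assms(1), rotated]) (simp add: christoffel_eq assms)
  then show ?thesis by (simp only: has_partial_imp_partial)
qed

lemma lower_christoffel_deriv:
  assumes "q \<in> \<D>" "k \<in> I" "i \<in> I" "a \<in> I" "b \<in> I"
  shows "(\<Sum>e\<in>I. g q i e * partial k (christoffel I g e a b) q) =
    chris1_deriv q k i a b - (\<Sum>e\<in>I. dg q k i e * christoffel I g e a b q)"
proof -
  have "has_partial (\<lambda>r. \<Sum>e\<in>I. g r i e * christoffel I g e a b r)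
     (\<Sum>e\<in>I. dg q k i e * christoffel I g e a b q + partial k (christoffel I g e a b) q * g q i e) k q"
    by (intro has_partial_sum has_partial_mult dg christoffel_diff assms)
  then have "has_partial (\<lambda>r. chris1 r i a b)
     (\<Sum>e\<in>I. dg q k i e * christoffel I g e a b q + partial k (christoffel I g e a b) q * g q i e) k q"
    by (rule has_partial_cong_on[OF op assms(1), rotated]) (simp add: lower_christoffel assms)
  then have "(\<Sum>e\<in>I. dg q k i e * christoffel I g e a b q + partial k (christoffel I g e a b) q * g q i e)
     = chris1_deriv q k i a b"
    using has_partial_imp_partial[OF chris1_partial[OF assms]] by (simp only: has_partial_imp_partial)
  then show ?thesis unfolding sum.distrib by (simp add: mult.commute)
qed

lemma dg_sym:
  assumes "q \<in> \<D>" "a \<in> I"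
  shows "dg q a i j = dg q a j i"
  using has_partial_imp_partial[OF dg[OF assms, of i j]] has_partial_imp_partial[OF dg[OF assms, of j i]]
  unfolding g_sym[of _ i j] by simp

text \<open>
  Lowering \<open>\<partial>\<^sub>a \<Gamma>\<^sup>k\<^sub>b\<^sub>j\<close> with the metric produces \<open>\<partial>\<^sub>a\<close> of the lowered symbol minus a term with \<open>\<partial>\<^sub>a g\<close>
  (\<open>lower_christoffel_deriv\<close>). That term and the product \<open>\<Gamma>\<Gamma>\<close> combine, because
  \<open>\<Gamma>\<^sub>i\<^sub>a\<^sub>e - \<partial>\<^sub>a g\<^sub>i\<^sub>e = - \<Gamma>\<^sub>e\<^sub>a\<^sub>i\<close>. In this form the derivative of the inverse metric has disappeared.
\<close>

lemma riemann_eq_chris1: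
  assumes q: "q \<in> \<D>" and I: "i \<in> I" "j \<in> I" "a \<in> I" "b \<in> I"
  shows "riemann I g q i j a b = chris1_deriv q a i b j - chris1_deriv q b i a j
    - (\<Sum>e\<in>I. \<Sum>f\<in>I. ginv q e f * chris1 q e a i * chris1 q f b j)
    + (\<Sum>e\<in>I. \<Sum>f\<in>I. ginv q e f * chris1 q e b i * chris1 q f a j)"
proof -
  have dg_chris: "(\<Sum>e\<in>I. chris1 q i c e * christoffel I g e d j q)
      - (\<Sum>e\<in>I. dg q c i e * christoffel I g e d j q)
      = - (\<Sum>e\<in>I. \<Sum>f\<in>I. ginv q e f * chris1 q e c i * chris1 q f d j)"
    if "c \<in> I" "d \<in> I" for c d
  proof -
    have "chris1 q i c e - dg q c i e = - chris1 q e c i" if "e \<in> I" for e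
      using dg_sym[OF q \<open>c \<in> I\<close>, of i e] dg_sym[OF q \<open>e \<in> I\<close>, of i c] dg_sym[OF q I(1), of c e]
      by (simp add: chris1_def field_simps)
    then have "(\<Sum>e\<in>I. chris1 q i c e * christoffel I g e d j q)
      - (\<Sum>e\<in>I. dg q c i e * christoffel I g e d j q)
       = (\<Sum>e\<in>I. - (chris1 q e c i * christoffel I g e d j q))"
      unfolding sum_subtractf[symmetric] by (intro sum.cong refl) (metis left_diff_distrib mult_minus_left)
    then show ?thesis
      using that I by (simp add: christoffel_eq[OF q] sum_negf sum_distrib_left mult.left_commute mult.assoc)
  qed
  have low2: "(\<Sum>e\<in>I. g q i e * (\<Sum>f\<in>I. christoffel I g e c f q * christoffel I g f d j q))
     = (\<Sum>f\<in>I. chris1 q i c f * christoffel I g f d j q)" if "c \<in> I" "d \<in> I" for c d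
  proof -
    have "(\<Sum>e\<in>I. g q i e * (\<Sum>f\<in>I. christoffel I g e c f q * christoffel I g f d j q))
      = (\<Sum>f\<in>I. (\<Sum>e\<in>I. g q i e * christoffel I g e c f q) * christoffel I g f d j q)"
      unfolding sum_distrib_left sum_distrib_right by (subst sum.swap) (simp add: mult.assoc)
    then show ?thesis using that I by (simp add: lower_christoffel[OF q])
  qed
  have "riemann I g q i j a b =
     (\<Sum>e\<in>I. g q i e * partial a (christoffel I g e b j) q)
     - (\<Sum>e\<in>I. g q i e * partial b (christoffel I g e a j) q)
     + (\<Sum>e\<in>I. g q i e * (\<Sum>f\<in>I. christoffel I g e a f q * christoffel I g f b j q))
     - (\<Sum>e\<in>I. g q i e * (\<Sum>f\<in>I. christoffel I g e b f q * christoffel I g f a j q))"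
    unfolding riemann_def riemann_up_christoffel[OF fin I(2) g_sym]
    by (simp only: distrib_left right_diff_distrib sum.distrib sum_subtractf)
  also have "\<dots> = chris1_deriv q a i b j - chris1_deriv q b i a j
     + ((\<Sum>e\<in>I. chris1 q i a e * christoffel I g e b j q)
        - (\<Sum>e\<in>I. dg q a i e * christoffel I g e b j q))
     - ((\<Sum>e\<in>I. chris1 q i b e * christoffel I g e a j q)
        - (\<Sum>e\<in>I. dg q b i e * christoffel I g e a j q))"
    using I by (simp add: lower_christoffel_deriv[OF q] low2)
  finally show ?thesis using I by (simp add: dg_chris)
qed

end


section \<open>Curvature components in a constant frame\<close>

text \<open>
  For vectors with constant components, the contracted derivatives of the metric behave like the
  derivatives of its components in new linear coordinates. Hence the coordinate formula for the
  curvature keeps its shape; \<open>w\<close> holds the diagonal of the inverse metric.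
\<close>

definition frame_chris :: "('f \<Rightarrow> 'f \<Rightarrow> 'f \<Rightarrow> real) \<Rightarrow> 'f \<Rightarrow> 'f \<Rightarrow> 'f \<Rightarrow> real" where
  "frame_chris d1 E F G = (d1 F E G + d1 G E F - d1 E F G) / 2"

definition frame_chris_deriv ::
  "('f \<Rightarrow> 'f \<Rightarrow> 'f \<Rightarrow> 'f \<Rightarrow> real) \<Rightarrow> 'f \<Rightarrow> 'f \<Rightarrow> 'f \<Rightarrow> 'f \<Rightarrow> real" where
  "frame_chris_deriv d2 H E F G = (d2 H F E G + d2 H G E F - d2 H E F G) / 2"

definition frame_riemann ::
  "'f set \<Rightarrow> ('f \<Rightarrow> real) \<Rightarrow> ('f \<Rightarrow> 'f \<Rightarrow> 'f \<Rightarrow> real) \<Rightarrow> ('f \<Rightarrow> 'f \<Rightarrow> 'f \<Rightarrow> 'f \<Rightarrow> real) \<Rightarrow>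
    'f \<Rightarrow> 'f \<Rightarrow> 'f \<Rightarrow> 'f \<Rightarrow> real" where
  "frame_riemann \<F> w d1 d2 F G H L =
     frame_chris_deriv d2 H F L G - frame_chris_deriv d2 L F H G
     - (\<Sum>E\<in>\<F>. w E * frame_chris d1 E H F * frame_chris d1 E L G)
     + (\<Sum>E\<in>\<F>. w E * frame_chris d1 E L F * frame_chris d1 E H G)"

lemma ctr_cong: "(\<And>i. i \<in> I \<Longrightarrow> f i = h i) \<Longrightarrow> ctr I v f = ctr I v h"
  unfolding ctr_def by (intro sum.cong) auto

text \<open>
  The inverse metric is diagonal in the frame at the point \<open>q\<close>, so the double sum over coordinates
  in the quadratic terms turns into a single sum over frame labels.
\<close>

lemma (in metric_chart) riemann_contracted:
  assumes q: "q \<in> \<D>"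
    and ginv: "\<And>e f. e \<in> I \<Longrightarrow> f \<in> I \<Longrightarrow> ginv q e f = (\<Sum>F\<in>\<F>. w F * E F e * E F f)"
    and d1: "\<And>D F G. D \<in> \<F> \<Longrightarrow> F \<in> \<F> \<Longrightarrow> G \<in> \<F> \<Longrightarrow>
      ctr I (E D) (\<lambda>a. ctr I (E F) (\<lambda>i. ctr I (E G) (\<lambda>j. dg q a i j))) = d1 D F G"
    and d2: "\<And>C D F G. C \<in> \<F> \<Longrightarrow> D \<in> \<F> \<Longrightarrow> F \<in> \<F> \<Longrightarrow> G \<in> \<F> \<Longrightarrow>
      ctr I (E C) (\<lambda>a. ctr I (E D) (\<lambda>b. ctr I (E F) (\<lambda>i. ctr I (E G) (\<lambda>j. d2g q a b i j)))) = d2 C D F G"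
    and mem: "F \<in> \<F>" "G \<in> \<F>" "H \<in> \<F>" "L \<in> \<F>"
  shows "ctr I (E F) (\<lambda>i. ctr I (E G) (\<lambda>j. ctr I (E H) (\<lambda>a. ctr I (E L) (\<lambda>b.
            riemann I g q i j a b)))) = frame_riemann \<F> w d1 d2 F G H L"
proof -
  define K where "K = (\<lambda>D a i. ctr I (E D) (\<lambda>e. chris1 q e a i))"
  have K: "ctr I (E A) (\<lambda>a. ctr I (E B) (\<lambda>b. K D a b)) = frame_chris d1 D A B"
    if "D \<in> \<F>" "A \<in> \<F>" "B \<in> \<F>" for A B D
    unfolding K_def frame_chris_def chris1_def d1[OF that(2,1,3), symmetric]
      d1[OF that(3,1,2), symmetric] d1[OF that, symmetric]
    by (simp add: ctr_simps ctr_swap[of I "E D" "E A"] ctr_swap[of I "E D" "E B"]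
        ctr_swap[of I "E B" "E A"])
  have K': "ctr I (E B) (\<lambda>b. ctr I (E A) (\<lambda>a. K D a b)) = frame_chris d1 D A B"
    if "D \<in> \<F>" "A \<in> \<F>" "B \<in> \<F>" for A B D
    using K[OF that] by (subst ctr_swap)
  have quad: "(\<Sum>e\<in>I. \<Sum>f\<in>I. ginv q e f * chris1 q e a i * chris1 q f b j)
      = (\<Sum>D\<in>\<F>. w D * K D a i * K D b j)" for a i b j
  proof -
    have "(\<Sum>e\<in>I. \<Sum>f\<in>I. ginv q e f * chris1 q e a i * chris1 q f b j)
       = (\<Sum>e\<in>I. \<Sum>f\<in>I. \<Sum>D\<in>\<F>. w D * (E D e * chris1 q e a i) * (E D f * chris1 q f b j))"
      by (intro sum.cong refl) (simp add: ginv sum_distrib_right sum_distrib_left mult_ac)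
    also have "\<dots> = (\<Sum>e\<in>I. \<Sum>D\<in>\<F>. \<Sum>f\<in>I. w D * (E D e * chris1 q e a i) * (E D f * chris1 q f b j))"
      by (intro sum.cong refl sum.swap)
    also have "\<dots> = (\<Sum>D\<in>\<F>. \<Sum>e\<in>I. \<Sum>f\<in>I. w D * (E D e * chris1 q e a i) * (E D f * chris1 q f b j))"
      by (rule sum.swap)
    also have "\<dots> = (\<Sum>D\<in>\<F>. w D * K D a i * K D b j)"
      unfolding K_def ctr_def sum_distrib_left[symmetric] sum_distrib_right[symmetric] ..
    finally show ?thesis .
  qed
  have "ctr I (E F) (\<lambda>i. ctr I (E G) (\<lambda>j. ctr I (E H) (\<lambda>a. ctr I (E L) (\<lambda>b.
            riemann I g q i j a b))))
     = ctr I (E F) (\<lambda>i. ctr I (E G) (\<lambda>j. ctr I (E H) (\<lambda>a. ctr I (E L) (\<lambda>b.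
          chris1_deriv q a i b j - chris1_deriv q b i a j
          - (\<Sum>D\<in>\<F>. w D * K D a i * K D b j) + (\<Sum>D\<in>\<F>. w D * K D b i * K D a j)))))"
    by (intro ctr_cong) (simp add: riemann_eq_chris1[OF q] quad)
  also have "\<dots> = ctr I (E F) (\<lambda>i. ctr I (E G) (\<lambda>j. ctr I (E H) (\<lambda>a. ctr I (E L) (\<lambda>b.
          chris1_deriv q a i b j - chris1_deriv q b i a j))))
      - (\<Sum>D\<in>\<F>. w D * frame_chris d1 D H F * frame_chris d1 D L G)
      + (\<Sum>D\<in>\<F>. w D * frame_chris d1 D L F * frame_chris d1 D H G)"
    by (simp add: ctr_simps K' mem cong: sum.cong)
  also have "ctr I (E F) (\<lambda>i. ctr I (E G) (\<lambda>j. ctr I (E H) (\<lambda>a. ctr I (E L) (\<lambda>b.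
          chris1_deriv q a i b j - chris1_deriv q b i a j))))
      = frame_chris_deriv d2 H F L G - frame_chris_deriv d2 L F H G"
    unfolding frame_chris_deriv_def chris1_deriv_def
    by (simp add: d2[symmetric] mem) (simp add: ctr_simps
        ctr_swap[of I "E G" "E F"] ctr_swap[of I "E H" "E F"] ctr_swap[of I "E L" "E F"]
        ctr_swap[of I "E H" "E G"] ctr_swap[of I "E L" "E G"] ctr_swap[of I "E L" "E H"])
  finally show ?thesis by (simp add: frame_riemann_def)
qed

lemma ctr_separates:
  assumes fin: "finite I" "finite \<F>"
    and complete: "\<And>i j. i \<in> I \<Longrightarrow> j \<in> I \<Longrightarrow> (\<Sum>F\<in>\<F>. \<theta> F i * E F j) = (if i = j then 1 else 0)"
    and eq: "\<And>F. F \<in> \<F> \<Longrightarrow> ctr I (E F) f = ctr I (E F) h" and i: "i \<in> I"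
  shows "f i = h i"
proof -
  have expand: "u i = (\<Sum>F\<in>\<F>. \<theta> F i * ctr I (E F) u)" for u
  proof -
    have "(\<Sum>F\<in>\<F>. \<theta> F i * ctr I (E F) u) = (\<Sum>j\<in>I. (\<Sum>F\<in>\<F>. \<theta> F i * E F j) * u j)"
      unfolding ctr_def sum_distrib_left sum_distrib_right
      by (subst sum.swap) (simp add: mult.assoc)
    also have "\<dots> = (\<Sum>j\<in>I. (if i = j then 1 else 0) * u j)"
      using i by (intro sum.cong) (auto simp: complete)
    also have "\<dots> = u i"
      using fin i by (simp add: if_distrib[of "\<lambda>t. t * _"] cong: if_cong)
    finally show ?thesis ..
  qed
  show ?thesis by (subst (1 2) expand) (simp add: eq)
qed

text \<open>
  A frame with a dual coframe separates tensors: the indices are stripped off one at a time.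
\<close>

lemma tensor4_eqI:
  assumes fin: "finite I" "finite \<F>"
    and complete: "\<And>i j. i \<in> I \<Longrightarrow> j \<in> I \<Longrightarrow> (\<Sum>F\<in>\<F>. \<theta> F i * E F j) = (if i = j then 1 else 0)"
    and eq: "\<And>F G H L. F \<in> \<F> \<Longrightarrow> G \<in> \<F> \<Longrightarrow> H \<in> \<F> \<Longrightarrow> L \<in> \<F> \<Longrightarrow>
       ctr I (E F) (\<lambda>i. ctr I (E G) (\<lambda>j. ctr I (E H) (\<lambda>k. ctr I (E L) (\<lambda>l. S i j k l)))) =
       ctr I (E F) (\<lambda>i. ctr I (E G) (\<lambda>j. ctr I (E H) (\<lambda>k. ctr I (E L) (\<lambda>l. T i j k l))))"
    and mem: "i \<in> I" "j \<in> I" "k \<in> I" "l \<in> I"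
  shows "S i j k l = T i j k l"
proof -
  note sep = ctr_separates[OF fin complete]
  have 1: "ctr I (E G) (\<lambda>j. ctr I (E H) (\<lambda>k. ctr I (E L) (\<lambda>l. S i j k l))) =
       ctr I (E G) (\<lambda>j. ctr I (E H) (\<lambda>k. ctr I (E L) (\<lambda>l. T i j k l)))"
    if "G \<in> \<F>" "H \<in> \<F>" "L \<in> \<F>" for G H L
    by (rule sep[where f = "\<lambda>i. ctr I (E G) (\<lambda>j. ctr I (E H) (\<lambda>k. ctr I (E L) (\<lambda>l. S i j k l)))"])
      (use eq that mem in auto)
  have 2: "ctr I (E H) (\<lambda>k. ctr I (E L) (\<lambda>l. S i j k l)) = ctr I (E H) (\<lambda>k. ctr I (E L) (\<lambda>l. T i j k l))"
    if "H \<in> \<F>" "L \<in> \<F>" for H L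
    by (rule sep[where f = "\<lambda>j. ctr I (E H) (\<lambda>k. ctr I (E L) (\<lambda>l. S i j k l))"])
      (use 1 that mem in auto)
  have 3: "ctr I (E L) (\<lambda>l. S i j k l) = ctr I (E L) (\<lambda>l. T i j k l)" if "L \<in> \<F>" for L
    by (rule sep[where f = "\<lambda>k. ctr I (E L) (\<lambda>l. S i j k l)"]) (use 2 that mem in auto)
  show ?thesis
    by (rule sep[where f = "\<lambda>l. S i j k l"]) (use 3 mem in auto)
qed


section \<open>Algebraic curvature tensors\<close>

text \<open>
  The symmetries in \<open>riemann_symmetric\<close> as separate equations for single components instead of
  averages, ready for moving indices.
\<close>

definition curvature_like :: "'i set \<Rightarrow> ('i \<Rightarrow> 'i \<Rightarrow> 'i \<Rightarrow> 'i \<Rightarrow> real) \<Rightarrow> bool" where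
  "curvature_like I r \<longleftrightarrow> (\<forall>a\<in>I. \<forall>b\<in>I. \<forall>c\<in>I. \<forall>d\<in>I.
     r b a c d = - r a b c d \<and> r a b d c = - r a b c d \<and> r c d a b = r a b c d \<and>
     r a b c d + r a c d b + r a d b c = 0)"

lemma curvature_likeD:
  assumes "curvature_like I r" "a \<in> I" "b \<in> I" "c \<in> I" "d \<in> I"
  shows "r b a c d = - r a b c d" "r a b d c = - r a b c d" "r c d a b = r a b c d"
    "r a b c d + r a c d b + r a d b c = 0"
  using bspec[OF bspec[OF bspec[OF bspec[OF assms(1)[unfolded curvature_like_def] assms(2)] assms(3)] assms(4)] assms(5)]
  by - (elim conjE, assumption)+

lemma curvature_like_imp_riemann_symmetric:
  assumes "curvature_like I r"
  shows "riemann_symmetric I r"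
  unfolding riemann_symmetric_def
proof (intro ballI conjI)
  fix a b c d assume "a \<in> I" "b \<in> I" "c \<in> I" "d \<in> I"
  note m = this
  note D = curvature_likeD[OF assms]
  have 1: "r b a c d = - r a b c d" "r a b d c = - r a b c d" "r b a d c = r a b c d"
    using D(1)[OF m] D(2)[OF m] D(1)[OF m(1,2,4,3)] by linarith+
  then show "r a b c d = (r a b c d - r b a c d - r a b d c + r b a d c) / 4" by simp
  show "r a b c d = r c d a b" using D(3)[of a b c d] m by simp
  show "(r a b c d + r a c d b + r a d b c - r a b d c - r a c b d - r a d c b) / 6 = 0"
    using D(4)[OF m] D(2)[OF m(1,3,4,2)] D(2)[OF m(1,4,2,3)] 1 by simp
qed

lemma curvature_like_mono: "curvature_like I r \<Longrightarrow> J \<subseteq> I \<Longrightarrow> curvature_like J r"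
  unfolding curvature_like_def by blast

lemma curvature_like_cong:
  assumes "\<And>a b c d. a \<in> I \<Longrightarrow> b \<in> I \<Longrightarrow> c \<in> I \<Longrightarrow> d \<in> I \<Longrightarrow> r a b c d = t a b c d"
    and "curvature_like I t"
  shows "curvature_like I r"
  unfolding curvature_like_def
proof (intro ballI)
  fix a b c d assume "a \<in> I" "b \<in> I" "c \<in> I" "d \<in> I"
  then show "r b a c d = - r a b c d \<and> r a b d c = - r a b c d \<and> r c d a b = r a b c d \<and>
     r a b c d + r a c d b + r a d b c = 0"
    using curvature_likeD[OF assms(2), of a b c d] by (simp only: assms(1)) 
qed

text \<open>
  An algebraic curvature tensor is determined by the components with two, three or four different
  indices in one standard order each.
\<close>

lemma curvature_like_eqI:
  assumes r: "curvature_like I r" and t: "curvature_like I t"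
    and sect: "\<And>i j. i \<in> I \<Longrightarrow> j \<in> I \<Longrightarrow> i \<noteq> j \<Longrightarrow> r i j i j = t i j i j"
    and trip: "\<And>i j k. i \<in> I \<Longrightarrow> j \<in> I \<Longrightarrow> k \<in> I \<Longrightarrow> i \<noteq> j \<Longrightarrow> i \<noteq> k \<Longrightarrow> j \<noteq> k \<Longrightarrow> r i j i k = t i j i k"
    and dist: "\<And>i j k l. i \<in> I \<Longrightarrow> j \<in> I \<Longrightarrow> k \<in> I \<Longrightarrow> l \<in> I \<Longrightarrow> i \<noteq> j \<Longrightarrow> i \<noteq> k \<Longrightarrow> j \<noteq> k \<Longrightarrow>
        i \<noteq> l \<Longrightarrow> j \<noteq> l \<Longrightarrow> k \<noteq> l \<Longrightarrow> r i j k l = t i j k l"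
    and m: "i \<in> I" "j \<in> I" "k \<in> I" "l \<in> I"
  shows "r i j k l = t i j k l"
proof -
  note r' = curvature_likeD[OF r] and t' = curvature_likeD[OF t]
  consider "i = j" | "k = l" | "i \<noteq> j" "k = i" "l = j" | "i \<noteq> j" "k = j" "l = i"
    | "i \<noteq> j" "k = i" "l \<noteq> i" "l \<noteq> j" | "i \<noteq> j" "k = j" "l \<noteq> i" "l \<noteq> j"
    | "i \<noteq> j" "l = i" "k \<noteq> i" "k \<noteq> j" | "i \<noteq> j" "l = j" "k \<noteq> i" "k \<noteq> j"
    | "i \<noteq> j" "i \<noteq> k" "j \<noteq> k" "i \<noteq> l" "j \<noteq> l" "k \<noteq> l" by blast
  then show ?thesis
  proof cases
    case 1
    have "r i i k l = 0" "t i i k l = 0"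
      using r'(1)[of i i k l] t'(1)[of i i k l] m by linarith+
    then show ?thesis using 1 by simp
  next
    case 2
    have "r i j k k = 0" "t i j k k = 0"
      using r'(2)[of i j k k] t'(2)[of i j k k] m by linarith+
    then show ?thesis using 2 by simp
  next
    case 3 then show ?thesis using sect m by simp
  next
    case 4 then show ?thesis using r'(2)[of i j i j] t'(2)[of i j i j] sect[of i j] m by simp
  next
    case 5 then show ?thesis using trip m by simp
  next
    case 6 then show ?thesis using r'(1)[of j i j l] t'(1)[of j i j l] trip[of j i l] m by simp
  next
    case 7 then show ?thesis using r'(2)[of i j i k] t'(2)[of i j i k] trip[of i j k] m by simp
  next
    case 8 then show ?thesis
      using r'(1)[of j i k j] t'(1)[of j i k j] r'(2)[of j i j k] t'(2)[of j i j k] trip[of j i k] m by simp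
  next
    case 9 then show ?thesis using dist m by simp
  qed
qed

text \<open>
  If the indices fall into two classes, the symmetries move each component to one of the types
  below, except for the type \<open>AABB\<close>, which the Bianchi identity expresses by two components of type
  \<open>ABAB\<close>.
\<close>

lemma curvature_like_eqI_split:
  assumes r: "curvature_like (A \<union> B) r" and t: "curvature_like (A \<union> B) t"
    and AAAA: "\<And>i j k l. i \<in> A \<Longrightarrow> j \<in> A \<Longrightarrow> k \<in> A \<Longrightarrow> l \<in> A \<Longrightarrow> r i j k l = t i j k l"
    and AAAB: "\<And>i j k l. i \<in> A \<Longrightarrow> j \<in> A \<Longrightarrow> k \<in> A \<Longrightarrow> l \<in> B \<Longrightarrow> r i j k l = t i j k l"
    and ABAB: "\<And>i j k l. i \<in> A \<Longrightarrow> j \<in> B \<Longrightarrow> k \<in> A \<Longrightarrow> l \<in> B \<Longrightarrow> r i j k l = t i j k l"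
    and ABBB: "\<And>i j k l. i \<in> A \<Longrightarrow> j \<in> B \<Longrightarrow> k \<in> B \<Longrightarrow> l \<in> B \<Longrightarrow> r i j k l = t i j k l"
    and BBBB: "\<And>i j k l. i \<in> B \<Longrightarrow> j \<in> B \<Longrightarrow> k \<in> B \<Longrightarrow> l \<in> B \<Longrightarrow> r i j k l = t i j k l"
    and m: "i \<in> A \<union> B" "j \<in> A \<union> B" "k \<in> A \<union> B" "l \<in> A \<union> B"
  shows "r i j k l = t i j k l"
proof -
  let ?L = "A \<union> B"
  have flip1: "r j i k l = t j i k l \<Longrightarrow> r i j k l = t i j k l"
    and flip2: "r i j l k = t i j l k \<Longrightarrow> r i j k l = t i j k l"
    and pair: "r k l i j = t k l i j \<Longrightarrow> r i j k l = t i j k l"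
    if "i \<in> ?L" "j \<in> ?L" "k \<in> ?L" "l \<in> ?L" for i j k l
    using curvature_likeD[OF r that] curvature_likeD[OF t that] by linarith+
  have AAB: "r i j k l = t i j k l" if "i \<in> A" "j \<in> A" "k \<in> B" "l \<in> A" for i j k l
    by (rule flip2) (use that AAAB in auto)
  have ABA: "r i j k l = t i j k l" if "i \<in> A" "j \<in> B" "k \<in> A" "l \<in> A" for i j k l
    by (rule pair) (use that AAAB in auto)
  have BAA: "r i j k l = t i j k l" if "i \<in> B" "j \<in> A" "k \<in> A" "l \<in> A" for i j k l
    by (rule flip1) (use that ABA in auto)
  have BABB: "r i j k l = t i j k l" if "i \<in> B" "j \<in> A" "k \<in> B" "l \<in> B" for i j k l
    by (rule flip1) (use that ABBB in auto)
  have BBAB: "r i j k l = t i j k l" if "i \<in> B" "j \<in> B" "k \<in> A" "l \<in> B" for i j k l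
    by (rule pair) (use that ABBB in auto)
  have BBBA: "r i j k l = t i j k l" if "i \<in> B" "j \<in> B" "k \<in> B" "l \<in> A" for i j k l
    by (rule flip2) (use that BBAB in auto)
  have ABBA: "r i j k l = t i j k l" if "i \<in> A" "j \<in> B" "k \<in> B" "l \<in> A" for i j k l
    by (rule flip2) (use that ABAB in auto)
  have BAAB: "r i j k l = t i j k l" if "i \<in> B" "j \<in> A" "k \<in> A" "l \<in> B" for i j k l
    by (rule flip1) (use that ABAB in auto)
  have BABA: "r i j k l = t i j k l" if "i \<in> B" "j \<in> A" "k \<in> B" "l \<in> A" for i j k l
    by (rule flip1) (use that ABBA in auto)
  have AABB: "r i j k l = t i j k l" if "i \<in> A" "j \<in> A" "k \<in> B" "l \<in> B" for i j k l
    using curvature_likeD(4)[OF r, of i j k l] curvature_likeD(4)[OF t, of i j k l]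
      ABBA[of i k l j] ABAB[of i l j k] that by auto
  have BBAA: "r i j k l = t i j k l" if "i \<in> B" "j \<in> B" "k \<in> A" "l \<in> A" for i j k l
    by (rule pair) (use that AABB in auto)
  show ?thesis
    using m AAAA AAAB AAB ABA BAA BABB BBAB BBBA ABBA BAAB BABA AABB BBAA ABAB ABBB BBBB by auto
qed

text \<open>
  The second derivatives enter through an expression with the symmetries of \<open>\<partial>\<partial>g\<close>; the quadratic
  terms \<open>q\<close> are symmetric under exchange of their two factors and within each of them.
\<close>

lemma curvature_like_frame_riemann:
  assumes d1: "\<And>D F G. D \<in> \<F> \<Longrightarrow> F \<in> \<F> \<Longrightarrow> G \<in> \<F> \<Longrightarrow> d1 D F G = d1 D G F"
    and d2: "\<And>C D F G. C \<in> \<F> \<Longrightarrow> D \<in> \<F> \<Longrightarrow> F \<in> \<F> \<Longrightarrow> G \<in> \<F> \<Longrightarrow> d2 C D F G = d2 D C F G"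
    and d2': "\<And>C D F G. C \<in> \<F> \<Longrightarrow> D \<in> \<F> \<Longrightarrow> F \<in> \<F> \<Longrightarrow> G \<in> \<F> \<Longrightarrow> d2 C D F G = d2 C D G F"
  shows "curvature_like \<F> (frame_riemann \<F> w d1 d2)"
proof -
  define q where "q = (\<lambda>F G H L. \<Sum>E\<in>\<F>. w E * frame_chris d1 E F G * frame_chris d1 E H L)"
  have c: "frame_chris d1 E F G = frame_chris d1 E G F" if "E \<in> \<F>" "F \<in> \<F>" "G \<in> \<F>" for E F G
    using d1[OF that] by (simp add: frame_chris_def)
  have q1: "q F G H L = q H L F G" for F G H L
    unfolding q_def by (intro sum.cong refl) (simp add: mult_ac)
  have q2: "q F G H L = q G F H L" if "F \<in> \<F>" "G \<in> \<F>" for F G H L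
    unfolding q_def by (intro sum.cong refl) (use c that in simp)
  have R: "frame_riemann \<F> w d1 d2 F G H L =
     (d2 H L F G + d2 H G F L - d2 H F L G) / 2 - (d2 L H F G + d2 L G F H - d2 L F H G) / 2
      - q H F L G + q L F H G" for F G H L
    by (simp add: frame_riemann_def frame_chris_deriv_def q_def)
  show ?thesis unfolding curvature_like_def
  proof (intro ballI)
    fix F G H L assume m: "F \<in> \<F>" "G \<in> \<F>" "H \<in> \<F>" "L \<in> \<F>"
    have R': "frame_riemann \<F> w d1 d2 F G H L =
        (d2 H G F L - d2 H F L G - d2 L G F H + d2 L F H G) / 2 - q H F L G + q L F H G"
      if "F \<in> \<F>" "G \<in> \<F>" "H \<in> \<F>" "L \<in> \<F>" for F G H L
      unfolding R using d2[of H L F G] that by (simp add: field_simps)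
    have "frame_riemann \<F> w d1 d2 G F H L = - frame_riemann \<F> w d1 d2 F G H L"
      using R'[OF m] R'[OF m(2,1,3,4)] d2'[OF m(3,2,1,4)] d2'[OF m(3,1,4,2)] d2'[OF m(4,2,1,3)] d2'[OF m(4,1,3,2)]
        q1[of H F L G] q1[of L F H G] by (simp add: field_simps)
    moreover have "frame_riemann \<F> w d1 d2 F G L H = - frame_riemann \<F> w d1 d2 F G H L"
      unfolding R by linarith
    moreover have "frame_riemann \<F> w d1 d2 H L F G = frame_riemann \<F> w d1 d2 F G H L"
      using R'[OF m] R'[OF m(3,4,1,2)] d2[OF m(3,2,1,4)] d2[OF m(3,1,4,2)] d2[OF m(4,2,1,3)] d2[OF m(4,1,3,2)]
        d2'[OF m(2,4,1,3)] d2'[OF m(1,4,3,2)] d2'[OF m(1,3,4,2)] d2'[OF m(2,3,1,4)]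
        q2[OF m(1,3), of G L] q1[of H F G L] q2[OF m(2,4), of H F] q1[of L G H F]
        q2[OF m(2,3), of F L] q1[of H G F L] q2[OF m(1,4), of H G] q1[of L F H G] by (simp add: field_simps)
    moreover have "frame_riemann \<F> w d1 d2 F G H L + frame_riemann \<F> w d1 d2 F H L G
             + frame_riemann \<F> w d1 d2 F L G H = 0"
      using R'[OF m] R'[OF m(1,3,4,2)] R'[OF m(1,4,2,3)] d2[OF m(3,2,1,4)] d2[OF m(4,2,1,3)] d2[OF m(4,3,1,2)]
        d2'[OF m(3,1,4,2)] d2'[OF m(4,1,3,2)] d2'[OF m(2,1,4,3)]
        q2[OF m(2,4), of H F] q2[OF m(2,3), of L F] q2[OF m(4,3), of G F]
        q1[of H F L G] q1[of L F H G] q1[of L F G H] q1[of G F L H] q1[of G F H L] q1[of H F G L] by (simp add: field_simps)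
    ultimately show "frame_riemann \<F> w d1 d2 G F H L = - frame_riemann \<F> w d1 d2 F G H L \<and>
          frame_riemann \<F> w d1 d2 F G L H = - frame_riemann \<F> w d1 d2 F G H L \<and>
          frame_riemann \<F> w d1 d2 H L F G = frame_riemann \<F> w d1 d2 F G H L \<and>
          frame_riemann \<F> w d1 d2 F G H L + frame_riemann \<F> w d1 d2 F H L G
             + frame_riemann \<F> w d1 d2 F L G H = 0" by blast
  qed
qed


section \<open>Derivatives of the metric at a point, in the coframe\<close>

text \<open>
  These are \<open>\<kappa>\<^sub>a\<^sub>b = \<partial>\<^sub>a log \<bar>x\<^sub>a\<^sup>2 - x\<^sub>b\<^sup>2\<bar>\<close> and the quotient \<open>\<kappa>\<^sub>a\<^sub>b / x\<^sub>a\<close> in a form that makes sense for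
  \<open>x\<^sub>a = 0\<close>. On the diagonal division by zero makes both vanish, so sums over all labels need not exclude
  the diagonal.
\<close>

definition kp :: "(nat \<Rightarrow> real) \<Rightarrow> nat \<Rightarrow> nat \<Rightarrow> real" where
  "kp x a b = 2 * x a / ((x a)\<^sup>2 - (x b)\<^sup>2)"

definition dl :: "(nat \<Rightarrow> real) \<Rightarrow> nat \<Rightarrow> nat \<Rightarrow> real" where
  "dl x a b = 2 / ((x a)\<^sup>2 - (x b)\<^sup>2)"

definition kron :: "nat \<Rightarrow> nat \<Rightarrow> real" where
  "kron a b = (if a = b then 1 else 0)"

lemma kp_self [simp]: "kp x a a = 0" and dl_self [simp]: "dl x a a = 0"
  by (simp_all add: kp_def dl_def)

text \<open>
  The data of the metric at one point: the coordinates \<open>x\<^sub>a\<close>, the coefficients \<open>\<lambda>\<^sub>a\<close>, and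
  \<open>l1 a = \<partial>\<^sub>a \<lambda>\<^sub>a\<close>, \<open>l2 a = \<partial>\<^sub>a\<^sup>2 \<lambda>\<^sub>a\<close>. Here every label \<open>a \<in> N\<close> carries both a direction \<open>dx\<^sub>a\<close> and a
  covector \<open>w\<^sub>a\<close>, as in even dimension.
\<close>

locale kerr_point =
  fixes N :: "nat set" and x lam l1 l2 :: "nat \<Rightarrow> real"
  assumes finN: "finite N"
    and distinct: "\<And>a b. a \<in> N \<Longrightarrow> b \<in> N \<Longrightarrow> a \<noteq> b \<Longrightarrow> (x a)\<^sup>2 \<noteq> (x b)\<^sup>2"
    and lam_nz: "\<And>a. a \<in> N \<Longrightarrow> lam a \<noteq> 0"
begin

abbreviation \<kappa> where "\<kappa> \<equiv> kp x"
abbreviation \<delta> where "\<delta> \<equiv> dl x"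

text \<open>
  The arrays \<open>L1 a c = \<partial>\<^sub>a \<lambda>\<^sub>c\<close> and \<open>L2 a b c = \<partial>\<^sub>a \<partial>\<^sub>b \<lambda>\<^sub>c\<close>, and likewise the components \<open>W1\<close>, \<open>W2\<close> of
  the first two derivatives of \<open>w\<^sub>C\<close> along the vector dual to \<open>w\<^sub>F\<close>, as they result from the structure
  equations.
\<close>

definition L1 :: "nat \<Rightarrow> nat \<Rightarrow> real" where
  "L1 a c = (if a = c then l1 c else - \<kappa> a c * lam c)"

definition L2 :: "nat \<Rightarrow> nat \<Rightarrow> nat \<Rightarrow> real" where
  "L2 a b c = (if a = b then (if c = a then l2 c else (2 * \<kappa> a c * \<kappa> a c - \<delta> a c) * lam c)
     else if c = a then \<kappa> a b * \<kappa> b a * lam a - \<kappa> b a * l1 a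
     else if c = b then \<kappa> a b * \<kappa> b a * lam b - \<kappa> a b * l1 b
     else \<kappa> a c * \<kappa> b c * lam c)"

definition W1 :: "nat \<Rightarrow> nat \<Rightarrow> nat \<Rightarrow> real" where
  "W1 a C F = \<kappa> a C * (kron C F - kron a F)"

definition W2 :: "nat \<Rightarrow> nat \<Rightarrow> nat \<Rightarrow> nat \<Rightarrow> real" where
  "W2 a b C F = (if a = b then \<delta> a C * (kron C F - kron a F)
     else if C = a \<or> C = b then 0
     else \<kappa> a C * \<kappa> b C * kron C F - \<kappa> b C * \<kappa> a b * kron b F - \<kappa> a C * \<kappa> b a * kron a F)"

text \<open>
  Derivatives of the \<open>x\<close>-block \<open>1 / \<lambda>\<^sub>c\<close> (\<open>gd1\<close>, \<open>gd2\<close>) and of the \<open>\<psi>\<close>-block \<open>\<Sum>\<^sub>C \<lambda>\<^sub>C w\<^sub>C w\<^sub>C\<close> (\<open>hd1\<close>, \<open>hd2\<close>).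
\<close>

definition gd1 :: "nat \<Rightarrow> nat \<Rightarrow> real" where
  "gd1 a c = - L1 a c / (lam c * lam c)"

definition gd2 :: "nat \<Rightarrow> nat \<Rightarrow> nat \<Rightarrow> real" where
  "gd2 a b c = 2 * L1 a c * L1 b c / (lam c * lam c * lam c) - L2 a b c / (lam c * lam c)"

definition hd1 :: "nat \<Rightarrow> nat \<Rightarrow> nat \<Rightarrow> real" where
  "hd1 a F G = (\<Sum>C\<in>N. L1 a C * kron C F * kron C G
      + lam C * (W1 a C F * kron C G + kron C F * W1 a C G))"

definition hd2 :: "nat \<Rightarrow> nat \<Rightarrow> nat \<Rightarrow> nat \<Rightarrow> real" where
  "hd2 a b F G = (\<Sum>C\<in>N. L2 a b C * kron C F * kron C G
      + L1 b C * (W1 a C F * kron C G + kron C F * W1 a C G)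
      + L1 a C * (W1 b C F * kron C G + kron C F * W1 b C G)
      + lam C * (W2 a b C F * kron C G + W1 b C F * W1 a C G
                 + W1 a C F * W1 b C G + kron C F * W2 a b C G))"

text \<open>
  Frame labels reuse the type of coordinate labels: \<open>XC a\<close> stands for \<open>\<partial> / \<partial>x\<^sub>a\<close> and \<open>PsiC a\<close> for the
  vector dual to \<open>w\<^sub>a\<close>.
\<close>

definition labels :: "coord set" where
  "labels = XC ` N \<union> PsiC ` N"

fun weight :: "coord \<Rightarrow> real" where
  "weight (XC a) = lam a"
| "weight (PsiC a) = 1 / lam a"

fun d1 :: "coord \<Rightarrow> coord \<Rightarrow> coord \<Rightarrow> real" where
  "d1 (XC a) (XC b) (XC c) = (if b = c then gd1 a b else 0)"
| "d1 (XC a) (PsiC b) (PsiC c) = hd1 a b c"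
| "d1 (PsiC a) F G = 0"
| "d1 (XC a) (XC b) (PsiC c) = 0"
| "d1 (XC a) (PsiC b) (XC c) = 0"

fun d2 :: "coord \<Rightarrow> coord \<Rightarrow> coord \<Rightarrow> coord \<Rightarrow> real" where
  "d2 (XC a) (XC b) (XC c) (XC d) = (if c = d then gd2 a b c else 0)"
| "d2 (XC a) (XC b) (PsiC c) (PsiC d) = hd2 a b c d"
| "d2 (PsiC a) H F G = 0"
| "d2 (XC a) (PsiC b) F G = 0"
| "d2 (XC a) (XC b) (XC c) (PsiC d) = 0"
| "d2 (XC a) (XC b) (PsiC c) (XC d) = 0"

abbreviation R :: "coord \<Rightarrow> coord \<Rightarrow> coord \<Rightarrow> coord \<Rightarrow> real" where
  "R \<equiv> frame_riemann labels weight d1 d2"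

text \<open>
  The first and second derivative of \<open>M = \<Sum>\<^sub>C \<lambda>\<^sub>C\<close> with respect to \<open>x\<^sub>a\<close>, and the functions \<open>S\<close>, \<open>F\<close>, \<open>D\<close>
  rewritten with \<open>\<kappa>\<close>. For \<open>x\<^sub>b = 0\<close> the value \<open>Sf a b\<close> is \<open>E\<^sub>a\<close>.
\<close>

definition K :: "nat \<Rightarrow> real" where "K a = (\<Sum>C\<in>N. \<kappa> a C * lam C)"
definition M1 :: "nat \<Rightarrow> real" where "M1 a = l1 a - K a"
definition M2 :: "nat \<Rightarrow> real" where
  "M2 a = l2 a - (\<Sum>C\<in>N. (\<delta> a C - 2 * \<kappa> a C * \<kappa> a C) * lam C)"

definition Sf :: "nat \<Rightarrow> nat \<Rightarrow> real" where "Sf a b = - (\<kappa> a b * M1 a + \<kappa> b a * M1 b) / 4"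
definition Ff :: "nat \<Rightarrow> nat \<Rightarrow> real" where "Ff a b = (\<kappa> a b * M1 b + \<kappa> b a * M1 a) / 4"
definition Df :: "nat \<Rightarrow> real" where "Df a = - M2 a / 2"

text \<open>
  This is the vanishing of the second divided difference of the identity function at the three
  points \<open>x\<^sub>a\<^sup>2\<close>, \<open>x\<^sub>b\<^sup>2\<close>, \<open>x\<^sub>c\<^sup>2\<close>. It is responsible for every cancellation that involves three labels.
\<close>

lemma kappa_cyclic:
  assumes "a \<in> N" "b \<in> N" "c \<in> N" "a \<noteq> b" "a \<noteq> c" "b \<noteq> c"
  shows "\<kappa> a b * \<kappa> a c + \<kappa> b a * \<kappa> b c + \<kappa> c a * \<kappa> c b = 0"
proof -
  have "(x a)\<^sup>2 - (x b)\<^sup>2 \<noteq> 0" "(x a)\<^sup>2 - (x c)\<^sup>2 \<noteq> 0" "(x b)\<^sup>2 - (x c)\<^sup>2 \<noteq> 0"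
    using distinct assms by auto
  moreover have "(x b)\<^sup>2 - (x a)\<^sup>2 = - ((x a)\<^sup>2 - (x b)\<^sup>2)" "(x c)\<^sup>2 - (x a)\<^sup>2 = - ((x a)\<^sup>2 - (x c)\<^sup>2)"
     "(x c)\<^sup>2 - (x b)\<^sup>2 = - ((x b)\<^sup>2 - (x c)\<^sup>2)" by auto
  ultimately show ?thesis
    unfolding kp_def by (simp add: divide_simps) (simp add: algebra_simps power2_eq_square)
qed

text \<open>
  The same kind of partial fraction identity, with both derivatives acting on the third label. It
  also expresses that mixed second derivatives of \<open>w\<^sub>c\<close> commute.
\<close>

lemma kappa_transfer:
  assumes "a \<in> N" "b \<in> N" "c \<in> N" "a \<noteq> b" "a \<noteq> c" "b \<noteq> c"
  shows "\<kappa> a c * \<kappa> b c = \<kappa> b a * \<kappa> a c + \<kappa> a b * \<kappa> b c"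
proof -
  have "(x a)\<^sup>2 - (x b)\<^sup>2 \<noteq> 0" "(x a)\<^sup>2 - (x c)\<^sup>2 \<noteq> 0" "(x b)\<^sup>2 - (x c)\<^sup>2 \<noteq> 0"
    using distinct assms by auto
  moreover have "(x b)\<^sup>2 - (x a)\<^sup>2 = - ((x a)\<^sup>2 - (x b)\<^sup>2)" by auto
  ultimately show ?thesis
    unfolding kp_def by (simp add: divide_simps) (simp add: algebra_simps power2_eq_square)
qed

lemma delta_eq:
  assumes "a \<in> N" "b \<in> N"
  shows "\<delta> a b = (\<kappa> a b * \<kappa> a b - \<kappa> b a * \<kappa> b a) / 2"
proof (cases "a = b")
  case False
  then have "(x a)\<^sup>2 - (x b)\<^sup>2 \<noteq> 0" using distinct assms by auto
  moreover have "(x b)\<^sup>2 - (x a)\<^sup>2 = - ((x a)\<^sup>2 - (x b)\<^sup>2)" by auto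
  ultimately show ?thesis
    unfolding kp_def dl_def by (simp add: divide_simps) (simp add: algebra_simps power2_eq_square)
qed simp

lemma sum_split2:
  assumes "a \<in> N" "b \<in> N" "a \<noteq> b"
  shows "(\<Sum>C\<in>N. f C) = f a + f b + (\<Sum>C\<in>N-{a,b}. f C :: real)"
proof -
  have "N - {a,b} = N - {a} - {b}" by auto
  then show ?thesis using assms finN
    by (simp add: sum.remove[of N a] sum.remove[of "N-{a}" b])
qed

lemma sum_split1: "a \<in> N \<Longrightarrow> (\<Sum>C\<in>N. f C) = f a + (\<Sum>C\<in>N-{a}. f C :: real)"
  using finN by (simp add: sum.remove)

lemma sum_split3:
  assumes "a \<in> N" "b \<in> N" "c \<in> N" "a \<noteq> b" "a \<noteq> c" "b \<noteq> c"
  shows "(\<Sum>C\<in>N. f C) = f a + f b + f c + (\<Sum>C\<in>N-{a,b,c}. f C :: real)"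
proof -
  have *: "N - {a,b,c} = N - {a,b} - {c}" by auto
  show ?thesis unfolding * using assms finN
    by (subst sum_split2[of a b]) (simp_all add: sum.remove[of "N-{a,b}" c])
qed

lemma sum_split4:
  assumes "a \<in> N" "b \<in> N" "c \<in> N" "d \<in> N" "a \<noteq> b" "a \<noteq> c" "b \<noteq> c" "a \<noteq> d" "b \<noteq> d" "c \<noteq> d"
  shows "(\<Sum>C\<in>N. f C) = f a + f b + f c + f d + (\<Sum>C\<in>N-{a,b,c,d}. f C :: real)"
proof -
  have *: "N - {a,b,c,d} = N - {a,b,c} - {d}" by auto
  show ?thesis unfolding * using assms finN
    by (subst sum_split3[of a b c]) (simp_all add: sum.remove[of "N-{a,b,c}" d])
qed

definition K_cross :: "nat \<Rightarrow> nat \<Rightarrow> real" where "K_cross a b = (\<Sum>C\<in>N. \<kappa> a C * \<kappa> b C * lam C)"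

text \<open>
  Summing \<open>kappa_transfer\<close> over the third label; the last summand compensates the two labels to
  which the identity does not apply.
\<close>

lemma K_cross_eq:
  assumes "a \<in> N" "b \<in> N" "a \<noteq> b"
  shows "K_cross a b = \<kappa> b a * K a + \<kappa> a b * K b - \<kappa> a b * \<kappa> b a * (lam a + lam b)"
proof -
  have "(\<Sum>C\<in>N-{a,b}. \<kappa> a C * \<kappa> b C * lam C)
     = (\<Sum>C\<in>N-{a,b}. \<kappa> b a * (\<kappa> a C * lam C) + \<kappa> a b * (\<kappa> b C * lam C))"
  proof (intro sum.cong refl)
    fix C assume "C \<in> N - {a,b}"
    then have "\<kappa> a C * \<kappa> b C = \<kappa> b a * \<kappa> a C + \<kappa> a b * \<kappa> b C"
      using assms by (intro kappa_transfer) auto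
    then show "\<kappa> a C * \<kappa> b C * lam C = \<kappa> b a * (\<kappa> a C * lam C) + \<kappa> a b * (\<kappa> b C * lam C)"
      by (simp only: distrib_right mult.assoc)
  qed
  then show ?thesis unfolding K_cross_def K_def sum_split2[OF assms]
    by (simp add: sum.distrib sum_distrib_left algebra_simps)
qed

text \<open>
  Summing \<open>kappa_cyclic\<close> over the third label. This turns the quadratic sums in sectional curvatures
  into the linear sums \<open>K\<close>, which are part of the derivatives of \<open>M\<close>.
\<close>

lemma sum_kappa_kappa:
  assumes "a \<in> N" "b \<in> N" "a \<noteq> b"
  shows "(\<Sum>C\<in>N-{a,b}. lam C * (\<kappa> C a * \<kappa> C b))
     = - \<kappa> a b * (K a - \<kappa> a b * lam b) - \<kappa> b a * (K b - \<kappa> b a * lam a)"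
proof -
  have "lam C * (\<kappa> C a * \<kappa> C b) = - \<kappa> a b * (\<kappa> a C * lam C) - \<kappa> b a * (\<kappa> b C * lam C)"
    if "C \<in> N-{a,b}" for C
  proof -
    have "\<kappa> C a * \<kappa> C b = - \<kappa> a b * \<kappa> a C - \<kappa> b a * \<kappa> b C"
      using kappa_cyclic[of a b C] assms that by auto
    then show ?thesis by (simp only: right_diff_distrib mult_ac)
  qed
  then have "(\<Sum>C\<in>N-{a,b}. lam C * (\<kappa> C a * \<kappa> C b))
     = (\<Sum>C\<in>N-{a,b}. - \<kappa> a b * (\<kappa> a C * lam C) - \<kappa> b a * (\<kappa> b C * lam C))"
    by (intro sum.cong refl) auto
  then show ?thesis unfolding K_def sum_split2[OF assms]
    by (simp add: sum_subtractf sum_negf sum_distrib_left algebra_simps)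
qed

lemma L2_sym: "L2 a b c = L2 b a c"
  by (auto simp: L2_def algebra_simps)
lemma W2_sym: "W2 a b C F = W2 b a C F"
  by (auto simp: W2_def algebra_simps)
lemma gd2_sym: "gd2 a b c = gd2 b a c"
  by (simp add: gd2_def L2_sym[of a b] mult_ac)
lemma hd1_sym: "hd1 a F G = hd1 a G F"
  unfolding hd1_def by (intro sum.cong refl) (simp add: algebra_simps)
lemma hd2_sym: "hd2 a b F G = hd2 b a F G"
  unfolding hd2_def by (intro sum.cong refl) (simp add: algebra_simps L2_sym[of a b] W2_sym[of a b])
lemma hd2_sym': "hd2 a b F G = hd2 a b G F"
  unfolding hd2_def by (intro sum.cong refl) (simp add: algebra_simps)

text \<open>
  The arrow shape of \<open>\<partial>\<^sub>a\<close> of the \<open>\<psi>\<close>-block: off the diagonal only row and column \<open>a\<close> survive.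
\<close>

lemma hd1_diag: "a \<in> N \<Longrightarrow> A \<in> N \<Longrightarrow> hd1 a A A = (if a = A then l1 A else \<kappa> a A * lam A)"
  unfolding hd1_def by (subst sum_split1[of A]) (auto simp: L1_def W1_def kron_def)

lemma hd1_off: "a \<in> N \<Longrightarrow> A \<in> N \<Longrightarrow> B \<in> N \<Longrightarrow> A \<noteq> B \<Longrightarrow>
   hd1 a A B = (if a = A then - \<kappa> a B * lam B else if a = B then - \<kappa> a A * lam A else 0)"
  unfolding hd1_def by (subst sum_split2[of A B]) (auto simp: L1_def W1_def kron_def)

lemmas hd1_simps = hd1_diag hd1_off

text \<open>
  The complete table of second derivatives of the \<open>\<psi>\<close>-block, up to the symmetries \<open>hd2_sym\<close> and
  \<open>hd2_sym'\<close>. Only two entries contain a genuine sum over labels.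
\<close>

lemma hd2_same_diag: "a \<in> N \<Longrightarrow> A \<in> N \<Longrightarrow> a \<noteq> A \<Longrightarrow> hd2 a a A A = \<delta> a A * lam A"
  unfolding hd2_def by (subst sum_split2[of a A]) (auto simp: L1_def L2_def W1_def W2_def kron_def algebra_simps)

lemma hd2_same_self: "a \<in> N \<Longrightarrow> hd2 a a a a = l2 a + 2 * K_cross a a"
  unfolding hd2_def K_cross_def sum_distrib_left
  by (subst (1 2) sum_split1[of a]) (auto simp: L1_def L2_def W1_def W2_def kron_def algebra_simps intro!: sum.cong)

lemma hd2_same_cross: "a \<in> N \<Longrightarrow> A \<in> N \<Longrightarrow> a \<noteq> A \<Longrightarrow> hd2 a a a A = - \<delta> a A * lam A"
  unfolding hd2_def by (subst sum_split2[of a A]) (auto simp: L1_def L2_def W1_def W2_def kron_def algebra_simps)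

lemma hd2_same_other:
  "a \<in> N \<Longrightarrow> A \<in> N \<Longrightarrow> B \<in> N \<Longrightarrow> a \<noteq> A \<Longrightarrow> a \<noteq> B \<Longrightarrow> A \<noteq> B \<Longrightarrow> hd2 a a A B = 0"
  unfolding hd2_def by (subst sum_split3[of a A B]) (auto simp: L1_def L2_def W1_def W2_def kron_def algebra_simps)

lemma hd2_diag_other:
  "a \<in> N \<Longrightarrow> b \<in> N \<Longrightarrow> A \<in> N \<Longrightarrow> a \<noteq> b \<Longrightarrow> a \<noteq> A \<Longrightarrow> b \<noteq> A \<Longrightarrow>
     hd2 a b A A = \<kappa> a A * \<kappa> b A * lam A"
  unfolding hd2_def by (subst sum_split3[of a b A]) (auto simp: L1_def L2_def W1_def W2_def kron_def algebra_simps)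

lemma hd2_diag_fst:
  "a \<in> N \<Longrightarrow> b \<in> N \<Longrightarrow> a \<noteq> b \<Longrightarrow> hd2 a b a a = \<kappa> b a * l1 a + \<kappa> a b * \<kappa> b a * lam a"
  unfolding hd2_def by (subst sum_split2[of a b]) (auto simp: L1_def L2_def W1_def W2_def kron_def algebra_simps)

lemma hd2_mixed:
  assumes "a \<in> N" "b \<in> N" "a \<noteq> b"
  shows "hd2 a b a b = K_cross a b - \<kappa> b a * l1 a - \<kappa> a b * l1 b"
  unfolding hd2_def K_cross_def
  by (subst (1 2) sum_split2[OF assms]) (use assms in \<open>auto simp: L1_def L2_def W1_def W2_def kron_def algebra_simps intro!: sum.cong\<close>)

lemma hd2_cross:
  "a \<in> N \<Longrightarrow> b \<in> N \<Longrightarrow> B \<in> N \<Longrightarrow> a \<noteq> b \<Longrightarrow> a \<noteq> B \<Longrightarrow> b \<noteq> B \<Longrightarrow>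
     hd2 a b a B = - \<kappa> a B * \<kappa> b a * lam B"
  unfolding hd2_def by (subst sum_split3[of a b B]) (auto simp: L1_def L2_def W1_def W2_def kron_def algebra_simps)

lemma hd2_other:
  "a \<in> N \<Longrightarrow> b \<in> N \<Longrightarrow> A \<in> N \<Longrightarrow> B \<in> N \<Longrightarrow> a \<noteq> b \<Longrightarrow> a \<noteq> A \<Longrightarrow> b \<noteq> A \<Longrightarrow> a \<noteq> B \<Longrightarrow> b \<noteq> B \<Longrightarrow>
     A \<noteq> B \<Longrightarrow> hd2 a b A B = 0"
  unfolding hd2_def by (subst sum_split4[of a b A B]) (auto simp: L1_def L2_def W1_def W2_def kron_def algebra_simps)

end


section \<open>Curvature components at a point\<close>

context kerr_point
begin

lemma sum_labels: "(\<Sum>E\<in>labels. f E) = (\<Sum>a\<in>N. f (XC a)) + (\<Sum>a\<in>N. f (PsiC a) :: real)"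
proof -
  have "(\<Sum>E\<in>labels. f E) = (\<Sum>E\<in>XC ` N. f E) + (\<Sum>E\<in>PsiC ` N. f E)"
    unfolding labels_def using finN by (intro sum.union_disjoint) auto
  then show ?thesis by (simp add: sum.reindex inj_on_def)
qed

text \<open>
  Christoffel symbols of the \<open>x\<close>-block. Those with indices from both blocks reduce to \<open>hd1\<close>.
\<close>

definition gam :: "nat \<Rightarrow> nat \<Rightarrow> nat \<Rightarrow> real" where
  "gam e a b = frame_chris d1 (XC e) (XC a) (XC b)"

text \<open>
  Reflecting all \<open>\<psi>\<close> is an isometry, so components with an odd number of \<open>\<psi>\<close>-indices vanish
  (\<open>R_zero_XXXP\<close>, \<open>R_zero_XPPP\<close>). The components computed here are sums over a single label.
\<close>

lemma R_XPXP: "R (XC a) (PsiC A) (XC b) (PsiC B) = - hd2 b a A B / 2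
     + (\<Sum>e\<in>N. lam e * gam e b a * hd1 e A B) / 2 + (\<Sum>C\<in>N. hd1 a C B * hd1 b C A / lam C) / 4"
  unfolding frame_riemann_def sum_labels frame_chris_deriv_def gam_def
  by (simp add: frame_chris_def hd2_sym'[of b a B A] hd1_sym[of _ B A] sum_divide_distrib sum_negf mult_ac)

lemma R_PPPP: "R (PsiC A) (PsiC B) (PsiC C) (PsiC D) =
    - (\<Sum>e\<in>N. lam e * hd1 e A C * hd1 e B D) / 4 + (\<Sum>e\<in>N. lam e * hd1 e A D * hd1 e B C) / 4"
  unfolding frame_riemann_def sum_labels frame_chris_deriv_def
  by (simp add: frame_chris_def hd1_sym[of _ C A] hd1_sym[of _ D B] hd1_sym[of _ D A] hd1_sym[of _ C B]
       sum_divide_distrib sum_negf mult.assoc)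

lemma R_XXXX: "R (XC a) (XC b) (XC c) (XC d) =
    (d2 (XC c) (XC d) (XC a) (XC b) + d2 (XC c) (XC b) (XC a) (XC d) - d2 (XC c) (XC a) (XC d) (XC b)) / 2
  - (d2 (XC d) (XC c) (XC a) (XC b) + d2 (XC d) (XC b) (XC a) (XC c) - d2 (XC d) (XC a) (XC c) (XC b)) / 2
  - (\<Sum>e\<in>N. lam e * gam e c a * gam e d b) + (\<Sum>e\<in>N. lam e * gam e d a * gam e c b)"
  unfolding frame_riemann_def sum_labels frame_chris_deriv_def gam_def
  by (simp add: frame_chris_def)

lemma R_zero_XXXP: "R (XC a) (XC b) (XC c) (PsiC D) = 0"
  unfolding frame_riemann_def sum_labels frame_chris_deriv_def by (simp add: frame_chris_def)

lemma R_zero_XPPP: "R (XC a) (PsiC B) (PsiC C) (PsiC D) = 0"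
  unfolding frame_riemann_def sum_labels frame_chris_deriv_def by (simp add: frame_chris_def)

lemma gam_eq: "gam e a b = ((if e = b then gd1 a e else 0) + (if e = a then gd1 b e else 0)
     - (if a = b then gd1 e a else 0)) / 2"
  by (simp add: gam_def frame_chris_def)

lemma gd1_self: "gd1 a a = - l1 a / (lam a * lam a)"
  by (simp add: gd1_def L1_def)

lemma gd1_other: "a \<noteq> c \<Longrightarrow> c \<in> N \<Longrightarrow> gd1 a c = \<kappa> a c / lam c"
  by (simp add: gd1_def L1_def lam_nz)

lemma gam_same: "e \<noteq> a \<Longrightarrow> a \<in> N \<Longrightarrow> gam e a a = - \<kappa> e a / (2 * lam a)"
  by (simp add: gam_eq gd1_other)

lemma gam_same_self: "gam a a a = - l1 a / (2 * lam a * lam a)"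
  by (simp add: gam_eq gd1_self)

lemma gam_mixed_fst: "a \<noteq> b \<Longrightarrow> a \<in> N \<Longrightarrow> gam a a b = \<kappa> b a / (2 * lam a)"
  by (simp add: gam_eq gd1_other)

lemma gam_mixed_snd: "a \<noteq> b \<Longrightarrow> b \<in> N \<Longrightarrow> gam b a b = \<kappa> a b / (2 * lam b)"
  by (simp add: gam_eq gd1_other)

lemma gam_mixed_other: "a \<noteq> b \<Longrightarrow> e \<noteq> a \<Longrightarrow> e \<noteq> b \<Longrightarrow> gam e a b = 0"
  by (simp add: gam_eq)

lemmas gam_simps = gam_same gam_same_self gam_mixed_fst gam_mixed_snd gam_mixed_other

text \<open>
  In the following evaluations the labels that occur in the component are split off from
  each sum. What remains is zero or a quadratic sum in \<open>\<kappa>\<close>.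
\<close>

lemma XPXP_same_diag:
  assumes "a \<in> N" "A \<in> N" "a \<noteq> A"
  shows "R (XC a) (PsiC A) (XC a) (PsiC A) = Sf a A * lam A / lam a"
proof -
  have r1: "(\<Sum>e\<in>N-{a,A}. lam e * gam e a a * hd1 e A A)
     = (\<Sum>e\<in>N-{a,A}. - (lam A / (2 * lam a)) * (lam e * (\<kappa> e a * \<kappa> e A)))"
    by (intro sum.cong refl) (use assms in \<open>auto simp: gam_simps hd1_simps\<close>)
  have 1: "(\<Sum>e\<in>N. lam e * gam e a a * hd1 e A A)
     = - l1 a * \<kappa> a A * lam A / (2 * lam a) - \<kappa> A a * lam A * l1 A / (2 * lam a)
       - lam A / (2 * lam a) * (\<Sum>C\<in>N-{a,A}. lam C * (\<kappa> C a * \<kappa> C A))"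
    unfolding sum_split2[OF assms] r1 sum_distrib_left[symmetric]
    using assms by (simp add: gam_simps hd1_simps lam_nz mult_ac)
  have r2: "(\<Sum>C\<in>N-{a,A}. hd1 a C A * hd1 a C A / lam C) = (\<Sum>C\<in>N-{a,A}. 0)"
    by (intro sum.cong refl) (use assms in \<open>auto simp: hd1_simps\<close>)
  have 2: "(\<Sum>C\<in>N. hd1 a C A * hd1 a C A / lam C) =
       \<kappa> a A * \<kappa> a A * lam A * lam A / lam a + \<kappa> a A * \<kappa> a A * lam A"
    unfolding sum_split2[OF assms] r2
    using assms by (simp add: hd1_simps lam_nz)
  show ?thesis
    unfolding R_XPXP 1 2 sum_kappa_kappa[OF assms]
    using assms by (simp add: hd2_same_diag delta_eq Sf_def M1_def lam_nz field_simps)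
qed

lemma XPXP_same_self:
  assumes "a \<in> N"
  shows "R (XC a) (PsiC a) (XC a) (PsiC a) = Df a"
proof -
  have r1: "(\<Sum>e\<in>N-{a}. lam e * gam e a a * hd1 e a a) = (\<Sum>e\<in>N-{a}. - (1/2) * (\<kappa> e a * \<kappa> e a * lam e))"
    by (intro sum.cong refl) (use assms in \<open>auto simp: gam_simps hd1_simps lam_nz\<close>)
  have 1: "(\<Sum>e\<in>N. lam e * gam e a a * hd1 e a a)
     = - l1 a * l1 a / (2 * lam a) - (\<Sum>C\<in>N. \<kappa> C a * \<kappa> C a * lam C) / 2"
    unfolding sum_split1[OF assms] r1 sum_distrib_left[symmetric]
    using assms by (simp add: gam_simps hd1_simps lam_nz)
  have r2: "(\<Sum>C\<in>N-{a}. hd1 a C a * hd1 a C a / lam C) = (\<Sum>C\<in>N-{a}. \<kappa> a C * \<kappa> a C * lam C)"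
    by (intro sum.cong refl) (use assms in \<open>auto simp: hd1_simps lam_nz\<close>)
  have 2: "(\<Sum>C\<in>N. hd1 a C a * hd1 a C a / lam C) = l1 a * l1 a / lam a + K_cross a a"
    unfolding K_cross_def sum_split1[OF assms] r2
    using assms by (simp add: hd1_simps lam_nz)
  have "(\<Sum>C\<in>N. (\<delta> a C - 2 * \<kappa> a C * \<kappa> a C) * lam C)
     = (\<Sum>C\<in>N. - (3/2) * (\<kappa> a C * \<kappa> a C * lam C) - (1/2) * (\<kappa> C a * \<kappa> C a * lam C))"
    by (intro sum.cong refl) (use assms in \<open>auto simp: delta_eq field_simps\<close>)
  then have 3: "M2 a = l2 a + (3/2) * K_cross a a + (1/2) * (\<Sum>C\<in>N. \<kappa> C a * \<kappa> C a * lam C)"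
    unfolding M2_def K_cross_def sum_subtractf sum_distrib_left[symmetric] by simp
  show ?thesis
    unfolding R_XPXP 1 2 Df_def 3
    using assms by (simp add: hd2_same_self lam_nz field_simps)
qed

lemma XPXP_same_cross:
  assumes "a \<in> N" "A \<in> N" "a \<noteq> A"
  shows "R (XC a) (PsiC a) (XC a) (PsiC A) = 0"
proof -
  have r1: "(\<Sum>e\<in>N-{a,A}. lam e * gam e a a * hd1 e a A) = (\<Sum>e\<in>N-{a,A}. 0)"
    by (intro sum.cong refl) (use assms in \<open>auto simp: hd1_simps\<close>)
  have 1: "(\<Sum>e\<in>N. lam e * gam e a a * hd1 e a A)
     = l1 a * \<kappa> a A * lam A / (2 * lam a) + \<kappa> A a * \<kappa> A a * lam A / 2"
    unfolding sum_split2[OF assms] r1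
    using assms by (simp add: gam_simps hd1_simps lam_nz mult_ac)
  have r2: "(\<Sum>C\<in>N-{a,A}. hd1 a C A * hd1 a C a / lam C) = (\<Sum>e\<in>N-{a,A}. 0)"
    by (intro sum.cong refl) (use assms in \<open>auto simp: hd1_simps\<close>)
  have 2: "(\<Sum>C\<in>N. hd1 a C A * hd1 a C a / lam C) =
       - l1 a * \<kappa> a A * lam A / lam a - \<kappa> a A * \<kappa> a A * lam A"
    unfolding sum_split2[OF assms] r2
    using assms by (simp add: hd1_simps lam_nz)
  show ?thesis
    unfolding R_XPXP 1 2
    using assms by (simp add: hd2_same_cross delta_eq lam_nz field_simps)
qed

lemma XPXP_same_other:
  assumes "a \<in> N" "A \<in> N" "B \<in> N" "a \<noteq> A" "a \<noteq> B" "A \<noteq> B"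
  shows "R (XC a) (PsiC A) (XC a) (PsiC B) = 0"
proof -
  have r1: "(\<Sum>e\<in>N-{a,A,B}. lam e * gam e a a * hd1 e A B) = (\<Sum>e\<in>N-{a,A,B}. 0)"
    by (intro sum.cong refl) (use assms in \<open>auto simp: hd1_simps\<close>)
  have 1: "(\<Sum>e\<in>N. lam e * gam e a a * hd1 e A B)
     = lam A * lam B / (2 * lam a) * (\<kappa> A a * \<kappa> A B + \<kappa> B a * \<kappa> B A)"
    unfolding sum_split3[OF assms] r1
    using assms by (simp add: gam_simps hd1_simps lam_nz field_simps)
  have r2: "(\<Sum>C\<in>N-{a,A,B}. hd1 a C B * hd1 a C A / lam C) = (\<Sum>e\<in>N-{a,A,B}. 0)"
    by (intro sum.cong refl) (use assms in \<open>auto simp: hd1_simps\<close>)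
  have 2: "(\<Sum>C\<in>N. hd1 a C B * hd1 a C A / lam C) = lam A * lam B / lam a * (\<kappa> a A * \<kappa> a B)"
    unfolding sum_split3[OF assms] r2
    using assms by (simp add: hd1_simps lam_nz)
  have 3: "\<kappa> a A * \<kappa> a B = - (\<kappa> A a * \<kappa> A B + \<kappa> B a * \<kappa> B A)"
    using kappa_cyclic[OF assms] by linarith
  show ?thesis
    unfolding R_XPXP 1 2 3 using assms by (simp add: hd2_same_other lam_nz field_simps)
qed

lemma chris_sum_mixed:
  assumes "a \<in> N" "b \<in> N" "a \<noteq> b"
  shows "(\<Sum>e\<in>N. lam e * gam e b a * hd1 e A B) = (\<kappa> b a * hd1 a A B + \<kappa> a b * hd1 b A B) / 2"
proof -
  have r: "(\<Sum>e\<in>N-{a,b}. lam e * gam e b a * hd1 e A B) = (\<Sum>e\<in>N-{a,b}. 0)"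
    by (intro sum.cong refl) (use assms in \<open>auto simp: gam_simps\<close>)
  show ?thesis unfolding sum_split2[OF assms] r
    using assms by (simp add: gam_simps lam_nz field_simps)
qed

text \<open>
  For different \<open>a\<close> and \<open>b\<close> only two Christoffel symbols of the \<open>x\<close>-block are left, so each such
  component is the sum of three terms.
\<close>

lemma XPXP_mixed_rule:
  assumes "a \<in> N" "b \<in> N" "a \<noteq> b"
    and "(\<Sum>C\<in>N. hd1 a C B * hd1 b C A / lam C) = s"
    and "- hd2 a b A B / 2 + (\<kappa> b a * hd1 a A B + \<kappa> a b * hd1 b A B) / 4 + s / 4 = r"
  shows "R (XC a) (PsiC A) (XC b) (PsiC B) = r"
  unfolding R_XPXP chris_sum_mixed[OF assms(1-3)] assms(4) hd2_sym[of b a] using assms(5) by simp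

lemma XPXP_matching:
  assumes "a \<in> N" "b \<in> N" "a \<noteq> b"
  shows "R (XC a) (PsiC a) (XC b) (PsiC b) = 2 * Ff a b"
proof (rule XPXP_mixed_rule[OF assms])
  have r: "(\<Sum>C\<in>N-{a,b}. hd1 a C b * hd1 b C a / lam C) = (\<Sum>e\<in>N-{a,b}. 0)"
    by (intro sum.cong refl) (use assms in \<open>auto simp: hd1_simps\<close>)
  show "(\<Sum>C\<in>N. hd1 a C b * hd1 b C a / lam C) = - \<kappa> a b * \<kappa> b a * (lam a + lam b)"
    unfolding sum_split2[OF assms] r
    using assms by (simp add: hd1_simps lam_nz field_simps)
qed (use assms in \<open>simp add: hd2_mixed K_cross_eq hd1_simps Ff_def M1_def field_simps\<close>)

lemma XPXP_swapped:
  assumes "a \<in> N" "b \<in> N" "a \<noteq> b"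
  shows "R (XC a) (PsiC b) (XC b) (PsiC a) = Ff a b"
proof (rule XPXP_mixed_rule[OF assms])
  have r: "(\<Sum>C\<in>N-{a,b}. hd1 a C a * hd1 b C b / lam C) = (\<Sum>C\<in>N-{a,b}. \<kappa> a C * \<kappa> b C * lam C)"
    by (intro sum.cong refl) (use assms in \<open>auto simp: hd1_simps lam_nz\<close>)
  show "(\<Sum>C\<in>N. hd1 a C a * hd1 b C b / lam C) = - l1 a * \<kappa> b a - l1 b * \<kappa> a b + K_cross a b"
    unfolding K_cross_def sum_split2[OF assms] r
    using assms by (simp add: hd1_simps lam_nz)
qed (use assms in \<open>simp add: hd2_mixed hd2_sym'[of a b b a] K_cross_eq hd1_simps Ff_def M1_def field_simps\<close>)

lemma XPXP_mixed_diag_fst: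
  assumes "a \<in> N" "b \<in> N" "a \<noteq> b"
  shows "R (XC a) (PsiC a) (XC b) (PsiC a) = 0"
proof (rule XPXP_mixed_rule[OF assms])
  have r: "(\<Sum>C\<in>N-{a,b}. hd1 a C a * hd1 b C a / lam C) = (\<Sum>e\<in>N-{a,b}. 0)"
    by (intro sum.cong refl) (use assms in \<open>auto simp: hd1_simps\<close>)
  show "(\<Sum>C\<in>N. hd1 a C a * hd1 b C a / lam C) = l1 a * \<kappa> b a + \<kappa> a b * \<kappa> b a * lam a"
    unfolding sum_split2[OF assms] r
    using assms by (simp add: hd1_simps lam_nz)
qed (use assms in \<open>simp add: hd2_diag_fst hd1_simps field_simps\<close>)

lemma XPXP_mixed_diag_snd:
  assumes "a \<in> N" "b \<in> N" "a \<noteq> b"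
  shows "R (XC a) (PsiC b) (XC b) (PsiC b) = 0"
proof (rule XPXP_mixed_rule[OF assms])
  have r: "(\<Sum>C\<in>N-{a,b}. hd1 a C b * hd1 b C b / lam C) = (\<Sum>e\<in>N-{a,b}. 0)"
    by (intro sum.cong refl) (use assms in \<open>auto simp: hd1_simps\<close>)
  show "(\<Sum>C\<in>N. hd1 a C b * hd1 b C b / lam C) = l1 b * \<kappa> a b + \<kappa> a b * \<kappa> b a * lam b"
    unfolding sum_split2[OF assms] r
    using assms by (simp add: hd1_simps lam_nz)
qed (use assms in \<open>simp add: hd2_sym[of a b b b] hd2_diag_fst hd1_simps field_simps\<close>)

lemma XPXP_mixed_diag_other:
  assumes "a \<in> N" "b \<in> N" "A \<in> N" "a \<noteq> b" "a \<noteq> A" "b \<noteq> A"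
  shows "R (XC a) (PsiC A) (XC b) (PsiC A) = 0"
proof (rule XPXP_mixed_rule[OF assms(1,2,4)])
  have r: "(\<Sum>C\<in>N-{a,b,A}. hd1 a C A * hd1 b C A / lam C) = (\<Sum>e\<in>N-{a,b,A}. 0)"
    by (intro sum.cong refl) (use assms in \<open>auto simp: hd1_simps\<close>)
  show "(\<Sum>C\<in>N. hd1 a C A * hd1 b C A / lam C) = (\<kappa> b a * \<kappa> a A + \<kappa> a b * \<kappa> b A) * lam A"
    unfolding sum_split3[OF assms] r kappa_transfer[OF assms, symmetric]
    using assms by (simp add: hd1_simps lam_nz)
qed (use assms in \<open>simp add: hd2_diag_other hd1_simps kappa_transfer[of a b A] field_simps\<close>)

lemma XPXP_mixed_cross:
  assumes "a \<in> N" "b \<in> N" "B \<in> N" "a \<noteq> b" "a \<noteq> B" "b \<noteq> B"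
  shows "R (XC a) (PsiC a) (XC b) (PsiC B) = 0" "R (XC a) (PsiC B) (XC b) (PsiC a) = 0"
proof -
  have r: "(\<Sum>C\<in>N-{a,b,B}. hd1 a C B * hd1 b C a / lam C) = (\<Sum>e\<in>N-{a,b,B}. 0)"
    by (intro sum.cong refl) (use assms in \<open>auto simp: hd1_simps\<close>)
  have "(\<Sum>C\<in>N. hd1 a C B * hd1 b C a / lam C) = - \<kappa> a B * \<kappa> b a * lam B"
    unfolding sum_split3[OF assms] r
    using assms by (simp add: hd1_simps lam_nz)
  then show "R (XC a) (PsiC a) (XC b) (PsiC B) = 0"
    by (rule XPXP_mixed_rule[OF assms(1,2,4)])
      (use assms in \<open>simp add: hd2_cross hd1_simps field_simps\<close>)
  have r: "(\<Sum>C\<in>N-{a,b,B}. hd1 a C a * hd1 b C B / lam C) = (\<Sum>e\<in>N-{a,b,B}. 0)"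
    by (intro sum.cong refl) (use assms in \<open>auto simp: hd1_simps\<close>)
  have "(\<Sum>C\<in>N. hd1 a C a * hd1 b C B / lam C) =
      \<kappa> a b * \<kappa> b B * lam B - (\<kappa> b a * \<kappa> a B + \<kappa> a b * \<kappa> b B) * lam B"
    unfolding sum_split3[OF assms] r kappa_transfer[OF assms(1,2,3,4,5,6), symmetric]
    using assms by (simp add: hd1_simps lam_nz)
  then show "R (XC a) (PsiC B) (XC b) (PsiC a) = 0"
    by (rule XPXP_mixed_rule[OF assms(1,2,4)])
      (use assms in \<open>simp add: hd2_sym'[of a b B a] hd2_cross hd1_simps field_simps\<close>)
qed

lemma XPXP_mixed_other:
  assumes "a \<in> N" "b \<in> N" "A \<in> N" "B \<in> N" "a \<noteq> b" "a \<noteq> A" "b \<noteq> A" "a \<noteq> B" "b \<noteq> B" "A \<noteq> B"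
  shows "R (XC a) (PsiC A) (XC b) (PsiC B) = 0"
proof (rule XPXP_mixed_rule[OF assms(1,2,5)])
  have r: "(\<Sum>C\<in>N-{a,b,A,B}. hd1 a C B * hd1 b C A / lam C) = (\<Sum>e\<in>N-{a,b,A,B}. 0)"
    by (intro sum.cong refl) (use assms in \<open>auto simp: hd1_simps\<close>)
  show "(\<Sum>C\<in>N. hd1 a C B * hd1 b C A / lam C) = 0"
    unfolding sum_split4[OF assms] r
    using assms by (simp add: hd1_simps lam_nz)
qed (use assms in \<open>simp add: hd2_other hd1_simps\<close>)

lemma PPPP_sectional:
  assumes "A \<in> N" "B \<in> N" "A \<noteq> B"
  shows "R (PsiC A) (PsiC B) (PsiC A) (PsiC B) = Sf A B * lam A * lam B"
proof -
  have r: "(\<Sum>e\<in>N-{A,B}. lam e * hd1 e A A * hd1 e B B)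
     = (\<Sum>e\<in>N-{A,B}. lam A * lam B * (lam e * (\<kappa> e A * \<kappa> e B)))"
    by (intro sum.cong refl) (use assms in \<open>auto simp: hd1_simps\<close>)
  have 1: "(\<Sum>e\<in>N. lam e * hd1 e A A * hd1 e B B) = lam A * lam B * (l1 A * \<kappa> A B + l1 B * \<kappa> B A
      - \<kappa> A B * (K A - \<kappa> A B * lam B) - \<kappa> B A * (K B - \<kappa> B A * lam A))"
    unfolding sum_split2[OF assms] r sum_distrib_left[symmetric] sum_kappa_kappa[OF assms]
    using assms by (simp add: hd1_simps algebra_simps)
  have r: "(\<Sum>e\<in>N-{A,B}. lam e * hd1 e A B * hd1 e B A) = (\<Sum>e\<in>N-{A,B}. 0)"
    by (intro sum.cong refl) (use assms in \<open>auto simp: hd1_simps\<close>)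
  have 2: "(\<Sum>e\<in>N. lam e * hd1 e A B * hd1 e B A) = lam A * lam B * (\<kappa> A B * \<kappa> A B * lam B + \<kappa> B A * \<kappa> B A * lam A)"
    unfolding sum_split2[OF assms] r
    using assms by (simp add: hd1_simps algebra_simps)
  show ?thesis unfolding R_PPPP 1 2 by (simp add: Sf_def M1_def field_simps)
qed

lemma PPPP_triple:
  assumes "A \<in> N" "B \<in> N" "C \<in> N" "A \<noteq> B" "A \<noteq> C" "B \<noteq> C"
  shows "R (PsiC A) (PsiC B) (PsiC A) (PsiC C) = 0"
proof -
  have r: "(\<Sum>e\<in>N-{A,B,C}. lam e * hd1 e A A * hd1 e B C) = (\<Sum>e\<in>N-{A,B,C}. 0)"
     "(\<Sum>e\<in>N-{A,B,C}. lam e * hd1 e A C * hd1 e B A) = (\<Sum>e\<in>N-{A,B,C}. 0)"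
    by (intro sum.cong refl; use assms in \<open>auto simp: hd1_simps\<close>)+
  have "R (PsiC A) (PsiC B) (PsiC A) (PsiC C) =
      lam A * lam B * lam C * (\<kappa> A B * \<kappa> A C + \<kappa> B A * \<kappa> B C + \<kappa> C A * \<kappa> C B) / 4"
    unfolding R_PPPP sum_split3[OF assms] r
    using assms by (simp add: hd1_simps field_simps)
  then show ?thesis using kappa_cyclic[OF assms] by simp
qed

lemma PPPP_distinct:
  assumes "A \<in> N" "B \<in> N" "C \<in> N" "D \<in> N" "A \<noteq> B" "A \<noteq> C" "B \<noteq> C" "A \<noteq> D" "B \<noteq> D" "C \<noteq> D"
  shows "R (PsiC A) (PsiC B) (PsiC C) (PsiC D) = 0"
proof -
  have "(\<Sum>e\<in>N. lam e * hd1 e A C * hd1 e B D) = 0" "(\<Sum>e\<in>N. lam e * hd1 e A D * hd1 e B C) = 0"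
    by (intro sum.neutral ballI; use assms in \<open>auto simp: hd1_simps\<close>)+
  then show ?thesis unfolding R_PPPP by simp
qed

lemma XXXX_sectional:
  assumes "a \<in> N" "b \<in> N" "a \<noteq> b"
  shows "R (XC a) (XC b) (XC a) (XC b) = Sf a b / (lam a * lam b)"
proof -
  have r: "(\<Sum>e\<in>N-{a,b}. lam e * gam e a a * gam e b b)
     = (\<Sum>e\<in>N-{a,b}. 1 / (4 * lam a * lam b) * (lam e * (\<kappa> e a * \<kappa> e b)))"
    by (intro sum.cong refl) (use assms in \<open>auto simp: gam_simps\<close>)
  have 1: "(\<Sum>e\<in>N. lam e * gam e a a * gam e b b) = 1 / (4 * lam a * lam b) * (l1 a * \<kappa> a b + l1 b * \<kappa> b a
      - \<kappa> a b * (K a - \<kappa> a b * lam b) - \<kappa> b a * (K b - \<kappa> b a * lam a))"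
    unfolding sum_split2[OF assms] r sum_distrib_left[symmetric] sum_kappa_kappa[OF assms]
    using assms by (simp add: gam_simps lam_nz field_simps)
  have r: "(\<Sum>e\<in>N-{a,b}. lam e * gam e b a * gam e a b) = (\<Sum>e\<in>N-{a,b}. 0)"
    by (intro sum.cong refl) (use assms in \<open>auto simp: gam_simps\<close>)
  have 2: "(\<Sum>e\<in>N. lam e * gam e b a * gam e a b) = (\<kappa> a b * \<kappa> a b / lam b + \<kappa> b a * \<kappa> b a / lam a) / 4"
    unfolding sum_split2[OF assms] r
    using assms by (simp add: gam_simps lam_nz field_simps)
  show ?thesis unfolding R_XXXX 1 2
    using assms by (simp add: gd2_def L1_def L2_def delta_eq Sf_def M1_def lam_nz field_simps)
qed

lemma XXXX_triple:
  assumes "a \<in> N" "b \<in> N" "c \<in> N" "a \<noteq> b" "a \<noteq> c" "b \<noteq> c"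
  shows "R (XC a) (XC b) (XC a) (XC c) = 0"
proof -
  have r: "(\<Sum>e\<in>N-{a,b,c}. lam e * gam e a a * gam e c b) = (\<Sum>e\<in>N-{a,b,c}. 0)"
     "(\<Sum>e\<in>N-{a,b,c}. lam e * gam e c a * gam e a b) = (\<Sum>e\<in>N-{a,b,c}. 0)"
    by (intro sum.cong refl; use assms in \<open>auto simp: gam_simps\<close>)+
  have 1: "R (XC a) (XC b) (XC a) (XC c) = - (\<kappa> c a * \<kappa> b a) / (2 * lam a)
     + (\<kappa> b a * \<kappa> c b + \<kappa> c a * \<kappa> b c) / (4 * lam a) + \<kappa> c a * \<kappa> b a / (4 * lam a)"
    unfolding R_XXXX sum_split3[OF assms] r
    using assms by (simp add: gam_simps gd2_def L1_def L2_def lam_nz field_simps)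
  have 2: "\<kappa> c a * \<kappa> b a = \<kappa> b c * \<kappa> c a + \<kappa> c b * \<kappa> b a"
    by (rule kappa_transfer) (use assms in auto)
  have "R (XC a) (XC b) (XC a) (XC c) = (\<kappa> b c * \<kappa> c a + \<kappa> c b * \<kappa> b a - \<kappa> c a * \<kappa> b a) / (4 * lam a)"
    unfolding 1 using assms by (simp add: lam_nz field_simps)
  then show ?thesis unfolding 2 by simp
qed

lemma XXXX_distinct:
  assumes "a \<in> N" "b \<in> N" "c \<in> N" "d \<in> N" "a \<noteq> b" "a \<noteq> c" "b \<noteq> c" "a \<noteq> d" "b \<noteq> d" "c \<noteq> d"
  shows "R (XC a) (XC b) (XC c) (XC d) = 0"
proof -
  have "(\<Sum>e\<in>N. lam e * gam e c a * gam e d b) = 0" "(\<Sum>e\<in>N. lam e * gam e d a * gam e c b) = 0"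
    by (intro sum.neutral ballI; use assms in \<open>auto simp: gam_eq\<close>)+
  then show ?thesis unfolding R_XXXX using assms by simp
qed

lemma Sf_commute: "Sf a b = Sf b a" and Ff_commute: "Ff a b = Ff b a"
  by (simp_all add: Sf_def Ff_def)

lemma Sf_self [simp]: "Sf a a = 0" and Ff_self [simp]: "Ff a a = 0"
  by (simp_all add: Sf_def Ff_def)

end


section \<open>The zero weight normal form of the curvature\<close>

text \<open>
  The common shape of the curvature in coordinates and in the frame: \<open>h\<close> and \<open>Q\<close> are families of
  antisymmetric and symmetric forms. The sums run over ordered pairs of labels, which avoids an
  ordering of the labels; in the first two sums the terms with \<open>a = b\<close> vanish for the coefficients
  used below.
\<close>

definition zero_weight_curvature ::
  "nat set \<Rightarrow> (nat \<Rightarrow> nat \<Rightarrow> real) \<Rightarrow> (nat \<Rightarrow> nat \<Rightarrow> real) \<Rightarrow> (nat \<Rightarrow> real) \<Rightarrow>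
    (nat \<Rightarrow> 'i \<Rightarrow> 'i \<Rightarrow> real) \<Rightarrow> (nat \<Rightarrow> 'i \<Rightarrow> 'i \<Rightarrow> real) \<Rightarrow> 'i \<Rightarrow> 'i \<Rightarrow> 'i \<Rightarrow> 'i \<Rightarrow> real" where
  "zero_weight_curvature N S F D h Q i j k l =
     (\<Sum>a\<in>N. \<Sum>b\<in>N. F a b * (2 * (h a i j * h b k l) + h a i k * h b j l - h a i l * h b j k))
     + (\<Sum>a\<in>N. \<Sum>b\<in>N. S a b * (Q a i k * Q b j l - Q a i l * Q b j k))
     + (\<Sum>a\<in>N. D a * (h a i j * h a k l))"

text \<open>
  The first sum satisfies the Bianchi identity because of its coefficients \<open>2, 1, -1\<close>, the second
  one because \<open>Q\<close> is symmetric, and the third one needs that each \<open>h a\<close> has rank two, which is the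
  Pluecker relation.
\<close>

lemma curvature_like_zero_weight_curvature:
  assumes S: "\<And>a b. S a b = S b a" and F: "\<And>a b. F a b = F b a"
    and h: "\<And>a i j. h a i j = - h a j i" and Q: "\<And>a i j. Q a i j = Q a j i"
    and plucker: "\<And>a i j k l. h a i j * h a k l + h a i k * h a l j + h a i l * h a j k = 0"
  shows "curvature_like I (zero_weight_curvature N S F D h Q)"
proof -
  define f where "f = (\<lambda>i j k l. \<Sum>a\<in>N. \<Sum>b\<in>N. F a b * (h a i j * h b k l))"
  define s where "s = (\<lambda>i j k l. \<Sum>a\<in>N. \<Sum>b\<in>N. S a b * (Q a i j * Q b k l))"
  define d where "d = (\<lambda>i j k l. \<Sum>a\<in>N. D a * (h a i j * h a k l))"
  have T: "zero_weight_curvature N S F D h Q i j k l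
     = 2 * f i j k l + f i k j l - f i l j k + s i k j l - s i l j k + d i j k l" for i j k l
    unfolding zero_weight_curvature_def f_def s_def d_def
    by (simp only: distrib_left right_diff_distrib sum.distrib sum_subtractf mult.left_commute[of _ 2]
        sum_distrib_left[symmetric])
  have f1: "f j i k l = - f i j k l" for i j k l
    unfolding f_def by (subst h) (simp add: sum_negf)
  have f2: "f i j l k = - f i j k l" for i j k l
    unfolding f_def by (subst (2) h) (simp add: sum_negf)
  have f3: "f k l i j = f i j k l" for i j k l
  proof -
    have "f k l i j = (\<Sum>b\<in>N. \<Sum>a\<in>N. F a b * (h a k l * h b i j))"
      unfolding f_def by (rule sum.swap)
    also have "\<dots> = f i j k l"
      unfolding f_def by (intro sum.cong refl) (simp add: F[of _ _] mult_ac)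
    finally show ?thesis .
  qed
  have s1: "s j i k l = s i j k l" for i j k l
    unfolding s_def by (subst Q) simp
  have s2: "s i j l k = s i j k l" for i j k l
    unfolding s_def by (subst (2) Q) simp
  have s3: "s k l i j = s i j k l" for i j k l
  proof -
    have "s k l i j = (\<Sum>b\<in>N. \<Sum>a\<in>N. S a b * (Q a k l * Q b i j))"
      unfolding s_def by (rule sum.swap)
    also have "\<dots> = s i j k l"
      unfolding s_def by (intro sum.cong refl) (simp add: S[of _ _] mult_ac)
    finally show ?thesis .
  qed
  have d1: "d j i k l = - d i j k l" for i j k l
    unfolding d_def by (subst h) (simp add: sum_negf)
  have d2: "d i j l k = - d i j k l" for i j k l
    unfolding d_def by (subst (2) h) (simp add: sum_negf)
  have d3: "d k l i j = d i j k l" for i j k l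
    unfolding d_def by (simp add: mult_ac)
  have d4: "d i j k l + d i k l j + d i l j k = 0" for i j k l
    unfolding d_def sum.distrib[symmetric] distrib_left[symmetric] plucker by simp
  show ?thesis unfolding curvature_like_def T
  proof (intro ballI conjI)
    fix i j k l
    show "2 * f j i k l + f j k i l - f j l i k + s j k i l - s j l i k + d j i k l =
      - (2 * f i j k l + f i k j l - f i l j k + s i k j l - s i l j k + d i j k l)"
      using f1[of j i k l] f3[of j k i l] f3[of j l i k] s3[of j k i l] s3[of j l i k] d1[of j i k l] by linarith
    show "2 * f i j l k + f i l j k - f i k j l + s i l j k - s i k j l + d i j l k =
      - (2 * f i j k l + f i k j l - f i l j k + s i k j l - s i l j k + d i j k l)"
      using f2[of i j l k] d2[of i j l k] by linarith
    show "2 * f k l i j + f k i l j - f k j l i + s k i l j - s k j l i + d k l i j =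
      2 * f i j k l + f i k j l - f i l j k + s i k j l - s i l j k + d i j k l"
      using f3[of k l i j] f1[of k i l j] f2[of i k l j] f3[of k j l i] f1[of l i k j] f2[of i l k j]
        s1[of k i l j] s2[of i k l j] s3[of k j l i] s1[of l i k j] s2[of i l k j] d3[of k l i j] by linarith
    show "2 * f i j k l + f i k j l - f i l j k + s i k j l - s i l j k + d i j k l
      + (2 * f i k l j + f i l k j - f i j k l + s i l k j - s i j k l + d i k l j)
      + (2 * f i l j k + f i j l k - f i k l j + s i j l k - s i k l j + d i l j k) = 0"
      using f2[of i k j l] f2[of i l k j] f2[of i j k l] s2[of i k j l] s2[of i l k j] s2[of i j k l]
        d4[of i j k l] by linarith
  qed
qed

fun leg_of :: "coord \<Rightarrow> nat" where
  "leg_of (XC a) = a" | "leg_of (PsiC a) = a"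

fun pairing :: "coord \<Rightarrow> coord \<Rightarrow> real" where
  "pairing (XC a) (PsiC b) = (if a = b then 1 else 0)"
| "pairing (PsiC a) (XC b) = (if a = b then -1 else 0)"
| "pairing (XC a) (XC b) = 0"
| "pairing (PsiC a) (PsiC b) = 0"

text \<open>
  The components of \<open>h\<^sub>a = dx\<^sub>a \<and> w\<^sub>a\<close> in the frame; the coefficients of the orthonormal coframe
  cancel.
\<close>

definition h_frame :: "nat \<Rightarrow> coord \<Rightarrow> coord \<Rightarrow> real" where
  "h_frame a F G = (if leg_of F = a then pairing F G else 0)"

context kerr_point
begin

definition Q_frame :: "nat \<Rightarrow> coord \<Rightarrow> coord \<Rightarrow> real" where
  "Q_frame a F G = (if leg_of F = a \<and> F = G then 1 / weight F else 0)"

abbreviation T :: "coord \<Rightarrow> coord \<Rightarrow> coord \<Rightarrow> coord \<Rightarrow> real" where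
  "T \<equiv> zero_weight_curvature N Sf Ff Df h_frame Q_frame"

text \<open>
  Each form is concentrated on the two frame vectors of its label, so the sums over labels
  collapse.
\<close>

lemma T_eq:
  assumes "F \<in> labels" "G \<in> labels" "H \<in> labels" "L \<in> labels"
  shows "T F G H L =
    2 * Ff (leg_of F) (leg_of H) * pairing F G * pairing H L
    + Ff (leg_of F) (leg_of G) * pairing F H * pairing G L
    - Ff (leg_of F) (leg_of G) * pairing F L * pairing G H
    + Sf (leg_of F) (leg_of G) / (weight F * weight G) *
        ((if F = H \<and> G = L then 1 else 0) - (if F = L \<and> G = H then 1 else 0))
    + (if leg_of F = leg_of H then Df (leg_of F) * pairing F G * pairing H L else 0)"
proof -
  have leg: "leg_of E \<in> N" if "E \<in> labels" for E
    using that by (auto simp: labels_def)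
  have f: "(\<Sum>a\<in>N. \<Sum>b\<in>N. Ff a b * (h_frame a A B * h_frame b C D)) =
      Ff (leg_of A) (leg_of C) * pairing A B * pairing C D" if "A \<in> labels" "C \<in> labels" for A B C D
  proof -
    have "(\<Sum>a\<in>N. \<Sum>b\<in>N. Ff a b * (h_frame a A B * h_frame b C D)) =
      (\<Sum>a\<in>N. if leg_of A = a then (\<Sum>b\<in>N. if leg_of C = b then Ff a b * pairing A B * pairing C D else 0) else 0)"
      unfolding h_frame_def by (intro sum.cong refl) (auto intro!: sum.cong)
    then show ?thesis using leg that finN by simp
  qed
  have s: "(\<Sum>a\<in>N. \<Sum>b\<in>N. Sf a b * (Q_frame a A B * Q_frame b C D)) =
      Sf (leg_of A) (leg_of C) / (weight A * weight C) * (if A = B \<and> C = D then 1 else 0)"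
    if "A \<in> labels" "C \<in> labels" for A B C D
  proof -
    have "(\<Sum>a\<in>N. \<Sum>b\<in>N. Sf a b * (Q_frame a A B * Q_frame b C D)) =
      (\<Sum>a\<in>N. if leg_of A = a then (\<Sum>b\<in>N. if leg_of C = b then
          Sf a b / (weight A * weight C) * (if A = B \<and> C = D then 1 else 0) else 0) else 0)"
      unfolding Q_frame_def by (intro sum.cong refl) (auto intro!: sum.cong sum.neutral)
    then show ?thesis by (simp only: sum.delta'[OF finN] leg that if_True)
  qed
  have d: "(\<Sum>a\<in>N. Df a * (h_frame a F G * h_frame a H L)) =
     (if leg_of F = leg_of H then Df (leg_of F) * pairing F G * pairing H L else 0)"
  proof -
    have "(\<Sum>a\<in>N. Df a * (h_frame a F G * h_frame a H L)) =
      (\<Sum>a\<in>N. if leg_of F = a then (if leg_of F = leg_of H then Df a * pairing F G * pairing H L else 0) else 0)"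
      unfolding h_frame_def by (intro sum.cong refl) auto
    then show ?thesis using leg assms finN by simp
  qed
  show ?thesis
    unfolding zero_weight_curvature_def
    by (simp only: distrib_left right_diff_distrib sum.distrib sum_subtractf mult.left_commute[of _ 2]
        sum_distrib_left[symmetric] f s d assms)
qed

lemma curvature_like_T: "curvature_like labels T"
proof (rule curvature_like_zero_weight_curvature)
  show "Sf a b = Sf b a" "Ff a b = Ff b a" for a b by (rule Sf_commute Ff_commute)+
  show "h_frame a F G = - h_frame a G F" for a F G
    by (cases F; cases G) (auto simp: h_frame_def)
  show "Q_frame a F G = Q_frame a G F" for a F G
    by (auto simp: Q_frame_def)
  show "h_frame a F G * h_frame a H L + h_frame a F H * h_frame a L G + h_frame a F L * h_frame a G H = 0" for a F G H L
    by (cases F; cases G; cases H; cases L) (auto simp: h_frame_def)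
qed

lemma curvature_like_R: "curvature_like labels R"
proof (rule curvature_like_frame_riemann)
  show "d1 D F G = d1 D G F" for D F G
    by (cases D; cases F; cases G) (auto simp: hd1_sym)
  show "d2 C D F G = d2 D C F G" for C D F G
    by (cases C; cases D; cases F; cases G) (auto simp: gd2_sym hd2_sym)
  show "d2 C D F G = d2 C D G F" for C D F G
    by (cases C; cases D; cases F; cases G) (auto simp: hd2_sym')
qed

lemma XC_labels [simp]: "XC a \<in> labels \<longleftrightarrow> a \<in> N" and PsiC_labels [simp]: "PsiC a \<in> labels \<longleftrightarrow> a \<in> N"
  by (auto simp: labels_def)

theorem R_eq_T:
  assumes "F \<in> labels" "G \<in> labels" "H \<in> labels" "L \<in> labels"
  shows "R F G H L = T F G H L"
proof -
  have X: "XC ` N \<subseteq> labels" and P: "PsiC ` N \<subseteq> labels" by (auto simp: labels_def)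
  show ?thesis
  proof (rule curvature_like_eqI_split[of "XC ` N" "PsiC ` N" R T])
    fix i j k l assume m: "i \<in> XC ` N" "j \<in> XC ` N" "k \<in> XC ` N" "l \<in> XC ` N"
    show "R i j k l = T i j k l"
    proof (rule curvature_like_eqI[OF curvature_like_mono[OF curvature_like_R X]
          curvature_like_mono[OF curvature_like_T X] _ _ _ m])
      fix i j assume "i \<in> XC ` N" "j \<in> XC ` N" "i \<noteq> j"
      then obtain a b where "i = XC a" "j = XC b" "a \<in> N" "b \<in> N" "a \<noteq> b" by blast
      then show "R i j i j = T i j i j" by (simp add: T_eq XXXX_sectional)
    next
      fix i j k assume "i \<in> XC ` N" "j \<in> XC ` N" "k \<in> XC ` N" "i \<noteq> j" "i \<noteq> k" "j \<noteq> k"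
      then obtain a b c where "i = XC a" "j = XC b" "k = XC c" "a \<in> N" "b \<in> N" "c \<in> N"
        "a \<noteq> b" "a \<noteq> c" "b \<noteq> c" by blast
      then show "R i j i k = T i j i k" by (simp add: T_eq XXXX_triple)
    next
      fix i j k l assume "i \<in> XC ` N" "j \<in> XC ` N" "k \<in> XC ` N" "l \<in> XC ` N"
        "i \<noteq> j" "i \<noteq> k" "j \<noteq> k" "i \<noteq> l" "j \<noteq> l" "k \<noteq> l"
      then obtain a b c d where "i = XC a" "j = XC b" "k = XC c" "l = XC d"
        "a \<in> N" "b \<in> N" "c \<in> N" "d \<in> N"
        "a \<noteq> b" "a \<noteq> c" "b \<noteq> c" "a \<noteq> d" "b \<noteq> d" "c \<noteq> d" by blast
      then show "R i j k l = T i j k l" by (simp add: T_eq XXXX_distinct)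
    qed
  next
    fix i j k l assume m: "i \<in> PsiC ` N" "j \<in> PsiC ` N" "k \<in> PsiC ` N" "l \<in> PsiC ` N"
    show "R i j k l = T i j k l"
    proof (rule curvature_like_eqI[OF curvature_like_mono[OF curvature_like_R P]
          curvature_like_mono[OF curvature_like_T P] _ _ _ m])
      fix i j assume "i \<in> PsiC ` N" "j \<in> PsiC ` N" "i \<noteq> j"
      then obtain a b where "i = PsiC a" "j = PsiC b" "a \<in> N" "b \<in> N" "a \<noteq> b" by blast
      then show "R i j i j = T i j i j" by (simp add: T_eq PPPP_sectional)
    next
      fix i j k assume "i \<in> PsiC ` N" "j \<in> PsiC ` N" "k \<in> PsiC ` N" "i \<noteq> j" "i \<noteq> k" "j \<noteq> k"
      then obtain a b c where "i = PsiC a" "j = PsiC b" "k = PsiC c" "a \<in> N" "b \<in> N" "c \<in> N"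
        "a \<noteq> b" "a \<noteq> c" "b \<noteq> c" by blast
      then show "R i j i k = T i j i k" by (simp add: T_eq PPPP_triple)
    next
      fix i j k l assume "i \<in> PsiC ` N" "j \<in> PsiC ` N" "k \<in> PsiC ` N" "l \<in> PsiC ` N"
        "i \<noteq> j" "i \<noteq> k" "j \<noteq> k" "i \<noteq> l" "j \<noteq> l" "k \<noteq> l"
      then obtain a b c d where "i = PsiC a" "j = PsiC b" "k = PsiC c" "l = PsiC d"
        "a \<in> N" "b \<in> N" "c \<in> N" "d \<in> N"
        "a \<noteq> b" "a \<noteq> c" "b \<noteq> c" "a \<noteq> d" "b \<noteq> d" "c \<noteq> d" by blast
      then show "R i j k l = T i j k l" by (simp add: T_eq PPPP_distinct)
    qed
  next
    fix i j k l assume "i \<in> XC ` N" "j \<in> PsiC ` N" "k \<in> XC ` N" "l \<in> PsiC ` N"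
    then obtain a A b B where *: "i = XC a" "j = PsiC A" "k = XC b" "l = PsiC B"
      "a \<in> N" "A \<in> N" "b \<in> N" "B \<in> N" by auto
    have pair: "R (XC a) (PsiC A) (XC b) (PsiC B) = R (XC b) (PsiC B) (XC a) (PsiC A)"
      by (rule curvature_likeD(3)[OF curvature_like_R]) (use * in auto)
    have "R (XC a) (PsiC A) (XC b) (PsiC B) = T (XC a) (PsiC A) (XC b) (PsiC B)"
    proof (cases "a = b")
      case True
      consider "A = a" "B = a" | "A = a" "B \<noteq> a" | "A \<noteq> a" "B = a" | "A \<noteq> a" "B = A"
        | "A \<noteq> a" "B \<noteq> a" "B \<noteq> A" by blast
      then show ?thesis
      proof cases
        case 3 then show ?thesis unfolding pair using * True by (simp add: T_eq XPXP_same_cross)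
      qed (use * True in \<open>simp_all add: T_eq XPXP_same_diag XPXP_same_self XPXP_same_cross XPXP_same_other\<close>)
    next
      case False
      consider "A = a" "B = b" | "A = b" "B = a" | "A = B" "A = a" | "A = B" "A = b"
        | "A = B" "A \<noteq> a" "A \<noteq> b" | "A \<noteq> B" "A = a" "B \<noteq> b" | "A \<noteq> B" "A = b" "B \<noteq> a"
        | "A \<noteq> B" "B = a" "A \<noteq> b" | "A \<noteq> B" "B = b" "A \<noteq> a"
        | "A \<noteq> B" "A \<noteq> a" "A \<noteq> b" "B \<noteq> a" "B \<noteq> b" by blast
      then show ?thesis
      proof cases
        case 7 then show ?thesis unfolding pair using * False by (simp add: T_eq XPXP_mixed_cross)
      next
        case 9 then show ?thesis unfolding pair using * False by (simp add: T_eq XPXP_mixed_cross)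
      qed (use * False in \<open>simp_all add: T_eq XPXP_matching XPXP_swapped XPXP_mixed_diag_fst
            XPXP_mixed_diag_snd XPXP_mixed_diag_other XPXP_mixed_cross XPXP_mixed_other\<close>)
    qed
    then show "R i j k l = T i j k l" using * by simp
  next
    fix i j k l assume "i \<in> XC ` N" "j \<in> XC ` N" "k \<in> XC ` N" "l \<in> PsiC ` N"
    then show "R i j k l = T i j k l" by (auto simp: T_eq R_zero_XXXP)
  next
    fix i j k l assume "i \<in> XC ` N" "j \<in> PsiC ` N" "k \<in> PsiC ` N" "l \<in> PsiC ` N"
    then show "R i j k l = T i j k l" by (auto simp: T_eq R_zero_XPPP)
  qed (use curvature_like_R curvature_like_T assms in \<open>auto simp: labels_def\<close>)
qed

end


section \<open>Elementary symmetric functions and Lagrange interpolation\<close>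

definition esym :: "(nat \<Rightarrow> real) \<Rightarrow> nat set \<Rightarrow> nat \<Rightarrow> real" where
  "esym u S k = (\<Sum>T | T \<subseteq> S \<and> card T = k. \<Prod>\<nu>\<in>T. u \<nu>)"

lemma esym_cong: "(\<And>\<nu>. \<nu> \<in> S \<Longrightarrow> u \<nu> = v \<nu>) \<Longrightarrow> esym u S k = esym v S k"
  unfolding esym_def by (intro sum.cong prod.cong refl) auto

lemma esym_0: "finite S \<Longrightarrow> esym u S 0 = 1"
proof -
  assume "finite S"
  then have "{T. T \<subseteq> S \<and> card T = 0} = {{}}" by (auto dest: finite_subset)
  then show ?thesis by (simp add: esym_def)
qed

lemma esym_insert:
  assumes "finite S" "a \<notin> S"
  shows "esym u (insert a S) (Suc k) = esym u S (Suc k) + u a * esym u S k"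
proof -
  let ?A = "{T. T \<subseteq> S \<and> card T = Suc k}" and ?B = "{T. T \<subseteq> S \<and> card T = k}"
  have eq: "{T. T \<subseteq> insert a S \<and> card T = Suc k} = ?A \<union> insert a ` ?B"
  proof (intro equalityI subsetI)
    fix T assume T: "T \<in> {T. T \<subseteq> insert a S \<and> card T = Suc k}"
    show "T \<in> ?A \<union> insert a ` ?B"
    proof (cases "a \<in> T")
      case True
      then have "T = insert a (T - {a})" by blast
      moreover have "T - {a} \<in> ?B" using T True by auto
      ultimately show ?thesis by blast
    next
      case False then show ?thesis using T by auto
    qed
  next
    fix T assume T: "T \<in> ?A \<union> insert a ` ?B"
    then show "T \<in> {T. T \<subseteq> insert a S \<and> card T = Suc k}"
    proof
      assume "T \<in> insert a ` ?B"
      then obtain T' where T': "T = insert a T'" "T' \<subseteq> S" "card T' = k" by auto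
      then have "finite T'" "a \<notin> T'" using assms by (auto dest: finite_subset)
      then show ?thesis using T' by auto
    qed auto
  qed
  have fin: "finite ?A" "finite ?B" using assms by (auto intro: rev_finite_subset[of "Pow S"])
  have inj: "inj_on (insert a) ?B"
  proof (rule inj_onI)
    fix T T' assume "T \<in> ?B" "T' \<in> ?B" "insert a T = insert a T'"
    moreover from this have "a \<notin> T" "a \<notin> T'" using assms by blast+
    ultimately show "T = T'" by (simp add: insert_ident)
  qed
  have "(\<Sum>T\<in>insert a ` ?B. \<Prod>\<nu>\<in>T. u \<nu>) = (\<Sum>T\<in>?B. u a * (\<Prod>\<nu>\<in>T. u \<nu>))"
    unfolding sum.reindex[OF inj] comp_def
  proof (intro sum.cong refl)
    fix T assume "T \<in> ?B"
    then have "finite T" "a \<notin> T" using assms by (auto dest: finite_subset)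
    then show "(\<Prod>\<nu>\<in>insert a T. u \<nu>) = u a * (\<Prod>\<nu>\<in>T. u \<nu>)" by simp
  qed
  moreover have "?A \<inter> insert a ` ?B = {}" using assms by blast
  ultimately show ?thesis
    unfolding esym_def eq using fin
    by (simp only: sum.union_disjoint finite_imageI sum_distrib_left)
qed

text \<open>
  The shift by one is totalised with value 0 at \<open>k = 0\<close>, so that the recursion holds for all \<open>k\<close>.
\<close>

definition esym_prev :: "(nat \<Rightarrow> real) \<Rightarrow> nat set \<Rightarrow> nat \<Rightarrow> real" where
  "esym_prev u S k = (case k of 0 \<Rightarrow> 0 | Suc j \<Rightarrow> esym u S j)"

lemma esym_insert_eq:
  "finite S \<Longrightarrow> a \<notin> S \<Longrightarrow> esym u (insert a S) k = esym u S k + u a * esym_prev u S k"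
  by (cases k) (simp_all add: esym_prev_def esym_0 esym_insert)

lemma esym_high: "finite S \<Longrightarrow> card S < k \<Longrightarrow> esym u S k = 0"
proof -
  assume "finite S" "card S < k"
  then have "{T. T \<subseteq> S \<and> card T = k} = {}" by (auto dest: card_mono)
  then show ?thesis unfolding esym_def by (simp only: sum.empty)
qed

lemma esym_card: "finite S \<Longrightarrow> esym u S (card S) = (\<Prod>\<nu>\<in>S. u \<nu>)"
proof -
  assume "finite S"
  then have "{T. T \<subseteq> S \<and> card T = card S} = {S}" by (auto dest: card_subset_eq)
  then show ?thesis unfolding esym_def by simp
qed

lemma esym_generating:
  assumes "finite S"
  shows "(\<Sum>k\<le>card S. esym u S k * t ^ (card S - k)) = (\<Prod>\<nu>\<in>S. u \<nu> + t)"
proof -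
  have "(\<Prod>\<nu>\<in>S. u \<nu> + t) = (\<Sum>T\<in>Pow S. (\<Prod>\<nu>\<in>T. u \<nu>) * t ^ card (S - T))"
    using prod_add[OF assms, of u "\<lambda>_. t"] by simp
  also have "\<dots> = (\<Sum>T\<in>Pow S. (\<Prod>\<nu>\<in>T. u \<nu>) * t ^ (card S - card T))"
    by (intro sum.cong refl) (use assms in \<open>auto simp: card_Diff_subset finite_subset\<close>)
  also have "\<dots> = (\<Sum>k\<le>card S. \<Sum>T\<in>{T \<in> Pow S. card T = k}. (\<Prod>\<nu>\<in>T. u \<nu>) * t ^ (card S - card T))"
    by (rule sum.group[symmetric]) (use assms in \<open>auto intro: card_mono\<close>)
  also have "\<dots> = (\<Sum>k\<le>card S. esym u S k * t ^ (card S - k))"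
    unfolding esym_def sum_distrib_right by (intro sum.cong) auto
  finally show ?thesis ..
qed

text \<open>
  The coefficients of the vectors dual to the covectors \<open>w\<^sub>a\<close>: row \<open>a\<close> evaluates the polynomial with
  coefficients \<open>esym u (N - {b})\<close>, that is \<open>\<Prod>\<^sub>\<nu>\<^sub>\<noteq>\<^sub>b (u\<^sub>\<nu> + t)\<close>, at \<open>t = - u\<^sub>a\<close> and normalises.
\<close>

definition lagrange :: "(nat \<Rightarrow> real) \<Rightarrow> nat set \<Rightarrow> nat \<Rightarrow> nat \<Rightarrow> real" where
  "lagrange u N a k = (- u a) ^ (card N - Suc k) / (\<Prod>\<nu>\<in>N-{a}. u \<nu> - u a)"

lemma esym_lagrange:
  assumes N: "finite N" and inj: "inj_on u N" and m: "a \<in> N" "b \<in> N"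
  shows "(\<Sum>k<card N. esym u (N-{b}) k * lagrange u N a k) = (if a = b then 1 else 0)"
proof -
  have card: "card (N-{b}) = card N - 1" and pos: "card N > 0"
    using N m by (auto simp: card_gt_0_iff)
  have eq: "{..<card N} = {..card (N-{b})}"
    using card pos by auto
  have "(\<Sum>k<card N. esym u (N-{b}) k * lagrange u N a k)
     = (\<Sum>k\<le>card (N-{b}). esym u (N-{b}) k * (- u a) ^ (card (N-{b}) - k)) / (\<Prod>\<nu>\<in>N-{a}. u \<nu> - u a)"
    unfolding sum_divide_distrib eq lagrange_def card by simp
  also have "\<dots> = (\<Prod>\<nu>\<in>N-{b}. u \<nu> - u a) / (\<Prod>\<nu>\<in>N-{a}. u \<nu> - u a)"
    using N by (subst esym_generating) auto
  also have "\<dots> = (if a = b then 1 else 0)"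
  proof (cases "a = b")
    case True
    have "(\<Prod>\<nu>\<in>N-{b}. u \<nu> - u b) \<noteq> 0" using N inj m by (auto simp: inj_on_def)
    then show ?thesis using True by simp
  next
    case False
    then have "(\<Prod>\<nu>\<in>N-{b}. u \<nu> - u a) = 0" using N m by auto
    then show ?thesis using False by simp
  qed
  finally show ?thesis .
qed

text \<open>
  The left hand side is a polynomial of degree less than \<open>card N\<close>, evaluated at the \<open>card N\<close>
  different points \<open>- u\<^sub>a\<close>.
\<close>

lemma lagrange_separates:
  assumes N: "finite N" and inj: "inj_on u N"
    and z: "\<And>a. a \<in> N \<Longrightarrow> (\<Sum>l<card N. z l * lagrange u N a l) = 0" and k: "k < card N"
  shows "z k = 0"
proof (rule ccontr)
  assume nz: "z k \<noteq> 0"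
  define d where "d = card N - 1"
  have d: "{..<card N} = {..d}" "k \<le> d" using k by (auto simp: d_def)
  (* reversed coefficients, so that the exponents increase *)
  define c where "c = (\<lambda>i. z (d - i))"
  have "(\<Sum>i\<le>d. c i * (- u a) ^ i) = 0" if "a \<in> N" for a
  proof -
    have "(\<Prod>\<nu>\<in>N-{a}. u \<nu> - u a) \<noteq> 0" using N inj that by (auto simp: inj_on_def)
    then have "(\<Sum>l<card N. z l * (- u a) ^ (card N - Suc l)) = 0"
      using z[OF that] by (simp add: lagrange_def sum_divide_distrib[symmetric])
    then have "(\<Sum>l\<le>d. z l * (- u a) ^ (d - l)) = 0"
      unfolding d by (simp add: d_def)
    moreover have "(\<Sum>i\<le>d. c i * (- u a) ^ i) = (\<Sum>l\<le>d. z l * (- u a) ^ (d - l))"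
      unfolding c_def by (rule sum.reindex_bij_witness[of _ "\<lambda>l. d - l" "\<lambda>i. d - i"]) auto
    ultimately show ?thesis by simp
  qed
  then have sub: "(\<lambda>a. - u a) ` N \<subseteq> {x. (\<Sum>i\<le>d. c i * x ^ i) = 0}" by auto
  have c: "c (d - k) \<noteq> 0" "d - k \<le> d" using nz d by (auto simp: c_def)
  have fin: "finite {x. (\<Sum>i\<le>d. c i * x ^ i) = 0}" "card {x. (\<Sum>i\<le>d. c i * x ^ i) = 0} \<le> d"
    using Poly_Roots.polyfun_rootbound[of d c] c by blast+
  have "card N = card ((\<lambda>a. - u a) ` N)"
    using inj by (subst card_image) (auto simp: inj_on_def)
  also have "\<dots> \<le> d" using card_mono[OF fin(1) sub] fin(2) by linarith
  finally show False using k by (simp add: d_def)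
qed

text \<open>
  A left inverse of a square matrix is a right inverse. Here it is simplest to observe that the
  difference of both sides is annihilated by all rows of \<open>lagrange\<close>.
\<close>

lemma lagrange_complete:
  assumes N: "finite N" and inj: "inj_on u N" and k: "k < card N" "l < card N"
  shows "(\<Sum>a\<in>N. esym u (N-{a}) k * lagrange u N a l) = (if k = l then 1 else 0)"
proof -
  define z where "z = (\<lambda>j. (\<Sum>a\<in>N. esym u (N-{a}) j * lagrange u N a l) - (if j = l then 1 else 0))"
  have "(\<Sum>j<card N. z j * lagrange u N b j) = 0" if b: "b \<in> N" for b
  proof -
    have "(\<Sum>j<card N. (\<Sum>a\<in>N. esym u (N-{a}) j * lagrange u N a l) * lagrange u N b j)
      = (\<Sum>a\<in>N. (\<Sum>j<card N. esym u (N-{a}) j * lagrange u N b j) * lagrange u N a l)"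
      unfolding sum_distrib_right by (subst sum.swap) (simp add: mult_ac)
    also have "\<dots> = (\<Sum>a\<in>N. if b = a then lagrange u N a l else 0)"
      by (intro sum.cong refl) (simp add: esym_lagrange[OF N inj b])
    also have "\<dots> = lagrange u N b l" using N b by simp
    finally have "(\<Sum>j<card N. (\<Sum>a\<in>N. esym u (N-{a}) j * lagrange u N a l) * lagrange u N b j) = lagrange u N b l" .
    moreover have "(\<Sum>j<card N. (if j = l then 1 else 0) * lagrange u N b j) = lagrange u N b l"
      using k by (simp add: if_distrib[of "\<lambda>t. t * _"] cong: if_cong)
    ultimately show ?thesis by (simp add: z_def left_diff_distrib sum_subtractf)
  qed
  then have "z k = 0" using lagrange_separates[OF N inj _ k(1)] by blast
  then show ?thesis by (simp add: z_def)
qed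


section \<open>Structure equations of the coframe\<close>

lemma has_partial_prod:
  assumes "finite S" "\<And>s. s \<in> S \<Longrightarrow> has_partial (f s) (D s) a q" "\<And>s. s \<in> S \<Longrightarrow> f s q \<noteq> 0"
  shows "has_partial (\<lambda>r. \<Prod>s\<in>S. f s r) ((\<Prod>s\<in>S. f s q) * (\<Sum>s\<in>S. D s / f s q)) a q"
  using assms
proof (induction S rule: finite_induct)
  case empty then show ?case by (simp add: has_partial_const)
next
  case (insert s S)
  have "has_partial (\<lambda>r. f s r * (\<Prod>s\<in>S. f s r))
     (D s * (\<Prod>s\<in>S. f s q) + ((\<Prod>s\<in>S. f s q) * (\<Sum>s\<in>S. D s / f s q)) * f s q) a q"
    by (rule has_partial_mult) (use insert in auto)
  moreover have "f s q \<noteq> 0" using insert by simp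
  ultimately show ?case unfolding prod.insert[OF insert(1,2)] sum.insert[OF insert(1,2)]
    by (elim has_partial_eq) (simp add: distrib_left)
qed

lemma has_partial_line_nonzero:
  assumes "has_partial f D a q" "f q \<noteq> 0"
  shows "\<forall>\<^sub>F t in nhds (q a). f (q(a := t)) \<noteq> 0"
proof -
  have "isCont (\<lambda>t. f (q(a := t))) (q a)"
    using assms(1) unfolding has_partial_def by (rule DERIV_isCont)
  then have "((\<lambda>t. f (q(a := t))) \<longlongrightarrow> f q) (nhds (q a))"
    by (simp add: continuous_within tendsto_nhds_iff)
  then show ?thesis using assms(2) by (rule tendsto_imp_eventually_ne)
qed

lemma has_partial_XC: "has_partial (\<lambda>r. r b) (if a = b then 1 else 0) a q"
  by (auto simp: has_partial_def)

text \<open>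
  All coefficients depend on the \<open>x\<close>-coordinates only, so derivatives along \<open>\<psi>\<close> are zero.
\<close>

definition psi_free :: "((coord \<Rightarrow> real) \<Rightarrow> 'a) \<Rightarrow> bool" where
  "psi_free f \<longleftrightarrow> (\<forall>q k t. f (q(PsiC k := t)) = f q)"

lemma psi_free_has_partial: "psi_free f \<Longrightarrow> has_partial f 0 (PsiC k) q"
  by (simp add: psi_free_def has_partial_def)

text \<open>
  Derivatives in both kinds of coordinate directions are thereby written as one tensor expression,
  which can be contracted with arbitrary vectors.
\<close>

lemma has_partial_coord:
  assumes "psi_free f" "\<And>\<mu>. \<mu> \<in> {1..n} \<Longrightarrow> has_partial f (D \<mu>) (XC \<mu>) q" "a \<in> coords n \<epsilon>"
  shows "has_partial f (\<Sum>\<mu>=1..n. dx \<mu> a * D \<mu>) a q"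
proof (cases a)
  case (XC \<nu>)
  have "(\<Sum>\<mu>=1..n. dx \<mu> a * D \<mu>) = (\<Sum>\<mu>=1..n. if \<nu> = \<mu> then D \<mu> else 0)"
    by (intro sum.cong) (auto simp: dx_def XC)
  then show ?thesis using assms XC by (auto simp: coords_def)
next
  case (PsiC k)
  then show ?thesis using psi_free_has_partial[OF assms(1)] by (simp add: dx_def)
qed

text \<open>
  The condition on \<open>c\<close> is a consequence of positive definiteness (\<open>kerr_domain_c_nonzero\<close>); on the
  domain \<open>dom\<close> below the metric is only nondegenerate, which makes the domain open along lines
  for elementary reasons.
\<close>

locale kerr_chart =
  fixes n \<epsilon> :: nat and c :: real and X :: "nat \<Rightarrow> real \<Rightarrow> real" and J :: "nat \<Rightarrow> real set"
  assumes n: "n \<ge> 1" and \<epsilon>: "\<epsilon> \<in> {0, 1}"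
    and J_open: "\<And>\<mu>. \<mu> \<in> {1..n} \<Longrightarrow> open (J \<mu>)"
    and X_smooth: "\<And>\<mu>. \<mu> \<in> {1..n} \<Longrightarrow> smooth_fun_on (J \<mu>) (X \<mu>)"
    and c_nz: "\<epsilon> = 1 \<Longrightarrow> c \<noteq> 0"
begin

definition N :: "nat set" where "N = {1-\<epsilon>..n}"

lemma N_cases: "N = (if \<epsilon> = 0 then {1..n} else insert 0 {1..n})"
  using \<epsilon> by (auto simp: N_def)

lemma finite_N [simp]: "finite N" by (simp add: N_def)
lemma K_N: "\<mu> \<in> {1..n} \<Longrightarrow> \<mu> \<in> N" by (auto simp: N_def intro: le_trans[OF diff_le_self])
lemma N_zero: "0 \<in> N \<longleftrightarrow> \<epsilon> = 1" using \<epsilon> by (auto simp: N_def)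
lemma N_K: "A \<in> N \<Longrightarrow> A \<noteq> 0 \<Longrightarrow> A \<in> {1..n}" by (auto simp: N_def)
lemma card_N: "card N = n + \<epsilon>" using n \<epsilon> by (auto simp: N_def)

definition x :: "(coord \<Rightarrow> real) \<Rightarrow> nat \<Rightarrow> real" where
  "x q A = (if A = 0 then 0 else q (XC A))"

abbreviation u :: "(coord \<Rightarrow> real) \<Rightarrow> nat \<Rightarrow> real" where "u q \<equiv> \<lambda>A. (x q A)\<^sup>2"

definition lam :: "(coord \<Rightarrow> real) \<Rightarrow> nat \<Rightarrow> real" where
  "lam q A = (if A = 0 then c / A_sym n n q else X A (q (XC A)) / U_fun n A q)"

definition wcoef :: "(coord \<Rightarrow> real) \<Rightarrow> nat \<Rightarrow> nat \<Rightarrow> real" where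
  "wcoef q A k = esym (u q) (N - {A}) k"

definition w :: "(coord \<Rightarrow> real) \<Rightarrow> nat \<Rightarrow> coord \<Rightarrow> real" where
  "w q A a = (\<Sum>k<n+\<epsilon>. wcoef q A k * dpsi k a)"

definition v :: "(coord \<Rightarrow> real) \<Rightarrow> nat \<Rightarrow> coord \<Rightarrow> real" where
  "v q A a = (\<Sum>k<n+\<epsilon>. lagrange (u q) N A k * dpsi k a)"

definition dom :: "(coord \<Rightarrow> real) set" where
  "dom = {q. (\<forall>\<mu>\<in>{1..n}. q (XC \<mu>) \<in> J \<mu> \<and> X \<mu> (q (XC \<mu>)) \<noteq> 0) \<and>
     (\<forall>a\<in>N. \<forall>b\<in>N. a \<noteq> b \<longrightarrow> u q a \<noteq> u q b)}"

lemma dom_distinct: "q \<in> dom \<Longrightarrow> a \<in> N \<Longrightarrow> b \<in> N \<Longrightarrow> a \<noteq> b \<Longrightarrow> u q a \<noteq> u q b"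
  by (auto simp: dom_def)

lemma U_fun_eq: "\<mu> \<in> {1..n} \<Longrightarrow> U_fun n \<mu> q = (\<Prod>\<nu>\<in>{1..n}-{\<mu>}. u q \<nu> - u q \<mu>)"
  unfolding U_fun_def by (intro prod.cong) (auto simp: x_def)

lemma U_fun_nz: "q \<in> dom \<Longrightarrow> \<mu> \<in> {1..n} \<Longrightarrow> U_fun n \<mu> q \<noteq> 0"
  using dom_distinct K_N by (auto simp: U_fun_eq)

lemma A_sym_eq: "A_sym n k q = esym (u q) {1..n} k"
  unfolding A_sym_def esym_def by (intro sum.cong prod.cong refl) (auto simp: x_def)

lemma A_sym_top: "A_sym n n q = (\<Prod>\<nu>\<in>{1..n}. u q \<nu>)"
  using esym_card[of "{1..n}" "u q"] by (simp add: A_sym_eq)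

lemma A_sym_nz: "q \<in> dom \<Longrightarrow> \<epsilon> = 1 \<Longrightarrow> A_sym n n q \<noteq> 0"
  using dom_distinct[of q 0] K_N N_zero by (force simp: A_sym_top x_def)

lemma lam_nz: "q \<in> dom \<Longrightarrow> A \<in> N \<Longrightarrow> lam q A \<noteq> 0"
proof (cases "A = 0")
  case True
  assume "q \<in> dom" "A \<in> N"
  then have "A_sym n n q \<noteq> 0" "c \<noteq> 0" using True N_zero A_sym_nz c_nz by auto
  then show ?thesis using True by (simp add: lam_def)
next
  case False
  assume *: "q \<in> dom" "A \<in> N"
  then have "A \<in> {1..n}" using False N_K by blast
  then have "U_fun n A q \<noteq> 0" "X A (q (XC A)) \<noteq> 0" using * U_fun_nz by (auto simp: dom_def)
  then show ?thesis using False by (simp add: lam_def)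
qed

lemma x_partial: "\<mu> \<in> {1..n} \<Longrightarrow> has_partial (\<lambda>r. x r A) (if A = \<mu> then 1 else 0) (XC \<mu>) q"
  by (cases "A = 0") (auto simp: x_def has_partial_const intro!: has_partial_eq[OF has_partial_XC])

lemma u_partial: "\<mu> \<in> {1..n} \<Longrightarrow> has_partial (\<lambda>r. u r A) (if A = \<mu> then 2 * x q \<mu> else 0) (XC \<mu>) q"
  by (rule has_partial_eq[OF has_partial_power2[OF x_partial]]) auto

lemma X_deriv:
  assumes "q \<in> dom" "\<mu> \<in> {1..n}"
  shows "(X \<mu> has_real_derivative deriv (X \<mu>) (q (XC \<mu>))) (at (q (XC \<mu>)))"
    and "(deriv (X \<mu>) has_real_derivative deriv (deriv (X \<mu>)) (q (XC \<mu>))) (at (q (XC \<mu>)))"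
proof -
  have J: "q (XC \<mu>) \<in> J \<mu>" using assms by (auto simp: dom_def)
  have "(deriv ^^ 0) (X \<mu>) field_differentiable at (q (XC \<mu>))"
    "(deriv ^^ Suc 0) (X \<mu>) field_differentiable at (q (XC \<mu>))"
    using X_smooth[OF assms(2)] J unfolding smooth_fun_on_def by blast+
  then show "(X \<mu> has_real_derivative deriv (X \<mu>) (q (XC \<mu>))) (at (q (XC \<mu>)))"
    "(deriv (X \<mu>) has_real_derivative deriv (deriv (X \<mu>)) (q (XC \<mu>))) (at (q (XC \<mu>)))"
    by (simp_all add: DERIV_deriv_iff_field_differentiable)
qed

lemma X_partial:
  assumes "q \<in> dom" "\<mu> \<in> {1..n}"
  shows "has_partial (\<lambda>r. X \<mu> (r (XC \<mu>))) (deriv (X \<mu>) (q (XC \<mu>))) (XC \<mu>) q"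
    and "has_partial (\<lambda>r. deriv (X \<mu>) (r (XC \<mu>))) (deriv (deriv (X \<mu>)) (q (XC \<mu>))) (XC \<mu>) q"
  using X_deriv[OF assms] by (simp_all add: has_partial_def)

lemma X_partial_other:
  "\<nu> \<noteq> \<mu> \<Longrightarrow> has_partial (\<lambda>r. X \<mu> (r (XC \<mu>))) 0 (XC \<nu>) q"
  "\<nu> \<noteq> \<mu> \<Longrightarrow> has_partial (\<lambda>r. deriv (X \<mu>) (r (XC \<mu>))) 0 (XC \<nu>) q"
  by (simp_all add: has_partial_def)

lemma u_partial_any: "\<exists>D. has_partial (\<lambda>r. u r A) D a q"
proof (cases "A = 0")
  case True
  then show ?thesis using has_partial_const[of 0 a q] by (auto simp: x_def)
next
  case False
  then have "(\<lambda>r. u r A) = (\<lambda>r. (r (XC A))\<^sup>2)" by (simp add: x_def)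
  then show ?thesis using has_partial_power2[OF has_partial_XC[of "XC A" a q]] by auto
qed

lemma dom_open: "line_open dom"
  unfolding line_open_def
proof (intro ballI allI)
  fix q and a :: coord assume q: "q \<in> dom"
  have 1: "\<forall>\<^sub>F t in nhds (q a). (q(a := t)) (XC \<mu>) \<in> J \<mu> \<and> X \<mu> ((q(a := t)) (XC \<mu>)) \<noteq> 0"
    if m: "\<mu> \<in> {1..n}" for \<mu>
  proof (cases "a = XC \<mu>")
    case True
    have "q (XC \<mu>) \<in> J \<mu>" "X \<mu> (q (XC \<mu>)) \<noteq> 0" using q m by (auto simp: dom_def)
    then have "\<forall>\<^sub>F t in nhds (q (XC \<mu>)). t \<in> J \<mu>"
      by (intro eventually_nhds_in_open[OF J_open[OF m]])
    moreover have "\<forall>\<^sub>F t in nhds (q (XC \<mu>)). X \<mu> ((q(XC \<mu> := t)) (XC \<mu>)) \<noteq> 0"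
      by (rule has_partial_line_nonzero[OF X_partial(1)[OF q m]]) fact
    ultimately show ?thesis unfolding True by eventually_elim simp
  next
    case False
    then have "(q(a := t)) (XC \<mu>) = q (XC \<mu>)" for t by simp
    moreover have "q (XC \<mu>) \<in> J \<mu>" "X \<mu> (q (XC \<mu>)) \<noteq> 0" using q m by (auto simp: dom_def)
    ultimately show ?thesis by (simp only: not_False_eq_True simp_thms eventually_True)
  qed
  have 2: "\<forall>\<^sub>F t in nhds (q a). b \<noteq> b' \<longrightarrow> u (q(a := t)) b \<noteq> u (q(a := t)) b'"
    if "b \<in> N" "b' \<in> N" for b b'
  proof (cases "b = b'")
    case False
    from u_partial_any[of b a q] obtain D where D: "has_partial (\<lambda>r. u r b) D a q" ..
    from u_partial_any[of b' a q] obtain D' where D': "has_partial (\<lambda>r. u r b') D' a q" ..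
    have nz: "u q b - u q b' \<noteq> 0" using dom_distinct[OF q that False] by simp
    have "\<forall>\<^sub>F t in nhds (q a). u (q(a := t)) b - u (q(a := t)) b' \<noteq> 0"
      by (rule has_partial_line_nonzero[where f = "\<lambda>r. u r b - u r b'", OF has_partial_diff[OF D D'] nz])
    then show ?thesis by (rule eventually_mono) (metis right_minus_eq)
  qed simp
  have "\<forall>\<^sub>F t in nhds (q a). \<forall>\<mu>\<in>{1..n}. (q(a := t)) (XC \<mu>) \<in> J \<mu> \<and> X \<mu> ((q(a := t)) (XC \<mu>)) \<noteq> 0"
    by (rule eventually_ball_finite[OF finite_atLeastAtMost ballI[OF 1]])
  moreover have "\<forall>\<^sub>F t in nhds (q a). \<forall>b\<in>N. \<forall>b'\<in>N. b \<noteq> b' \<longrightarrow> u (q(a := t)) b \<noteq> u (q(a := t)) b'"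
    by (rule eventually_ball_finite[OF finite_N ballI[OF eventually_ball_finite[OF finite_N ballI[OF 2]]]])
  ultimately show "\<forall>\<^sub>F t in nhds (q a). q(a := t) \<in> dom"
    unfolding dom_def mem_Collect_eq by (rule eventually_conj)
qed

lemma U_partial:
  assumes q: "q \<in> dom" and m: "\<mu> \<in> {1..n}" "\<nu> \<in> {1..n}"
  shows "has_partial (U_fun n \<mu>) (U_fun n \<mu> q *
     (if \<nu> = \<mu> then (\<Sum>\<rho>\<in>{1..n}-{\<mu>}. kp (x q) \<mu> \<rho>) else kp (x q) \<nu> \<mu>)) (XC \<nu>) q"
proof -
  let ?K = "{1..n}-{\<mu>}"
  have nz: "u q \<rho> - u q \<mu> \<noteq> 0" if "\<rho> \<in> ?K" for \<rho>
    using dom_distinct[OF q, of \<rho> \<mu>] that K_N m by auto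
  have "has_partial (\<lambda>r. \<Prod>\<rho>\<in>?K. u r \<rho> - u r \<mu>) ((\<Prod>\<rho>\<in>?K. u q \<rho> - u q \<mu>) *
      (\<Sum>\<rho>\<in>?K. ((if \<rho> = \<nu> then 2 * x q \<nu> else 0) - (if \<mu> = \<nu> then 2 * x q \<nu> else 0)) / (u q \<rho> - u q \<mu>))) (XC \<nu>) q"
    by (intro has_partial_prod has_partial_diff u_partial m nz) auto
  moreover have "(\<Sum>\<rho>\<in>?K. ((if \<rho> = \<nu> then 2 * x q \<nu> else 0) - (if \<mu> = \<nu> then 2 * x q \<nu> else 0)) / (u q \<rho> - u q \<mu>))
     = (if \<nu> = \<mu> then (\<Sum>\<rho>\<in>?K. kp (x q) \<mu> \<rho>) else kp (x q) \<nu> \<mu>)"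
  proof (cases "\<nu> = \<mu>")
    case True
    have "(0 - 2 * x q \<mu>) / (u q \<rho> - u q \<mu>) = kp (x q) \<mu> \<rho>" for \<rho>
      unfolding kp_def by (metis minus_diff_eq minus_divide_divide diff_0)
    then show ?thesis using True by (auto intro!: sum.cong)
  next
    case False
    have "(\<Sum>\<rho>\<in>?K. ((if \<rho> = \<nu> then 2 * x q \<nu> else 0) - (if \<mu> = \<nu> then 2 * x q \<nu> else 0)) / (u q \<rho> - u q \<mu>))
      = (\<Sum>\<rho>\<in>?K. if \<rho> = \<nu> then kp (x q) \<nu> \<mu> else 0)"
      by (intro sum.cong) (use False in \<open>auto simp: kp_def\<close>)
    then show ?thesis using False m by simp
  qed
  ultimately show ?thesis
    unfolding U_fun_eq[OF m(1), symmetric] by simp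
qed

text \<open>
  The logarithmic derivative of \<open>1 / U\<^sub>\<mu>\<close> along \<open>x\<^sub>\<mu>\<close> is \<open>- \<Sum>\<^sub>\<rho> \<kappa>\<^sub>\<mu>\<^sub>\<rho>\<close>. The value 0 for the label 0 reflects that
  there is no direction \<open>x\<^sub>0\<close>. The second derivative \<open>l2\<close> may stay implicit, as it enters the curvature only through \<open>\<partial>\<^sub>\<mu>\<^sup>2 M\<close>.
\<close>

definition l1 :: "(coord \<Rightarrow> real) \<Rightarrow> nat \<Rightarrow> real" where
  "l1 q \<mu> = (if \<mu> = 0 then 0 else
     deriv (X \<mu>) (q (XC \<mu>)) / U_fun n \<mu> q - lam q \<mu> * (\<Sum>\<rho>\<in>{1..n}-{\<mu>}. kp (x q) \<mu> \<rho>))"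

definition l2 :: "(coord \<Rightarrow> real) \<Rightarrow> nat \<Rightarrow> real" where
  "l2 q \<mu> = partial (XC \<mu>) (\<lambda>r. l1 r \<mu>) q"

lemma kerr_point: "q \<in> dom \<Longrightarrow> kerr_point N (x q) (lam q)"
  by unfold_locales (auto simp: lam_nz dest: dom_distinct)

abbreviation L1 where "L1 q \<equiv> kerr_point.L1 (x q) (lam q) (l1 q)"
abbreviation L2 where "L2 q \<equiv> kerr_point.L2 (x q) (lam q) (l1 q) (l2 q)"
abbreviation \<kappa> where "\<kappa> q \<equiv> kp (x q)"
abbreviation \<delta> where "\<delta> q \<equiv> dl (x q)"

lemmas L1_def = kerr_point.L1_def[OF kerr_point]
lemmas L2_def = kerr_point.L2_def[OF kerr_point]

lemma lam_partial:
  assumes q: "q \<in> dom" and m: "A \<in> N" "\<mu> \<in> {1..n}"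
  shows "has_partial (\<lambda>r. lam r A) (L1 q \<mu> A) (XC \<mu>) q"
proof (cases "A = 0")
  case True
  then have \<epsilon>1: "\<epsilon> = 1" using m N_zero by auto
  have nz: "u q \<nu> \<noteq> 0" if "\<nu> \<in> {1..n}" for \<nu>
    using A_sym_nz[OF q \<epsilon>1] that unfolding A_sym_top by auto
  have "has_partial (\<lambda>r. \<Prod>\<nu>\<in>{1..n}. u r \<nu>) ((\<Prod>\<nu>\<in>{1..n}. u q \<nu>) *
     (\<Sum>\<nu>\<in>{1..n}. (if \<nu> = \<mu> then 2 * x q \<mu> else 0) / u q \<nu>)) (XC \<mu>) q"
    by (intro has_partial_prod u_partial m nz) auto
  moreover have "(\<Sum>\<nu>\<in>{1..n}. (if \<nu> = \<mu> then 2 * x q \<mu> else 0) / u q \<nu>) =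
      (\<Sum>\<nu>\<in>{1..n}. if \<nu> = \<mu> then \<kappa> q \<mu> 0 else 0)"
    by (intro sum.cong refl) (auto simp: kp_def x_def)
  ultimately have "has_partial (A_sym n n) (A_sym n n q * \<kappa> q \<mu> 0) (XC \<mu>) q"
    using m by (simp add: A_sym_top[abs_def])
  from has_partial_cmult[OF has_partial_inverse[OF this A_sym_nz[OF q \<epsilon>1]], of c]
  show ?thesis using True m A_sym_nz[OF q \<epsilon>1]
    by (simp add: lam_def L1_def[OF q] field_simps)
next
  case False
  then have A: "A \<in> {1..n}" using m N_K by auto
  note U = U_partial[OF q A m(2)] and nz = U_fun_nz[OF q A]
  show ?thesis
  proof (cases "\<mu> = A")
    case True
    have "has_partial (\<lambda>r. X A (r (XC A)) / U_fun n A r) (L1 q \<mu> A) (XC A) q"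
      by (rule has_partial_eq[OF has_partial_divide[OF X_partial(1)[OF q A] U[unfolded True] nz]])
        (use nz False True in \<open>simp add: lam_def L1_def[OF q] l1_def field_simps\<close>)
    then show ?thesis using False True by (simp add: lam_def)
  next
    case F: False
    have "has_partial (\<lambda>r. X A (r (XC A)) / U_fun n A r) (L1 q \<mu> A) (XC \<mu>) q"
      by (rule has_partial_eq[OF has_partial_divide[OF X_partial_other(1)[OF F] U nz]])
        (use nz False F in \<open>simp add: lam_def L1_def[OF q] field_simps\<close>)
    then show ?thesis using False by (simp add: lam_def)
  qed
qed

text \<open>
  The derivative of \<open>\<kappa>\<^sub>a\<^sub>b\<close> along \<open>x\<^sub>\<mu>\<close>, again expressed by \<open>\<kappa>\<close> and \<open>\<delta>\<close>.
\<close>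

definition dkappa :: "(coord \<Rightarrow> real) \<Rightarrow> nat \<Rightarrow> nat \<Rightarrow> nat \<Rightarrow> real" where
  "dkappa q \<mu> a b = (if a = b then 0 else if a = \<mu> then \<delta> q \<mu> b - \<kappa> q \<mu> b * \<kappa> q \<mu> b
     else if b = \<mu> then - \<kappa> q a \<mu> * \<kappa> q \<mu> a else 0)"

lemma kappa_partial:
  assumes q: "q \<in> dom" and m: "a \<in> N" "b \<in> N" "\<mu> \<in> {1..n}"
  shows "has_partial (\<lambda>r. \<kappa> r a b) (dkappa q \<mu> a b) (XC \<mu>) q"
proof (cases "a = b")
  case True then show ?thesis by (simp add: dkappa_def has_partial_const)
next
  case False
  have nz: "u q a - u q b \<noteq> 0" using dom_distinct[OF q m(1,2) False] by simp
  define d where "d = u q a - u q b"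
  have kab: "\<kappa> q a b = 2 * x q a / d" "\<delta> q a b = 2 / d" by (simp_all add: kp_def dl_def d_def)
  have "u q b - u q a = - d" by (simp add: d_def)
  then have kba: "\<kappa> q b a = - (2 * x q b) / d" by (simp add: kp_def)
  have "has_partial (\<lambda>r. \<kappa> r a b) (((2 * (if a = \<mu> then 1 else 0)) * (u q a - u q b) - (2 * x q a) *
     ((if a = \<mu> then 2 * x q \<mu> else 0) - (if b = \<mu> then 2 * x q \<mu> else 0))) / ((u q a - u q b) * (u q a - u q b))) (XC \<mu>) q"
    unfolding kp_def
    by (intro has_partial_divide has_partial_cmult has_partial_diff x_partial u_partial m nz)
  then have "has_partial (\<lambda>r. \<kappa> r a b) (((2 * (if a = \<mu> then 1 else 0)) * d - (2 * x q a) *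
     ((if a = \<mu> then 2 * x q \<mu> else 0) - (if b = \<mu> then 2 * x q \<mu> else 0))) / (d * d)) (XC \<mu>) q"
    (is ?hp) unfolding d_def .
  have "d \<noteq> 0" using nz by (simp add: d_def)
  consider "a = \<mu>" "b \<noteq> \<mu>" | "a \<noteq> \<mu>" "b = \<mu>" | "a \<noteq> \<mu>" "b \<noteq> \<mu>" using False by blast
  then have "((2 * (if a = \<mu> then 1 else 0)) * d - (2 * x q a) *
     ((if a = \<mu> then 2 * x q \<mu> else 0) - (if b = \<mu> then 2 * x q \<mu> else 0))) / (d * d) = dkappa q \<mu> a b"
  proof cases
    case 1
    then show ?thesis using \<open>d \<noteq> 0\<close> by (simp add: dkappa_def kab[unfolded 1(1)] field_simps)
  next
    case 2
    then show ?thesis using \<open>d \<noteq> 0\<close>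
      by (simp add: dkappa_def kab[unfolded 2(2)] kba[unfolded 2(2)] field_simps)
  qed (simp add: dkappa_def)
  with \<open>?hp\<close> show ?thesis by (rule has_partial_eq)
qed

lemma l1_partial:
  assumes q: "q \<in> dom" and m: "\<mu> \<in> {1..n}" "\<nu> \<in> {1..n}"
  shows "has_partial (\<lambda>r. l1 r \<mu>) (L2 q \<nu> \<mu> \<mu>) (XC \<nu>) q"
proof -
  have l1: "l1 r \<mu> = deriv (X \<mu>) (r (XC \<mu>)) / U_fun n \<mu> r - lam r \<mu> * (\<Sum>\<rho>\<in>{1..n}-{\<mu>}. \<kappa> r \<mu> \<rho>)" for r
    using m by (simp add: l1_def)
  have K: "\<mu> \<in> N" "\<nu> \<in> N" using m K_N by auto
  note nz = U_fun_nz[OF q m(1)]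
  show ?thesis
  proof (cases "\<nu> = \<mu>")
    case True
    have "\<exists>D. has_partial (\<lambda>r. l1 r \<mu>) D (XC \<mu>) q"
      unfolding l1
      by (rule exI, rule has_partial_diff[OF has_partial_divide[OF X_partial(2)[OF q m(1)] U_partial[OF q m(1,1)] nz]
           has_partial_mult[OF lam_partial[OF q K(1) m(1)] has_partial_sum[OF kappa_partial[OF q K(1) _ m(1)]]]])
        (auto intro: K_N)
    then have "has_partial (\<lambda>r. l1 r \<mu>) (l2 q \<mu>) (XC \<mu>) q"
      using has_partial_imp_partial unfolding l2_def by fastforce
    then show ?thesis using True by (simp add: L2_def[OF q])
  next
    case False
    have s: "(\<Sum>\<rho>\<in>{1..n}-{\<mu>}. dkappa q \<nu> \<mu> \<rho>) = - \<kappa> q \<mu> \<nu> * \<kappa> q \<nu> \<mu>"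
    proof -
      have "(\<Sum>\<rho>\<in>{1..n}-{\<mu>}. dkappa q \<nu> \<mu> \<rho>) = (\<Sum>\<rho>\<in>{1..n}-{\<mu>}. if \<nu> = \<rho> then - \<kappa> q \<mu> \<nu> * \<kappa> q \<nu> \<mu> else 0)"
        by (intro sum.cong refl) (use False in \<open>auto simp: dkappa_def\<close>)
      then show ?thesis using False m by simp
    qed
    have "has_partial (\<lambda>r. l1 r \<mu>) ((0 * U_fun n \<mu> q - deriv (X \<mu>) (q (XC \<mu>)) *
        (U_fun n \<mu> q * (if \<nu> = \<mu> then (\<Sum>\<rho>\<in>{1..n}-{\<mu>}. \<kappa> q \<mu> \<rho>) else \<kappa> q \<nu> \<mu>))) / (U_fun n \<mu> q * U_fun n \<mu> q)
       - (L1 q \<nu> \<mu> * (\<Sum>\<rho>\<in>{1..n}-{\<mu>}. \<kappa> q \<mu> \<rho>) + (\<Sum>\<rho>\<in>{1..n}-{\<mu>}. dkappa q \<nu> \<mu> \<rho>) * lam q \<mu>)) (XC \<nu>) q"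
      unfolding l1
      by (intro has_partial_diff has_partial_divide has_partial_mult has_partial_sum X_partial_other(2)[OF False]
          U_partial lam_partial kappa_partial q m nz K) (auto intro: K_N)
    then show ?thesis
      unfolding s
      by (rule has_partial_eq) (use nz False in \<open>auto simp: L1_def[OF q] L2_def[OF q] l1 divide_simps algebra_simps\<close>)
  qed
qed

lemma L1_partial:
  assumes q: "q \<in> dom" and m: "\<mu> \<in> {1..n}" "\<nu> \<in> {1..n}" "C \<in> N"
  shows "has_partial (\<lambda>r. L1 r \<nu> C) (L2 q \<mu> \<nu> C) (XC \<mu>) q"
proof -
  have K: "\<mu> \<in> N" "\<nu> \<in> N" using m K_N by auto
  have "has_partial (\<lambda>r. if \<nu> = C then l1 r C else - \<kappa> r \<nu> C * lam r C) (L2 q \<mu> \<nu> C) (XC \<mu>) q"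
  proof (cases "\<nu> = C")
    case True
    then show ?thesis using l1_partial[OF q m(2,1)] by simp
  next
    case False
    have "has_partial (\<lambda>r. - \<kappa> r \<nu> C * lam r C)
       (- dkappa q \<mu> \<nu> C * lam q C + L1 q \<mu> C * - \<kappa> q \<nu> C) (XC \<mu>) q"
      by (intro has_partial_mult has_partial_minus kappa_partial lam_partial q m K)
    moreover have "- dkappa q \<mu> \<nu> C * lam q C + L1 q \<mu> C * - \<kappa> q \<nu> C = L2 q \<mu> \<nu> C"
      using False by (cases "\<mu> = \<nu>"; cases "\<mu> = C")
        (simp_all add: dkappa_def L1_def[OF q] L2_def[OF q] algebra_simps)
    ultimately show ?thesis using False by simp
  qed
  then show ?thesis
    by (rule has_partial_cong_on[OF dom_open q, rotated]) (simp add: L1_def)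
qed

text \<open>
  Let \<open>e\<close> be the elementary symmetric functions of the \<open>x\<^sub>\<rho>\<^sup>2\<close> with \<open>\<rho> \<noteq> C, \<mu>\<close>. The coefficients of
  \<open>w\<^sub>C\<close> are \<open>e\<^sub>k + x\<^sub>\<mu>\<^sup>2 e\<^sub>k\<^sub>-\<^sub>1\<close>, those of \<open>w\<^sub>\<mu>\<close> are \<open>e\<^sub>k + x\<^sub>C\<^sup>2 e\<^sub>k\<^sub>-\<^sub>1\<close>. So both the derivative
  \<open>2 x\<^sub>\<mu> e\<^sub>k\<^sub>-\<^sub>1\<close> and the difference of the covectors are multiples of \<open>e\<^sub>k\<^sub>-\<^sub>1\<close>.
\<close>

lemma w_partial:
  assumes q: "q \<in> dom" and m: "\<mu> \<in> {1..n}" "C \<in> N"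
  shows "has_partial (\<lambda>r. w r C i) (\<kappa> q \<mu> C * (w q C i - w q \<mu> i)) (XC \<mu>) q"
proof -
  have K: "\<mu> \<in> N" using m K_N by auto
  have wc: "has_partial (\<lambda>r. wcoef r C k) (\<kappa> q \<mu> C * (wcoef q C k - wcoef q \<mu> k)) (XC \<mu>) q" for k
  proof (cases "\<mu> = C")
    case True
    have "has_partial (\<lambda>r. wcoef r C k) 0 (XC \<mu>) q"
    proof -
      have "wcoef (q(XC \<mu> := t)) C k = wcoef q C k" for t
        unfolding wcoef_def by (rule esym_cong) (auto simp: x_def True)
      then show ?thesis by (simp add: has_partial_def)
    qed
    then show ?thesis using True by simp
  next
    case False
    define S where "S = N - {C} - {\<mu>}"
    have S: "finite S" "\<mu> \<notin> S" "C \<notin> S" "N - {C} = insert \<mu> S" "N - {\<mu>} = insert C S"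
      using False K m by (auto simp: S_def)
    have split: "wcoef r C k = esym (u r) S k + u r \<mu> * esym_prev (u r) S k"
      "wcoef r \<mu> k = esym (u r) S k + u r C * esym_prev (u r) S k" for r
      unfolding wcoef_def S(4,5) using S by (simp_all add: esym_insert_eq)
    have const: "esym (u (q(XC \<mu> := t))) S j = esym (u q) S j" for t j
      by (rule esym_cong) (use S(2) in \<open>auto simp: x_def\<close>)
    have const': "esym_prev (u (q(XC \<mu> := t))) S k = esym_prev (u q) S k" for t
      by (cases k) (simp_all add: esym_prev_def const)
    have "has_partial (\<lambda>r. esym (u r) S k) 0 (XC \<mu>) q" "has_partial (\<lambda>r. esym_prev (u r) S k) 0 (XC \<mu>) q"
      unfolding has_partial_def const const' by simp_all
    from has_partial_add[OF this(1) has_partial_mult[OF u_partial[OF m(1), of \<mu>] this(2)]]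
    have "has_partial (\<lambda>r. wcoef r C k) (2 * x q \<mu> * esym_prev (u q) S k) (XC \<mu>) q"
      unfolding split by simp
    moreover have "u q \<mu> - u q C \<noteq> 0" using dom_distinct[OF q K m(2) False] by simp
    then have "\<kappa> q \<mu> C * (wcoef q C k - wcoef q \<mu> k) = 2 * x q \<mu> * esym_prev (u q) S k"
      unfolding split kp_def by (simp add: field_simps)
    ultimately show ?thesis by simp
  qed
  have "has_partial (\<lambda>r. \<Sum>k<n+\<epsilon>. dpsi k i * wcoef r C k)
     (\<Sum>k<n+\<epsilon>. dpsi k i * (\<kappa> q \<mu> C * (wcoef q C k - wcoef q \<mu> k))) (XC \<mu>) q"
    by (intro has_partial_sum has_partial_cmult wc)
  moreover have "(\<Sum>k<n+\<epsilon>. dpsi k i * (\<kappa> q \<mu> C * (wcoef q C k - wcoef q \<mu> k)))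
     = \<kappa> q \<mu> C * (w q C i - w q \<mu> i)"
    unfolding w_def sum_subtractf[symmetric] sum_distrib_left
    by (intro sum.cong refl) (simp add: algebra_simps)
  ultimately show ?thesis unfolding w_def by (simp add: mult.commute)
qed

definition w2 :: "(coord \<Rightarrow> real) \<Rightarrow> nat \<Rightarrow> nat \<Rightarrow> nat \<Rightarrow> coord \<Rightarrow> real" where
  "w2 q \<mu> \<nu> C i = (if \<mu> = \<nu> then \<delta> q \<mu> C * (w q C i - w q \<mu> i)
     else if C = \<mu> \<or> C = \<nu> then 0
     else \<kappa> q \<mu> C * \<kappa> q \<nu> C * w q C i - \<kappa> q \<nu> C * \<kappa> q \<mu> \<nu> * w q \<nu> i - \<kappa> q \<mu> C * \<kappa> q \<nu> \<mu> * w q \<mu> i)"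

definition w1 :: "(coord \<Rightarrow> real) \<Rightarrow> nat \<Rightarrow> nat \<Rightarrow> coord \<Rightarrow> real" where
  "w1 q \<mu> C i = \<kappa> q \<mu> C * (w q C i - w q \<mu> i)"

text \<open>
  Differentiating \<open>\<kappa>\<^sub>\<nu>\<^sub>C (w\<^sub>C - w\<^sub>\<nu>)\<close> once more; \<open>kappa_transfer\<close> brings the coefficient of \<open>w\<^sub>\<mu>\<close> into a
  form that is symmetric in \<open>\<mu>\<close> and \<open>\<nu>\<close>.
\<close>

lemma w1_partial:
  assumes q: "q \<in> dom" and m: "\<mu> \<in> {1..n}" "\<nu> \<in> {1..n}" "C \<in> N"
  shows "has_partial (\<lambda>r. w1 r \<nu> C i) (w2 q \<mu> \<nu> C i) (XC \<mu>) q"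
proof -
  have K: "\<mu> \<in> N" "\<nu> \<in> N" using m K_N by auto
  have "has_partial (\<lambda>r. w1 r \<nu> C i) (dkappa q \<mu> \<nu> C * (w q C i - w q \<nu> i) +
       (\<kappa> q \<mu> C * (w q C i - w q \<mu> i) - \<kappa> q \<mu> \<nu> * (w q \<nu> i - w q \<mu> i)) * \<kappa> q \<nu> C) (XC \<mu>) q"
    unfolding w1_def
    by (intro has_partial_mult has_partial_diff kappa_partial w_partial q m K)
  moreover have "dkappa q \<mu> \<nu> C * (w q C i - w q \<nu> i) +
       (\<kappa> q \<mu> C * (w q C i - w q \<mu> i) - \<kappa> q \<mu> \<nu> * (w q \<nu> i - w q \<mu> i)) * \<kappa> q \<nu> C = w2 q \<mu> \<nu> C i"
  proof (cases "\<mu> = \<nu> \<or> C = \<mu> \<or> C = \<nu>")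
    case True
    then show ?thesis by (cases "\<mu> = \<nu>"; cases "C = \<mu>"; cases "C = \<nu>")
      (simp_all add: dkappa_def w2_def algebra_simps)
  next
    case False
    then have "\<kappa> q \<mu> C * \<kappa> q \<nu> C = \<kappa> q \<nu> \<mu> * \<kappa> q \<mu> C + \<kappa> q \<mu> \<nu> * \<kappa> q \<nu> C"
      using kerr_point.kappa_transfer[OF kerr_point[OF q] K m(3)] by auto
    then have "\<kappa> q \<mu> C * \<kappa> q \<nu> C * w q \<mu> i
       = \<kappa> q \<nu> \<mu> * \<kappa> q \<mu> C * w q \<mu> i + \<kappa> q \<mu> \<nu> * \<kappa> q \<nu> C * w q \<mu> i"
      by (simp add: distrib_right)
    then show ?thesis using False by (simp add: dkappa_def w2_def algebra_simps)
  qed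
  ultimately show ?thesis by simp
qed

end


section \<open>The metric and its inverse in the coframe\<close>

context kerr_chart
begin

abbreviation K :: "nat set" where "K \<equiv> {1..n}"
abbreviation I :: "coord set" where "I \<equiv> coords n \<epsilon>"

lemma finite_I [simp]: "finite I"
  by (simp add: coords_def)

lemma w_at_XC [simp]: "w q A (XC \<mu>) = 0" and v_at_XC [simp]: "v q A (XC \<mu>) = 0"
  by (simp_all add: w_def v_def dpsi_def)

lemma dx_at [simp]: "dx \<mu> (PsiC k) = 0" "dx \<mu> (XC \<nu>) = (if \<nu> = \<mu> then 1 else 0)"
  by (auto simp: dx_def)

lemma dpsi_expand: "(\<Sum>j<m. f j * dpsi j (PsiC k)) = (if k < m then f k else 0)"
  by (simp add: dpsi_def if_distrib[of "\<lambda>t. _ * t"] cong: if_cong)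

lemma w_at_PsiC: "w q A (PsiC k) = (if k < n + \<epsilon> then wcoef q A k else 0)"
  unfolding w_def by (rule dpsi_expand)

lemma v_at_PsiC: "v q A (PsiC k) = (if k < n + \<epsilon> then lagrange (u q) N A k else 0)"
  unfolding v_def by (rule dpsi_expand)

text \<open>
  In odd dimension the additional point \<open>x\<^sub>0 = 0\<close> does not change elementary symmetric functions, and
  the coefficient with \<open>k = n\<close> of \<open>w\<^sub>\<mu>\<close> is zero.
\<close>

lemma w_eq_A_sub:
  assumes "\<mu> \<in> K"
  shows "(\<Sum>k<n. A_sub n k \<mu> q * dpsi k a) = w q \<mu> a"
proof -
  have A: "A_sub n k \<mu> q = esym (u q) (K-{\<mu>}) k" for k
    unfolding A_sub_def esym_def by (intro sum.cong prod.cong refl) (auto simp: x_def)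
  have wc: "wcoef q \<mu> k = A_sub n k \<mu> q" for k
  proof (cases "\<epsilon> = 0")
    case True
    have "N = K" unfolding N_cases using True by simp
    then show ?thesis unfolding wcoef_def A by simp
  next
    case False
    then have "N - {\<mu>} = insert 0 (K-{\<mu>})" unfolding N_cases using assms by auto
    then show ?thesis unfolding wcoef_def A by (simp add: esym_insert_eq x_def)
  qed
  have "w q \<mu> a = (\<Sum>k<n. wcoef q \<mu> k * dpsi k a)"
  proof (cases "\<epsilon> = 0")
    case False
    then have m: "n + \<epsilon> = Suc n" using \<epsilon> by auto
    have "wcoef q \<mu> n = 0"
      unfolding wc A using assms by (intro esym_high) auto
    then show ?thesis unfolding w_def m by simp
  next
    case True
    then have m: "n + \<epsilon> = n" by simp
    show ?thesis unfolding w_def m ..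
  qed
  then show ?thesis by (simp add: wc)
qed

lemma w_eq_A_sym:
  assumes "\<epsilon> = 1"
  shows "(\<Sum>k\<le>n. A_sym n k q * dpsi k a) = w q 0 a"
proof -
  have "N - {0} = K" unfolding N_cases using assms by auto
  then show ?thesis
    unfolding w_def wcoef_def A_sym_eq using assms by (simp add: lessThan_Suc_atMost)
qed

lemma metric_eq:
  "kerr_metric n \<epsilon> c X q a b = (\<Sum>\<mu>\<in>K. 1 / lam q \<mu> * (dx \<mu> a * dx \<mu> b))
     + (\<Sum>A\<in>N. lam q A * (w q A a * w q A b))"
proof -
  have eps: "real \<epsilon> * (c / A_sym n n q) *
          ((\<Sum>k\<le>n. A_sym n k q * dpsi k a) * (\<Sum>k\<le>n. A_sym n k q * dpsi k b))
       = (if \<epsilon> = 0 then 0 else lam q 0 * (w q 0 a * w q 0 b))"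
    using \<epsilon> w_eq_A_sym by (auto simp: lam_def)
  have N: "(\<Sum>A\<in>N. lam q A * (w q A a * w q A b)) =
     (\<Sum>A\<in>K. lam q A * (w q A a * w q A b)) + (if \<epsilon> = 0 then 0 else lam q 0 * (w q 0 a * w q 0 b))"
    by (simp add: N_cases)
  show ?thesis
    unfolding kerr_metric_def eps N
    by (simp add: w_eq_A_sub lam_def sum.distrib[symmetric] add.assoc[symmetric])
qed

lemma x_psi [simp]: "x (q(PsiC k := t)) = x q"
  by (auto simp: x_def)
lemma U_psi [simp]: "U_fun n \<mu> (q(PsiC k := t)) = U_fun n \<mu> q"
  by (simp add: U_fun_def)
lemma A_sym_psi [simp]: "A_sym n j (q(PsiC k := t)) = A_sym n j q"
  by (simp add: A_sym_eq)
lemma lam_psi [simp]: "lam (q(PsiC k := t)) = lam q"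
  by (auto simp: lam_def)
lemma w_psi [simp]: "w (q(PsiC k := t)) = w q"
  by (intro ext) (simp add: w_def wcoef_def)
lemma v_psi [simp]: "v (q(PsiC k := t)) = v q"
  by (intro ext) (simp add: v_def)
lemma l1_psi [simp]: "l1 (q(PsiC k := t)) = l1 q"
  by (auto simp: l1_def)
lemma w1_psi [simp]: "w1 (q(PsiC k := t)) = w1 q"
  by (intro ext) (simp add: w1_def)

abbreviation gd1 where "gd1 q \<equiv> kerr_point.gd1 (x q) (lam q) (l1 q)"
abbreviation gd2 where "gd2 q \<equiv> kerr_point.gd2 (x q) (lam q) (l1 q) (l2 q)"
abbreviation hd1 where "hd1 q \<equiv> kerr_point.hd1 N (x q) (lam q) (l1 q)"
abbreviation hd2 where "hd2 q \<equiv> kerr_point.hd2 N (x q) (lam q) (l1 q) (l2 q)"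

text \<open>
  Derivatives of the metric by the product rule, with the derivatives of \<open>\<lambda>\<^sub>C\<close> and \<open>w\<^sub>C\<close> given by the
  structure equations.
\<close>

definition Dg :: "(coord \<Rightarrow> real) \<Rightarrow> nat \<Rightarrow> coord \<Rightarrow> coord \<Rightarrow> real" where
  "Dg q \<mu> i j = (\<Sum>\<nu>\<in>K. gd1 q \<mu> \<nu> * (dx \<nu> i * dx \<nu> j))
    + (\<Sum>C\<in>N. L1 q \<mu> C * (w q C i * w q C j) + lam q C * (w1 q \<mu> C i * w q C j + w q C i * w1 q \<mu> C j))"

definition D2g :: "(coord \<Rightarrow> real) \<Rightarrow> nat \<Rightarrow> nat \<Rightarrow> coord \<Rightarrow> coord \<Rightarrow> real" where
  "D2g q \<mu> \<nu> i j = (\<Sum>\<rho>\<in>K. gd2 q \<mu> \<nu> \<rho> * (dx \<rho> i * dx \<rho> j))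
    + (\<Sum>C\<in>N. L2 q \<mu> \<nu> C * (w q C i * w q C j)
        + L1 q \<nu> C * (w1 q \<mu> C i * w q C j + w q C i * w1 q \<mu> C j)
        + L1 q \<mu> C * (w1 q \<nu> C i * w q C j + w q C i * w1 q \<nu> C j)
        + lam q C * (w2 q \<mu> \<nu> C i * w q C j + w1 q \<nu> C i * w1 q \<mu> C j
             + w1 q \<mu> C i * w1 q \<nu> C j + w q C i * w2 q \<mu> \<nu> C j))"

lemma w_partial': "q \<in> dom \<Longrightarrow> \<mu> \<in> K \<Longrightarrow> C \<in> N \<Longrightarrow> has_partial (\<lambda>r. w r C i) (w1 q \<mu> C i) (XC \<mu>) q"
  unfolding w1_def by (rule w_partial)

lemma metric_partial:
  assumes q: "q \<in> dom" and \<mu>: "\<mu> \<in> K"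
  shows "has_partial (\<lambda>r. kerr_metric n \<epsilon> c X r i j) (Dg q \<mu> i j) (XC \<mu>) q"
proof -
  have 1: "has_partial (\<lambda>r. 1 / lam r \<nu> * (dx \<nu> i * dx \<nu> j)) (gd1 q \<mu> \<nu> * (dx \<nu> i * dx \<nu> j)) (XC \<mu>) q"
    if "\<nu> \<in> K" for \<nu>
  proof -
    have "has_partial (\<lambda>r. (dx \<nu> i * dx \<nu> j) * (1 / lam r \<nu>))
       ((dx \<nu> i * dx \<nu> j) * (- L1 q \<mu> \<nu> / (lam q \<nu> * lam q \<nu>))) (XC \<mu>) q"
      by (intro has_partial_cmult has_partial_inverse lam_partial q \<mu> lam_nz K_N that)
    then show ?thesis by (simp add: kerr_point.gd1_def[OF kerr_point[OF q]] mult_ac)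
  qed
  have 2: "has_partial (\<lambda>r. lam r C * (w r C i * w r C j))
     (L1 q \<mu> C * (w q C i * w q C j) + lam q C * (w1 q \<mu> C i * w q C j + w q C i * w1 q \<mu> C j)) (XC \<mu>) q"
    if "C \<in> N" for C
    by (rule has_partial_eq[OF has_partial_mult[OF lam_partial[OF q that \<mu>]
        has_partial_mult[OF w_partial'[OF q \<mu> that] w_partial'[OF q \<mu> that]]]]) (simp add: algebra_simps)
  show ?thesis unfolding metric_eq Dg_def
    by (intro has_partial_add has_partial_sum 1 2)
qed

lemma gd1_partial:
  assumes q: "q \<in> dom" and m: "\<mu> \<in> K" "\<nu> \<in> K" "\<rho> \<in> N"
  shows "has_partial (\<lambda>r. gd1 r \<nu> \<rho>) (gd2 q \<mu> \<nu> \<rho>) (XC \<mu>) q"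
proof -
  have nz: "lam q \<rho> \<noteq> 0" using lam_nz q m by blast
  have "has_partial (\<lambda>r. - L1 r \<nu> \<rho> / (lam r \<rho> * lam r \<rho>))
     ((- L2 q \<mu> \<nu> \<rho> * (lam q \<rho> * lam q \<rho>) - - L1 q \<nu> \<rho> * (L1 q \<mu> \<rho> * lam q \<rho> + L1 q \<mu> \<rho> * lam q \<rho>))
       / ((lam q \<rho> * lam q \<rho>) * (lam q \<rho> * lam q \<rho>))) (XC \<mu>) q"
    by (intro has_partial_divide has_partial_minus has_partial_mult L1_partial lam_partial q m) (use nz in simp)
  moreover have "(- L2 q \<mu> \<nu> \<rho> * (lam q \<rho> * lam q \<rho>) - - L1 q \<nu> \<rho> * (L1 q \<mu> \<rho> * lam q \<rho> + L1 q \<mu> \<rho> * lam q \<rho>))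
       / ((lam q \<rho> * lam q \<rho>) * (lam q \<rho> * lam q \<rho>)) = gd2 q \<mu> \<nu> \<rho>"
    using nz unfolding kerr_point.gd2_def[OF kerr_point[OF q]] by (simp add: field_simps)
  ultimately have "has_partial (\<lambda>r. - L1 r \<nu> \<rho> / (lam r \<rho> * lam r \<rho>)) (gd2 q \<mu> \<nu> \<rho>) (XC \<mu>) q" by simp
  then show ?thesis
    by (rule has_partial_cong_on[OF dom_open q, rotated]) (simp add: kerr_point.gd1_def[OF kerr_point])
qed

lemma Dg_partial:
  assumes q: "q \<in> dom" and m: "\<mu> \<in> K" "\<nu> \<in> K"
  shows "has_partial (\<lambda>r. Dg r \<nu> i j) (D2g q \<mu> \<nu> i j) (XC \<mu>) q"
proof -
  have 1: "has_partial (\<lambda>r. gd1 r \<nu> \<rho> * (dx \<rho> i * dx \<rho> j)) (gd2 q \<mu> \<nu> \<rho> * (dx \<rho> i * dx \<rho> j)) (XC \<mu>) q"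
    if "\<rho> \<in> K" for \<rho>
    using has_partial_cmult[OF gd1_partial[OF q m K_N[OF that]], of "dx \<rho> i * dx \<rho> j"] by (simp add: mult.commute)
  have 2: "has_partial (\<lambda>r. L1 r \<nu> C * (w r C i * w r C j) + lam r C * (w1 r \<nu> C i * w r C j + w r C i * w1 r \<nu> C j))
     (L2 q \<mu> \<nu> C * (w q C i * w q C j)
        + L1 q \<nu> C * (w1 q \<mu> C i * w q C j + w q C i * w1 q \<mu> C j)
        + L1 q \<mu> C * (w1 q \<nu> C i * w q C j + w q C i * w1 q \<nu> C j)
        + lam q C * (w2 q \<mu> \<nu> C i * w q C j + w1 q \<nu> C i * w1 q \<mu> C j
             + w1 q \<mu> C i * w1 q \<nu> C j + w q C i * w2 q \<mu> \<nu> C j)) (XC \<mu>) q"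
    if "C \<in> N" for C
  proof -
    note L = L1_partial[OF q m that] and l = lam_partial[OF q that m(1)]
      and w = w_partial'[OF q m(1) that] and w1 = w1_partial[OF q m that]
    show ?thesis
      by (rule has_partial_eq[OF has_partial_add[OF has_partial_mult[OF L has_partial_mult[OF w[of i] w[of j]]]
            has_partial_mult[OF l has_partial_add[OF has_partial_mult[OF w1[of i] w[of j]]
              has_partial_mult[OF w[of i] w1[of j]]]]]])
        (simp add: algebra_simps)
  qed
  show ?thesis unfolding D2g_def Dg_def
    by (intro has_partial_add has_partial_sum 1 2)
qed

definition ginv :: "(coord \<Rightarrow> real) \<Rightarrow> coord \<Rightarrow> coord \<Rightarrow> real" where
  "ginv q a b = (\<Sum>\<mu>\<in>K. lam q \<mu> * (dx \<mu> a * dx \<mu> b)) + (\<Sum>A\<in>N. 1 / lam q A * (v q A a * v q A b))"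

lemma ctr_dx: "\<mu> \<in> K \<Longrightarrow> ctr I (dx \<mu>) f = f (XC \<mu>)"
proof -
  assume "\<mu> \<in> K"
  then have "XC \<mu> \<in> I" by (auto simp: coords_def)
  have "ctr I (dx \<mu>) f = (\<Sum>i\<in>I. if i = XC \<mu> then f i else 0)"
    unfolding ctr_def by (intro sum.cong) (auto simp: dx_def)
  then show ?thesis using \<open>XC \<mu> \<in> I\<close> by simp
qed

lemma ctr_v: "ctr I (v q A) f = (\<Sum>k<n+\<epsilon>. lagrange (u q) N A k * f (PsiC k))"
proof -
  have "ctr I (v q A) f = (\<Sum>i\<in>XC ` K. v q A i * f i) + (\<Sum>i\<in>PsiC ` {..<n+\<epsilon>}. v q A i * f i)"
    unfolding ctr_def coords_def by (rule sum.union_disjoint) auto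
  also have "\<dots> = (\<Sum>k<n+\<epsilon>. lagrange (u q) N A k * f (PsiC k))"
    by (simp add: sum.reindex inj_on_def v_at_PsiC)
  finally show ?thesis .
qed

lemma inj_u: "q \<in> dom \<Longrightarrow> inj_on (u q) N"
  using dom_distinct by (auto simp: inj_on_def)

lemma dual_dx_dx: "\<mu> \<in> K \<Longrightarrow> ctr I (dx \<mu>) (dx \<nu>) = kron \<nu> \<mu>"
  by (simp add: ctr_dx kron_def)
lemma dual_dx_w: "\<mu> \<in> K \<Longrightarrow> ctr I (dx \<mu>) (w q C) = 0"
  by (simp add: ctr_dx)
lemma dual_v_dx: "ctr I (v q A) (dx \<nu>) = 0"
  by (simp add: ctr_v)
lemma dual_v_w:
  assumes "q \<in> dom" "A \<in> N" "C \<in> N"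
  shows "ctr I (v q A) (w q C) = kron C A"
proof -
  have "ctr I (v q A) (w q C) = (\<Sum>k<card N. esym (u q) (N-{C}) k * lagrange (u q) N A k)"
    unfolding ctr_v card_N by (intro sum.cong) (auto simp: w_at_PsiC wcoef_def)
  then show ?thesis using esym_lagrange[OF finite_N inj_u[OF assms(1)] assms(2,3)] by (simp add: kron_def)
qed

lemma complete:
  assumes q: "q \<in> dom" and m: "a \<in> I" "b \<in> I"
  shows "(\<Sum>\<mu>\<in>K. dx \<mu> a * dx \<mu> b) + (\<Sum>A\<in>N. w q A a * v q A b) = (if a = b then 1 else 0)"
proof (cases a)
  case (XC \<mu>)
  then have "(\<Sum>\<nu>\<in>K. dx \<nu> a * dx \<nu> b) = (\<Sum>\<nu>\<in>K. if \<nu> = \<mu> then dx \<nu> b else 0)"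
    by (intro sum.cong) auto
  then show ?thesis using XC m by (auto simp: coords_def dx_def)
next
  case (PsiC k)
  then have "(\<Sum>A\<in>N. w q A a * v q A b) = (if a = b then 1 else 0)"
    using lagrange_complete[OF finite_N inj_u[OF q], of k] m
    by (cases b) (auto simp: w_at_PsiC v_at_PsiC wcoef_def card_N coords_def)
  then show ?thesis using PsiC by simp
qed

lemma metric_ginv:
  assumes q: "q \<in> dom" and m: "a \<in> I" "b \<in> I"
  shows "(\<Sum>d\<in>I. kerr_metric n \<epsilon> c X q a d * ginv q d b) = (if a = b then 1 else 0)"
proof -
  have 1: "(\<Sum>d\<in>I. dx \<mu> d * ginv q d b) = lam q \<mu> * dx \<mu> b" if "\<mu> \<in> K" for \<mu>
  proof -
    have "(\<Sum>d\<in>I. dx \<mu> d * ginv q d b) = ginv q (XC \<mu>) b"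
      using ctr_dx[OF that, of "\<lambda>d. ginv q d b"] by (simp add: ctr_def)
    also have "\<dots> = (\<Sum>\<nu>\<in>K. if \<nu> = \<mu> then lam q \<mu> * dx \<mu> b else 0)"
    proof -
      have "(\<Sum>\<nu>\<in>K. lam q \<nu> * (dx \<nu> (XC \<mu>) * dx \<nu> b)) = (\<Sum>\<nu>\<in>K. if \<nu> = \<mu> then lam q \<mu> * dx \<mu> b else 0)"
        by (intro sum.cong refl) auto
      then show ?thesis unfolding ginv_def by simp
    qed
    finally show ?thesis using that by simp
  qed
  have 2: "(\<Sum>d\<in>I. w q A d * ginv q d b) = 1 / lam q A * v q A b" if A: "A \<in> N" for A
  proof -
    have "(\<Sum>d\<in>I. w q A d * ginv q d b) =
       (\<Sum>\<mu>\<in>K. lam q \<mu> * dx \<mu> b * ctr I (dx \<mu>) (w q A)) + (\<Sum>B\<in>N. 1 / lam q B * v q B b * ctr I (v q B) (w q A))"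
      unfolding ginv_def ctr_def distrib_left sum.distrib sum_distrib_left
      by (subst (1 2) sum.swap) (simp add: mult_ac)
    also have "\<dots> = (\<Sum>B\<in>N. if A = B then 1 / lam q B * v q B b else 0)"
    proof -
      have "(\<Sum>\<mu>\<in>K. lam q \<mu> * dx \<mu> b * ctr I (dx \<mu>) (w q A)) = 0"
        by (intro sum.neutral ballI) (simp add: dual_dx_w)
      moreover have "(\<Sum>B\<in>N. 1 / lam q B * v q B b * ctr I (v q B) (w q A)) =
          (\<Sum>B\<in>N. if A = B then 1 / lam q B * v q B b else 0)"
        by (intro sum.cong refl) (auto simp: dual_v_w[OF q _ A] kron_def)
      ultimately show ?thesis by simp
    qed
    finally show ?thesis using A by simp
  qed
  have "(\<Sum>d\<in>I. kerr_metric n \<epsilon> c X q a d * ginv q d b) =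
      (\<Sum>\<mu>\<in>K. 1 / lam q \<mu> * dx \<mu> a * (\<Sum>d\<in>I. dx \<mu> d * ginv q d b))
     + (\<Sum>A\<in>N. lam q A * w q A a * (\<Sum>d\<in>I. w q A d * ginv q d b))"
    unfolding metric_eq distrib_right sum.distrib sum_distrib_left sum_distrib_right
    by (subst (1 2) sum.swap) (simp add: mult_ac)
  also have "\<dots> = (\<Sum>\<mu>\<in>K. dx \<mu> a * dx \<mu> b) + (\<Sum>A\<in>N. w q A a * v q A b)"
  proof (rule arg_cong2[where f = plus]; rule sum.cong[OF refl])
    fix \<mu> assume "\<mu> \<in> K"
    then show "1 / lam q \<mu> * dx \<mu> a * (\<Sum>d\<in>I. dx \<mu> d * ginv q d b) = dx \<mu> a * dx \<mu> b"
      using 1 lam_nz[OF q K_N] by simp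
  next
    fix A assume "A \<in> N"
    then show "lam q A * w q A a * (\<Sum>d\<in>I. w q A d * ginv q d b) = w q A a * v q A b"
      using 2 lam_nz[OF q] by simp
  qed
  finally show ?thesis using complete[OF q m] by simp
qed

end


section \<open>The metric as a chart with a frame\<close>

context kerr_chart
begin

text \<open>
  At each point the frame consists of the vectors dual to \<open>dx\<^sub>\<mu>\<close>, \<open>\<mu> \<in> K\<close>, and \<open>w\<^sub>A\<close>, \<open>A \<in> N\<close>. It is not
  normalised, which keeps square roots out of the computation.
\<close>

definition frame :: "(coord \<Rightarrow> real) \<Rightarrow> coord \<Rightarrow> coord \<Rightarrow> real" where
  "frame q F = (case F of XC \<mu> \<Rightarrow> dx \<mu> | PsiC A \<Rightarrow> v q A)"

definition coframe :: "(coord \<Rightarrow> real) \<Rightarrow> coord \<Rightarrow> coord \<Rightarrow> real" where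
  "coframe q F = (case F of XC \<mu> \<Rightarrow> dx \<mu> | PsiC A \<Rightarrow> w q A)"

definition frame_labels :: "coord set" where "frame_labels = XC ` K \<union> PsiC ` N"

lemma sum_frame_labels:
  "(\<Sum>F\<in>frame_labels. f F) = (\<Sum>\<mu>\<in>K. f (XC \<mu>)) + (\<Sum>A\<in>N. f (PsiC A) :: real)"
proof -
  have "(\<Sum>F\<in>frame_labels. f F) = (\<Sum>F\<in>XC ` K. f F) + (\<Sum>F\<in>PsiC ` N. f F)"
    unfolding frame_labels_def by (rule sum.union_disjoint) auto
  then show ?thesis by (simp add: sum.reindex inj_on_def)
qed

lemma frame_complete:
  "q \<in> dom \<Longrightarrow> i \<in> I \<Longrightarrow> j \<in> I \<Longrightarrow>
    (\<Sum>F\<in>frame_labels. coframe q F i * frame q F j) = (if i = j then 1 else 0)"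
  using complete by (simp add: sum_frame_labels frame_def coframe_def)

abbreviation weight where "weight q \<equiv> kerr_point.weight (lam q)"
abbreviation d1 where "d1 q \<equiv> kerr_point.d1 N (x q) (lam q) (l1 q)"
abbreviation d2 where "d2 q \<equiv> kerr_point.d2 N (x q) (lam q) (l1 q) (l2 q)"

lemma ginv_frame:
  assumes "q \<in> dom"
  shows "ginv q a b = (\<Sum>F\<in>frame_labels. weight q F * frame q F a * frame q F b)"
  by (simp add: ginv_def sum_frame_labels frame_def kerr_point.weight.simps[OF kerr_point[OF assms]] mult.assoc)

lemma ctr_w1: "q \<in> dom \<Longrightarrow> A \<in> N \<Longrightarrow> C \<in> N \<Longrightarrow> \<mu> \<in> K \<Longrightarrow>
    ctr I (v q A) (w1 q \<mu> C) = kerr_point.W1 (x q) \<mu> C A"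
  unfolding w1_def by (simp add: ctr_simps dual_v_w K_N kerr_point.W1_def[OF kerr_point])

lemma ctr_w2: "q \<in> dom \<Longrightarrow> A \<in> N \<Longrightarrow> C \<in> N \<Longrightarrow> \<mu> \<in> K \<Longrightarrow> \<nu> \<in> K \<Longrightarrow>
    ctr I (v q A) (w2 q \<mu> \<nu> C) = kerr_point.W2 (x q) \<mu> \<nu> C A"
  unfolding w2_def
  by (cases "\<mu> = \<nu>"; cases "C = \<mu> \<or> C = \<nu>")
    (simp_all add: ctr_simps dual_v_w K_N kerr_point.W2_def[OF kerr_point])

lemma ctr_dx_w1: "\<mu> \<in> K \<Longrightarrow> ctr I (dx \<mu>) (w1 q \<nu> C) = 0"
  by (simp add: ctr_dx w1_def)
lemma ctr_dx_w2: "\<mu> \<in> K \<Longrightarrow> ctr I (dx \<mu>) (w2 q \<nu> \<rho> C) = 0"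
  by (simp add: ctr_dx w2_def)

lemma sum_kron: "finite S \<Longrightarrow> a \<in> S \<Longrightarrow> (\<Sum>b\<in>S. f b * (kron b a * g b)) = f a * g a"
proof -
  assume "finite S" "a \<in> S"
  moreover have "(\<Sum>b\<in>S. f b * (kron b a * g b)) = (\<Sum>b\<in>S. if b = a then f a * g a else 0)"
    by (intro sum.cong refl) (auto simp: kron_def)
  ultimately show ?thesis by simp
qed

text \<open>
  Contracting with the dual vectors replaces \<open>w\<^sub>C\<close> by a Kronecker delta, which gives the arrays of
  \<open>kerr_point\<close>.
\<close>

lemma ctr_Dg:
  assumes q: "q \<in> dom" and \<mu>: "\<mu> \<in> K" and m: "F \<in> frame_labels" "G \<in> frame_labels"
  shows "ctr I (frame q F) (\<lambda>i. ctr I (frame q G) (\<lambda>j. Dg q \<mu> i j)) = d1 q (XC \<mu>) F G"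
proof -
  note d1 = kerr_point.d1.simps[OF kerr_point[OF q]]
  consider a b where "F = XC a" "G = XC b" "a \<in> K" "b \<in> K" | a B where "F = XC a" "G = PsiC B" "a \<in> K" "B \<in> N"
    | A b where "F = PsiC A" "G = XC b" "A \<in> N" "b \<in> K" | A B where "F = PsiC A" "G = PsiC B" "A \<in> N" "B \<in> N"
    using m by (auto simp: frame_labels_def)
  then show ?thesis
  proof cases
    case 1
    have "ctr I (dx a) (\<lambda>i. ctr I (dx b) (\<lambda>j. Dg q \<mu> i j)) = (\<Sum>\<nu>\<in>K. gd1 q \<mu> \<nu> * (kron \<nu> a * kron \<nu> b))"
      unfolding Dg_def using 1
      by (simp add: ctr_simps dual_dx_dx dual_dx_w ctr_dx_w1)
    also have "\<dots> = gd1 q \<mu> a * kron a b" by (rule sum_kron) (use 1 in auto)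
    finally show ?thesis using 1 by (simp add: frame_def d1 kron_def)
  next
    case 2
    then show ?thesis unfolding Dg_def frame_def
      by (simp add: ctr_simps dual_dx_dx dual_dx_w dual_v_dx ctr_dx_w1 d1)
  next
    case 3
    then show ?thesis unfolding Dg_def frame_def
      by (simp add: ctr_simps dual_dx_dx dual_dx_w dual_v_dx ctr_dx_w1 d1)
  next
    case 4
    have "ctr I (v q A) (\<lambda>i. ctr I (v q B) (\<lambda>j. Dg q \<mu> i j)) = hd1 q \<mu> A B"
      unfolding Dg_def kerr_point.hd1_def[OF kerr_point[OF q]]
      by (simp add: ctr_simps dual_v_dx)
        (intro sum.cong refl, simp add: dual_v_w ctr_w1[OF q _ _ \<mu>] q 4 mult_ac)
    then show ?thesis using 4 by (simp add: frame_def d1)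
  qed
qed

lemma ctr_D2g:
  assumes q: "q \<in> dom" and \<mu>: "\<mu> \<in> K" "\<nu> \<in> K" and m: "F \<in> frame_labels" "G \<in> frame_labels"
  shows "ctr I (frame q F) (\<lambda>i. ctr I (frame q G) (\<lambda>j. D2g q \<mu> \<nu> i j)) = d2 q (XC \<mu>) (XC \<nu>) F G"
proof -
  note d2 = kerr_point.d2.simps[OF kerr_point[OF q]]
  consider a b where "F = XC a" "G = XC b" "a \<in> K" "b \<in> K" | a B where "F = XC a" "G = PsiC B" "a \<in> K" "B \<in> N"
    | A b where "F = PsiC A" "G = XC b" "A \<in> N" "b \<in> K" | A B where "F = PsiC A" "G = PsiC B" "A \<in> N" "B \<in> N"
    using m by (auto simp: frame_labels_def)
  then show ?thesis
  proof cases
    case 1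
    have "ctr I (dx a) (\<lambda>i. ctr I (dx b) (\<lambda>j. D2g q \<mu> \<nu> i j)) = (\<Sum>\<rho>\<in>K. gd2 q \<mu> \<nu> \<rho> * (kron \<rho> a * kron \<rho> b))"
      unfolding D2g_def using 1
      by (simp add: ctr_simps dual_dx_dx dual_dx_w ctr_dx_w1 ctr_dx_w2)
    also have "\<dots> = gd2 q \<mu> \<nu> a * kron a b" by (rule sum_kron) (use 1 in auto)
    finally show ?thesis using 1 by (simp add: frame_def d2 kron_def)
  next
    case 2
    then show ?thesis unfolding D2g_def frame_def
      by (simp add: ctr_simps dual_dx_dx dual_dx_w dual_v_dx ctr_dx_w1 ctr_dx_w2 d2)
  next
    case 3
    then show ?thesis unfolding D2g_def frame_def
      by (simp add: ctr_simps dual_dx_dx dual_dx_w dual_v_dx ctr_dx_w1 ctr_dx_w2 d2)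
  next
    case 4
    have "ctr I (v q A) (\<lambda>i. ctr I (v q B) (\<lambda>j. D2g q \<mu> \<nu> i j)) = hd2 q \<mu> \<nu> A B"
      unfolding D2g_def kerr_point.hd2_def[OF kerr_point[OF q]]
      by (simp add: ctr_simps dual_v_dx)
        (intro sum.cong refl, simp add: dual_v_w ctr_w1[OF q _ _ \<mu>(1)] ctr_w1[OF q _ _ \<mu>(2)] ctr_w2[OF q _ _ \<mu>] q 4 mult_ac)
    then show ?thesis using 4 by (simp add: frame_def d2)
  qed
qed

definition dg :: "(coord \<Rightarrow> real) \<Rightarrow> coord \<Rightarrow> coord \<Rightarrow> coord \<Rightarrow> real" where
  "dg q a i j = (\<Sum>\<mu>\<in>K. dx \<mu> a * Dg q \<mu> i j)"

definition d2g :: "(coord \<Rightarrow> real) \<Rightarrow> coord \<Rightarrow> coord \<Rightarrow> coord \<Rightarrow> coord \<Rightarrow> real" where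
  "d2g q a b i j = (\<Sum>\<mu>\<in>K. dx \<mu> a * (\<Sum>\<nu>\<in>K. dx \<nu> b * D2g q \<mu> \<nu> i j))"

lemma ctr_dg:
  assumes q: "q \<in> dom" and m: "D \<in> frame_labels" "F \<in> frame_labels" "G \<in> frame_labels"
  shows "ctr I (frame q D) (\<lambda>a. ctr I (frame q F) (\<lambda>i. ctr I (frame q G) (\<lambda>j. dg q a i j))) = d1 q D F G"
proof -
  have "ctr I (frame q D) (\<lambda>a. ctr I (frame q F) (\<lambda>i. ctr I (frame q G) (\<lambda>j. dg q a i j)))
     = (\<Sum>\<mu>\<in>K. ctr I (frame q D) (dx \<mu>) * d1 q (XC \<mu>) F G)"
    unfolding dg_def by (simp only: ctr_simps) (intro sum.cong refl, simp only: ctr_Dg[OF q _ m(2,3)])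
  also have "\<dots> = d1 q D F G"
  proof (cases D)
    case (XC a)
    then have "a \<in> K" using m by (auto simp: frame_labels_def)
    have "(\<Sum>\<mu>\<in>K. ctr I (frame q D) (dx \<mu>) * d1 q (XC \<mu>) F G) = (\<Sum>\<mu>\<in>K. 1 * (kron \<mu> a * d1 q (XC \<mu>) F G))"
      unfolding XC by (simp add: frame_def dual_dx_dx[OF \<open>a \<in> K\<close>])
    also have "\<dots> = 1 * d1 q (XC a) F G" by (rule sum_kron) (use \<open>a \<in> K\<close> in auto)
    finally show ?thesis using XC by simp
  next
    case (PsiC A)
    then show ?thesis by (simp add: frame_def dual_v_dx kerr_point.d1.simps[OF kerr_point[OF q]])
  qed
  finally show ?thesis .
qed

lemma ctr_d2g:
  assumes q: "q \<in> dom" and m: "C \<in> frame_labels" "D \<in> frame_labels" "F \<in> frame_labels" "G \<in> frame_labels"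
  shows "ctr I (frame q C) (\<lambda>a. ctr I (frame q D) (\<lambda>b. ctr I (frame q F) (\<lambda>i. ctr I (frame q G)
     (\<lambda>j. d2g q a b i j)))) = d2 q C D F G"
proof -
  note d2 = kerr_point.d2.simps[OF kerr_point[OF q]]
  have "ctr I (frame q C) (\<lambda>a. ctr I (frame q D) (\<lambda>b. ctr I (frame q F) (\<lambda>i. ctr I (frame q G) (\<lambda>j. d2g q a b i j))))
     = (\<Sum>\<mu>\<in>K. ctr I (frame q C) (dx \<mu>) * (\<Sum>\<nu>\<in>K. ctr I (frame q D) (dx \<nu>) * d2 q (XC \<mu>) (XC \<nu>) F G))"
    unfolding d2g_def
    by (simp only: ctr_simps) (intro sum.cong refl arg_cong2[where f = times], simp only: ctr_D2g[OF q _ _ m(3,4)])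
  also have "\<dots> = d2 q C D F G"
  proof (cases C)
    case (XC a)
    then have a: "a \<in> K" using m by (auto simp: frame_labels_def)
    have "(\<Sum>\<mu>\<in>K. ctr I (frame q C) (dx \<mu>) * (\<Sum>\<nu>\<in>K. ctr I (frame q D) (dx \<nu>) * d2 q (XC \<mu>) (XC \<nu>) F G))
       = (\<Sum>\<mu>\<in>K. 1 * (kron \<mu> a * (\<Sum>\<nu>\<in>K. ctr I (frame q D) (dx \<nu>) * d2 q (XC \<mu>) (XC \<nu>) F G)))"
      unfolding XC by (simp add: frame_def dual_dx_dx[OF a])
    also have "\<dots> = 1 * (\<Sum>\<nu>\<in>K. ctr I (frame q D) (dx \<nu>) * d2 q (XC a) (XC \<nu>) F G)"
      by (rule sum_kron) (use a in auto)
    also have "\<dots> = d2 q C D F G"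
    proof (cases D)
      case D: (XC b)
      then have b: "b \<in> K" using m by (auto simp: frame_labels_def)
      have "(\<Sum>\<nu>\<in>K. ctr I (frame q D) (dx \<nu>) * d2 q (XC a) (XC \<nu>) F G) =
         (\<Sum>\<nu>\<in>K. 1 * (kron \<nu> b * d2 q (XC a) (XC \<nu>) F G))"
        unfolding D by (simp add: frame_def dual_dx_dx[OF b])
      also have "\<dots> = 1 * d2 q (XC a) (XC b) F G" by (rule sum_kron) (use b in auto)
      finally show ?thesis using XC D by simp
    next
      case (PsiC B)
      then show ?thesis using XC by (simp add: frame_def dual_v_dx d2)
    qed
    finally show ?thesis .
  next
    case (PsiC A)
    then show ?thesis by (simp add: frame_def dual_v_dx d2)
  qed
  finally show ?thesis .
qed

lemma line_diff_mult:
  "\<exists>D. has_partial f D a q \<Longrightarrow> \<exists>D. has_partial g D a q \<Longrightarrow> \<exists>D. has_partial (\<lambda>r. f r * g r) D a q"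
  by (elim exE) (rule exI, rule has_partial_mult)

lemma v_diff:
  assumes q: "q \<in> dom" and A: "A \<in> N"
  shows "\<exists>D. has_partial (\<lambda>r. v r A i) D a q"
proof -
  from u_partial_any[of A a q] obtain D where D: "has_partial (\<lambda>r. u r A) D a q" ..
  have pow: "\<exists>D. has_partial (\<lambda>r. (- u r A) ^ j) D a q" for j
  proof (induction j)
    case 0
    show ?case unfolding power_0 by (rule exI, rule has_partial_const)
  next
    case (Suc j)
    show ?case unfolding power_Suc
      by (rule line_diff_mult[OF _ Suc], rule exI, rule has_partial_minus[OF D])
  qed
  have "\<exists>E. has_partial (\<lambda>r. u r B - u r A) E a q" for B
  proof -
    from u_partial_any[of B a q] obtain D' where "has_partial (\<lambda>r. u r B) D' a q" ..
    then have "has_partial (\<lambda>r. u r B - u r A) (D' - D) a q" using D by (rule has_partial_diff)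
    then show ?thesis ..
  qed
  then have "\<forall>B. \<exists>E. has_partial (\<lambda>r. u r B - u r A) E a q" ..
  from choice[OF this] obtain E where E: "\<forall>B. has_partial (\<lambda>r. u r B - u r A) (E B) a q" ..
  have nz: "u q B - u q A \<noteq> 0" if "B \<in> N-{A}" for B
  proof -
    have "B \<in> N" "B \<noteq> A" using that by auto
    from dom_distinct[OF q this(1) A this(2)] show ?thesis by simp
  qed
  then have nz': "(\<Prod>B\<in>N-{A}. u q B - u q A) \<noteq> 0"
    unfolding prod_zero_iff[OF finite_Diff[OF finite_N]] by blast
  have prod: "has_partial (\<lambda>r. \<Prod>B\<in>N-{A}. u r B - u r A)
     ((\<Prod>B\<in>N-{A}. u q B - u q A) * (\<Sum>B\<in>N-{A}. E B / (u q B - u q A))) a q"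
    by (rule has_partial_prod[where f = "\<lambda>B r. u r B - u r A"]) (simp, rule E[rule_format], rule nz)
  have lag: "\<exists>D. has_partial (\<lambda>r. dpsi k i * lagrange (u r) N A k) D a q" for k
  proof -
    from pow[of "card N - Suc k"] obtain P where P: "has_partial (\<lambda>r. (- u r A) ^ (card N - Suc k)) P a q" ..
    show ?thesis unfolding lagrange_def
      by (rule exI, rule has_partial_cmult, rule has_partial_divide, rule P, rule prod, rule nz')
  qed
  then have "\<forall>k. \<exists>E. has_partial (\<lambda>r. dpsi k i * lagrange (u r) N A k) E a q" ..
  from choice[OF this] obtain E' where E': "\<forall>k. has_partial (\<lambda>r. dpsi k i * lagrange (u r) N A k) (E' k) a q" ..
  have "has_partial (\<lambda>r. \<Sum>k<n+\<epsilon>. dpsi k i * lagrange (u r) N A k) (\<Sum>k<n+\<epsilon>. E' k) a q"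
    by (rule has_partial_sum) (rule E'[rule_format])
  moreover have "(\<lambda>r. \<Sum>k<n+\<epsilon>. dpsi k i * lagrange (u r) N A k) = (\<lambda>r. v r A i)"
    unfolding v_def by (simp only: mult.commute)
  ultimately show ?thesis by auto
qed

lemma lam_diff:
  assumes q: "q \<in> dom" and A: "A \<in> N" and a: "a \<in> I"
  shows "\<exists>D. has_partial (\<lambda>r. lam r A) D a q"
proof -
  have "psi_free (\<lambda>r. lam r A)" by (simp add: psi_free_def)
  then have "has_partial (\<lambda>r. lam r A) (\<Sum>\<mu>\<in>K. dx \<mu> a * L1 q \<mu> A) a q"
    by (rule has_partial_coord[OF _ _ a]) (rule lam_partial[OF q A])
  then show ?thesis ..
qed

lemma ginv_diff:
  assumes q: "q \<in> dom" and k: "k \<in> I"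
  shows "\<exists>D. has_partial (\<lambda>r. ginv r a b) D k q"
proof -
  have "\<exists>D. has_partial (\<lambda>r. 1 / lam r A * (v r A a * v r A b)) D k q" if A: "A \<in> N" for A
  proof (intro line_diff_mult v_diff q A)
    obtain D where D: "has_partial (\<lambda>r. lam r A) D k q" using lam_diff[OF q A k] ..
    show "\<exists>D. has_partial (\<lambda>r. 1 / lam r A) D k q"
      by (rule exI, rule has_partial_inverse, rule D, rule lam_nz[OF q A])
  qed
  then have "\<forall>A\<in>N. \<exists>D. has_partial (\<lambda>r. 1 / lam r A * (v r A a * v r A b)) D k q" ..
  from bchoice[OF this] obtain D where D: "\<forall>A\<in>N. has_partial (\<lambda>r. 1 / lam r A * (v r A a * v r A b)) (D A) k q" ..
  have "\<exists>D. has_partial (\<lambda>r. lam r \<mu> * (dx \<mu> a * dx \<mu> b)) D k q" if "\<mu> \<in> K" for \<mu>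
  proof (rule line_diff_mult[OF lam_diff[OF q K_N[OF that] k]])
    show "\<exists>D. has_partial (\<lambda>r. dx \<mu> a * dx \<mu> b) D k q" by (rule exI, rule has_partial_const)
  qed
  then have "\<forall>\<mu>\<in>K. \<exists>D. has_partial (\<lambda>r. lam r \<mu> * (dx \<mu> a * dx \<mu> b)) D k q" ..
  from bchoice[OF this] obtain D' where D': "\<forall>\<mu>\<in>K. has_partial (\<lambda>r. lam r \<mu> * (dx \<mu> a * dx \<mu> b)) (D' \<mu>) k q" ..
  have "has_partial (\<lambda>r. ginv r a b) ((\<Sum>\<mu>\<in>K. D' \<mu>) + (\<Sum>A\<in>N. D A)) k q"
    unfolding ginv_def by (intro has_partial_add has_partial_sum D[rule_format] D'[rule_format])
  then show ?thesis ..
qed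

sublocale metric_chart I dom "kerr_metric n \<epsilon> c X" ginv dg d2g
proof
  show "finite I" by simp
  show "line_open dom" by (rule dom_open)
  show "kerr_metric n \<epsilon> c X q a b = kerr_metric n \<epsilon> c X q b a" for q a b
    by (simp add: metric_eq mult.commute)
  show "has_partial (\<lambda>r. kerr_metric n \<epsilon> c X r i j) (dg q a i j) a q" if "q \<in> dom" "a \<in> I" for q a i j
    unfolding dg_def
    by (rule has_partial_coord[OF _ metric_partial[OF that(1)] that(2)]) (simp_all add: psi_free_def metric_eq)
  show "has_partial (\<lambda>r. dg r b i j) (d2g q a b i j) a q" if "q \<in> dom" "a \<in> I" "b \<in> I" for q a b i j
    unfolding d2g_def
  proof (rule has_partial_coord[OF _ _ that(2)])
    show "psi_free (\<lambda>r. dg r b i j)"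
      by (simp add: psi_free_def dg_def Dg_def)
    fix \<mu> assume "\<mu> \<in> K"
    then show "has_partial (\<lambda>r. dg r b i j) (\<Sum>\<nu>\<in>K. dx \<nu> b * D2g q \<mu> \<nu> i j) (XC \<mu>) q"
      unfolding dg_def by (intro has_partial_sum has_partial_cmult Dg_partial that(1))
  qed
  show "ginv q a b = 0" if "a \<notin> I \<or> b \<notin> I" for q a b
  proof -
    have "lam q \<mu> * (dx \<mu> a * dx \<mu> b) = 0" if "\<mu> \<in> K" for \<mu>
      using \<open>a \<notin> I \<or> b \<notin> I\<close> that by (auto simp: coords_def dx_def)
    moreover have "1 / lam q A * (v q A a * v q A b) = 0" for A
      using \<open>a \<notin> I \<or> b \<notin> I\<close> by (cases a; cases b) (auto simp: coords_def v_at_PsiC)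
    ultimately show ?thesis unfolding ginv_def by (simp only: sum.neutral_const cong: sum.cong)
  qed
  show "ginv q a b = ginv q b a" for q a b
    by (simp add: ginv_def mult.commute)
  show "(\<Sum>d\<in>I. kerr_metric n \<epsilon> c X q a d * ginv q d b) = (if a = b then 1 else 0)"
    if "q \<in> dom" "a \<in> I" "b \<in> I" for q a b using metric_ginv[OF that] .
  show "\<exists>D. has_partial (\<lambda>r. ginv r a b) D k q" if "q \<in> dom" "a \<in> I" "b \<in> I" "k \<in> I" for q a b k
    using ginv_diff that by blast
qed

end


section \<open>The curvature in coordinates\<close>

context kerr_chart
begin

abbreviation "S q \<equiv> kerr_point.Sf N (x q) (lam q) (l1 q)"
abbreviation "F q \<equiv> kerr_point.Ff N (x q) (lam q) (l1 q)"
abbreviation "D q \<equiv> kerr_point.Df N (x q) (lam q) (l2 q)"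

definition h :: "(coord \<Rightarrow> real) \<Rightarrow> nat \<Rightarrow> coord \<Rightarrow> coord \<Rightarrow> real" where
  "h q a i j = dx a i * w q a j - w q a i * dx a j"

definition Q :: "(coord \<Rightarrow> real) \<Rightarrow> nat \<Rightarrow> coord \<Rightarrow> coord \<Rightarrow> real" where
  "Q q a i j = 1 / lam q a * (dx a i * dx a j) + lam q a * (w q a i * w q a j)"

lemma ctr_h:
  assumes q: "q \<in> dom" and a: "a \<in> N" and m: "L \<in> frame_labels" "M \<in> frame_labels"
  shows "ctr I (frame q L) (\<lambda>i. ctr I (frame q M) (\<lambda>j. h q a i j)) = h_frame a L M"
  using m unfolding frame_labels_def frame_def h_def
  by (auto simp: ctr_simps dual_dx_dx dual_dx_w dual_v_dx dual_v_w[OF q _ a] h_frame_def kron_def)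

lemma ctr_Q:
  assumes q: "q \<in> dom" and a: "a \<in> N" and m: "L \<in> frame_labels" "M \<in> frame_labels"
  shows "ctr I (frame q L) (\<lambda>i. ctr I (frame q M) (\<lambda>j. Q q a i j)) = kerr_point.Q_frame (lam q) a L M"
  using m unfolding frame_labels_def frame_def Q_def kerr_point.Q_frame_def[OF kerr_point[OF q]]
  by (auto simp: ctr_simps dual_dx_dx dual_dx_w dual_v_dx dual_v_w[OF q _ a] kron_def
      kerr_point.weight.simps[OF kerr_point[OF q]] split: if_split_asm)

lemma ctr_zero_weight_curvature:
  assumes h: "\<And>a L M. a \<in> N \<Longrightarrow> L \<in> \<F> \<Longrightarrow> M \<in> \<F> \<Longrightarrow> ctr I (E L) (\<lambda>i. ctr I (E M) (\<lambda>j. hc a i j)) = hf a L M"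
    and Q: "\<And>a L M. a \<in> N \<Longrightarrow> L \<in> \<F> \<Longrightarrow> M \<in> \<F> \<Longrightarrow> ctr I (E L) (\<lambda>i. ctr I (E M) (\<lambda>j. Qc a i j)) = Qf a L M"
    and m: "A \<in> \<F>" "B \<in> \<F>" "C \<in> \<F>" "H \<in> \<F>"
  shows "ctr I (E A) (\<lambda>i. ctr I (E B) (\<lambda>j. ctr I (E C) (\<lambda>k. ctr I (E H) (\<lambda>l.
     zero_weight_curvature N s f d hc Qc i j k l)))) = zero_weight_curvature N s f d hf Qf A B C H"
  unfolding zero_weight_curvature_def
  by (simp only: ctr_simps)
    (intro arg_cong2[where f = plus] sum.cong refl; simp only: ctr_simps h Q m)

text \<open>
  In odd dimension the arrays of \<open>kerr_point\<close> have a direction \<open>XC 0\<close> that is not a coordinate. All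
  derivatives in this direction vanish since \<open>\<kappa>\<^sub>0\<^sub>b = 0\<close> and \<open>l1 0 = 0\<close>, hence it drops out of the
  sum over frame labels: the slice \<open>x\<^sub>0 = 0\<close> is totally geodesic.
\<close>

theorem riemann_eq_zero_weight_curvature:
  assumes q: "q \<in> dom" and m: "i \<in> I" "j \<in> I" "k \<in> I" "l \<in> I"
  shows "riemann I (kerr_metric n \<epsilon> c X) q i j k l
     = zero_weight_curvature N (S q) (F q) (D q) (h q) (Q q) i j k l"
proof (rule tensor4_eqI[OF finite_I _ frame_complete[OF q] _ m])
  show "finite frame_labels" by (simp add: frame_labels_def)
next
  interpret P: kerr_point N "x q" "lam q" "l1 q" "l2 q" by (rule kerr_point[OF q])
  have sub: "frame_labels \<subseteq> P.labels"
    by (auto simp: frame_labels_def P.labels_def K_N)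
  (* E can only be the label XC 0, which is no coordinate direction *)
  have zero: "frame_chris P.d1 E G H = 0"
    if E: "E \<in> P.labels - frame_labels" and GH: "G \<in> frame_labels" "H \<in> frame_labels" for E G H
  proof -
    obtain a where a: "E = XC a" "a \<in> N" "a \<notin> K"
      using E unfolding P.labels_def frame_labels_def by blast
    then have "a = 0" using N_K by blast
    then have "E = XC 0" "0 \<in> N" using a by auto
    have k0: "kp (x q) 0 b = 0" for b by (simp add: kp_def x_def)
    have "P.gd1 0 b = 0" for b
      by (simp add: P.gd1_def P.L1_def k0 l1_def)
    moreover have "P.hd1 0 a b = 0" if "a \<in> N" "b \<in> N" for a b
      using that \<open>0 \<in> N\<close> by (cases "a = b") (auto simp: P.hd1_simps k0 l1_def)
    ultimately show ?thesis
      using GH unfolding \<open>E = XC 0\<close> frame_labels_def by (auto simp: frame_chris_def)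
  qed
  fix A B C H assume fr: "A \<in> frame_labels" "B \<in> frame_labels" "C \<in> frame_labels" "H \<in> frame_labels"
  have "ctr I (frame q A) (\<lambda>i. ctr I (frame q B) (\<lambda>j. ctr I (frame q C) (\<lambda>k. ctr I (frame q H) (\<lambda>l.
      riemann I (kerr_metric n \<epsilon> c X) q i j k l))))
     = frame_riemann frame_labels P.weight P.d1 P.d2 A B C H"
    by (rule riemann_contracted[OF q _ _ _ fr]) (use ginv_frame[OF q] ctr_dg[OF q] ctr_d2g[OF q] in auto)
  also have "\<dots> = P.R A B C H"
  proof -
    have s: "(\<Sum>E\<in>frame_labels. P.weight E * frame_chris P.d1 E a b * frame_chris P.d1 E c d)
      = (\<Sum>E\<in>P.labels. P.weight E * frame_chris P.d1 E a b * frame_chris P.d1 E c d)"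
      if "a \<in> frame_labels" "b \<in> frame_labels" for a b c d
      by (rule sum.mono_neutral_left) (use sub zero that in \<open>auto simp: P.labels_def\<close>)
    show ?thesis unfolding frame_riemann_def using fr by (simp add: s)
  qed
  also have "\<dots> = P.T A B C H"
    by (rule P.R_eq_T) (use sub fr in auto)
  also have "\<dots> = ctr I (frame q A) (\<lambda>i. ctr I (frame q B) (\<lambda>j. ctr I (frame q C) (\<lambda>k. ctr I (frame q H) (\<lambda>l.
      zero_weight_curvature N (S q) (F q) (D q) (h q) (Q q) i j k l))))"
    by (rule ctr_zero_weight_curvature[symmetric, OF ctr_h[OF q] ctr_Q[OF q] fr])
  finally show "ctr I (frame q A) (\<lambda>i. ctr I (frame q B) (\<lambda>j. ctr I (frame q C) (\<lambda>k. ctr I (frame q H) (\<lambda>l.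
      riemann I (kerr_metric n \<epsilon> c X) q i j k l))))
    = ctr I (frame q A) (\<lambda>i. ctr I (frame q B) (\<lambda>j. ctr I (frame q C) (\<lambda>k. ctr I (frame q H) (\<lambda>l.
      zero_weight_curvature N (S q) (F q) (D q) (h q) (Q q) i j k l))))" .
qed

theorem riemann_curvature_like:
  assumes q: "q \<in> dom"
  shows "curvature_like I (riemann I (kerr_metric n \<epsilon> c X) q)"
proof (rule curvature_like_cong[OF riemann_eq_zero_weight_curvature[OF q]])
  interpret P: kerr_point N "x q" "lam q" "l1 q" "l2 q" by (rule kerr_point[OF q])
  show "curvature_like I (zero_weight_curvature N (S q) (F q) (D q) (h q) (Q q))"
  proof (rule curvature_like_zero_weight_curvature)
    show "S q a b = S q b a" "F q a b = F q b a" for a b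
      by (rule P.Sf_commute P.Ff_commute)+
  qed (simp_all add: h_def Q_def algebra_simps)
qed

lemma M_fun_eq: "M_fun n \<epsilon> c X q = (\<Sum>A\<in>N. lam q A)"
proof -
  have "(\<Sum>A\<in>N. lam q A) = (\<Sum>\<mu>\<in>K. lam q \<mu>) + (if \<epsilon> = 0 then 0 else lam q 0)"
    unfolding N_cases by simp
  moreover have "(\<Sum>\<mu>\<in>K. lam q \<mu>) = (\<Sum>\<mu>\<in>K. X \<mu> (q (XC \<mu>)) / U_fun n \<mu> q)"
    by (intro sum.cong) (auto simp: lam_def)
  ultimately show ?thesis unfolding M_fun_def using \<epsilon> by (auto simp: lam_def)
qed

text \<open>
  By the structure equations \<open>\<partial>\<^sub>\<mu> \<Sum>\<^sub>A \<lambda>\<^sub>A = \<partial>\<^sub>\<mu> \<lambda>\<^sub>\<mu> - \<Sum>\<^sub>A \<kappa>\<^sub>\<mu>\<^sub>A \<lambda>\<^sub>A\<close>.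
\<close>

lemma M_partial:
  assumes q: "q \<in> dom" and \<mu>: "\<mu> \<in> K"
  shows "partial (XC \<mu>) (M_fun n \<epsilon> c X) q = kerr_point.M1 N (x q) (lam q) (l1 q) \<mu>"
    and "partial (XC \<mu>) (partial (XC \<mu>) (M_fun n \<epsilon> c X)) q = kerr_point.M2 N (x q) (lam q) (l2 q) \<mu>"
proof -
  have M: "M_fun n \<epsilon> c X = (\<lambda>r. \<Sum>A\<in>N. lam r A)" by (rule ext) (rule M_fun_eq)
  have first: "partial (XC \<mu>) (M_fun n \<epsilon> c X) r = (\<Sum>A\<in>N. L1 r \<mu> A)" if "r \<in> dom" for r
    unfolding M by (rule has_partial_imp_partial) (intro has_partial_sum lam_partial that \<mu>)
  interpret P: kerr_point N "x q" "lam q" "l1 q" "l2 q" by (rule kerr_point[OF q])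
  have \<mu>N: "\<mu> \<in> N" using \<mu> K_N by auto
  have "(\<Sum>A\<in>N-{\<mu>}. L1 q \<mu> A) = (\<Sum>A\<in>N-{\<mu>}. - (kp (x q) \<mu> A * lam q A))"
    by (intro sum.cong) (auto simp: P.L1_def)
  then have "(\<Sum>A\<in>N. L1 q \<mu> A) = P.M1 \<mu>"
    unfolding P.M1_def P.K_def P.sum_split1[OF \<mu>N] by (simp add: P.L1_def sum_negf)
  then show "partial (XC \<mu>) (M_fun n \<epsilon> c X) q = P.M1 \<mu>" using first[OF q] by simp
  have "has_partial (\<lambda>r. \<Sum>A\<in>N. L1 r \<mu> A) (\<Sum>A\<in>N. L2 q \<mu> \<mu> A) (XC \<mu>) q"
    by (intro has_partial_sum L1_partial q \<mu>)
  then have "has_partial (partial (XC \<mu>) (M_fun n \<epsilon> c X)) (\<Sum>A\<in>N. L2 q \<mu> \<mu> A) (XC \<mu>) q"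
    by (rule has_partial_cong_on[OF dom_open q, rotated]) (simp add: first)
  then have "partial (XC \<mu>) (partial (XC \<mu>) (M_fun n \<epsilon> c X)) q = (\<Sum>A\<in>N. L2 q \<mu> \<mu> A)"
    by (rule has_partial_imp_partial)
  moreover have "(\<Sum>A\<in>N-{\<mu>}. L2 q \<mu> \<mu> A) = (\<Sum>A\<in>N-{\<mu>}. - ((dl (x q) \<mu> A - 2 * kp (x q) \<mu> A * kp (x q) \<mu> A) * lam q A))"
    by (intro sum.cong) (auto simp: P.L2_def algebra_simps)
  then have "(\<Sum>A\<in>N. L2 q \<mu> \<mu> A) = P.M2 \<mu>"
    unfolding P.M2_def P.sum_split1[OF \<mu>N] by (simp add: P.L2_def sum_negf)
  ultimately show "partial (XC \<mu>) (partial (XC \<mu>) (M_fun n \<epsilon> c X)) q = P.M2 \<mu>" by simp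
qed

lemma kp_eq:
  assumes "q \<in> dom" "\<mu> \<in> K" "\<nu> \<in> K" "\<mu> \<noteq> \<nu>"
  shows "kp (x q) \<mu> \<nu> = 2 * q (XC \<mu>) / ((q (XC \<mu>))\<^sup>2 - (q (XC \<nu>))\<^sup>2)"
    "kp (x q) \<nu> \<mu> = - (2 * q (XC \<nu>)) / ((q (XC \<mu>))\<^sup>2 - (q (XC \<nu>))\<^sup>2)"
proof -
  have "\<mu> \<noteq> 0" "\<nu> \<noteq> 0" using assms by auto
  then show "kp (x q) \<mu> \<nu> = 2 * q (XC \<mu>) / ((q (XC \<mu>))\<^sup>2 - (q (XC \<nu>))\<^sup>2)"
    by (simp add: kp_def x_def)
  define d where "d = (q (XC \<mu>))\<^sup>2 - (q (XC \<nu>))\<^sup>2"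
  have "(x q \<nu>)\<^sup>2 - (x q \<mu>)\<^sup>2 = - d" using \<open>\<mu> \<noteq> 0\<close> \<open>\<nu> \<noteq> 0\<close> by (simp add: d_def x_def)
  then have "kp (x q) \<nu> \<mu> = - (2 * q (XC \<nu>)) / d"
    using \<open>\<nu> \<noteq> 0\<close> unfolding kp_def by (simp add: x_def)
  then show "kp (x q) \<nu> \<mu> = - (2 * q (XC \<nu>)) / ((q (XC \<mu>))\<^sup>2 - (q (XC \<nu>))\<^sup>2)"
    unfolding d_def .
qed

lemma coefficient_eqs:
  assumes q: "q \<in> dom" and m: "\<mu> \<in> K"
  shows S_eq: "\<nu> \<in> K \<Longrightarrow> \<mu> \<noteq> \<nu> \<Longrightarrow> S q \<mu> \<nu> = S_fun n \<epsilon> c X \<mu> \<nu> q"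
    and F_eq: "\<nu> \<in> K \<Longrightarrow> \<mu> \<noteq> \<nu> \<Longrightarrow> F q \<mu> \<nu> = F_fun n \<epsilon> c X \<mu> \<nu> q"
    and D_eq: "D q \<mu> = D_fun n \<epsilon> c X \<mu> q"
    and E_eq: "\<epsilon> = 1 \<Longrightarrow> S q \<mu> 0 = E_fun n \<epsilon> c X \<mu> q"
proof -
  note defs = kerr_point.Sf_def[OF kerr_point[OF q]] kerr_point.Ff_def[OF kerr_point[OF q]]
    kerr_point.Df_def[OF kerr_point[OF q]]
  {
    assume \<nu>: "\<nu> \<in> K" "\<mu> \<noteq> \<nu>"
    define d where "d = (q (XC \<mu>))\<^sup>2 - (q (XC \<nu>))\<^sup>2"
    have nz: "d \<noteq> 0" unfolding d_def
      using dom_distinct[OF q K_N[OF m] K_N[OF \<nu>(1)] \<nu>(2)] m \<nu> by (auto simp: x_def)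
    show "S q \<mu> \<nu> = S_fun n \<epsilon> c X \<mu> \<nu> q"
      using nz unfolding defs S_fun_def kp_eq[OF q m \<nu>] M_partial(1)[OF q m] M_partial(1)[OF q \<nu>(1)]
        d_def[symmetric] by (simp add: field_simps)
    show "F q \<mu> \<nu> = F_fun n \<epsilon> c X \<mu> \<nu> q"
      using nz unfolding defs F_fun_def kp_eq[OF q m \<nu>] M_partial(1)[OF q m] M_partial(1)[OF q \<nu>(1)]
        d_def[symmetric] by (simp add: field_simps)
  }
  show "D q \<mu> = D_fun n \<epsilon> c X \<mu> q"
    unfolding defs D_fun_def M_partial(2)[OF q m] by simp
  assume "\<epsilon> = 1"
  then have "u q \<mu> \<noteq> u q 0" using dom_distinct[OF q K_N[OF m], of 0] m N_zero by auto
  then have "q (XC \<mu>) \<noteq> 0" using m by (auto simp: x_def)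
  then show "S q \<mu> 0 = E_fun n \<epsilon> c X \<mu> q"
    using m unfolding defs E_fun_def M_partial(1)[OF q m]
    by (simp add: kp_def x_def field_simps power2_eq_square)
qed

end


section \<open>Tensors of totally zero weight\<close>

lemma sum_over_pairs:
  fixes f :: "nat \<Rightarrow> nat \<Rightarrow> real"
  shows "(\<Sum>a=1..n. \<Sum>b=1..n. f a b) = (\<Sum>a=1..n. f a a) + (\<Sum>a=1..n. \<Sum>b\<in>{a<..n}. f a b + f b a)"
proof (induction n)
  case (Suc n)
  have "(\<Sum>a=1..n. \<Sum>b\<in>{a<..Suc n}. f a b + f b a)
     = (\<Sum>a=1..n. (\<Sum>b\<in>{a<..n}. f a b + f b a) + (f a (Suc n) + f (Suc n) a))"
  proof (intro sum.cong refl)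
    fix a assume "a \<in> {1..n}"
    then have "{a<..Suc n} = insert (Suc n) {a<..n}" by auto
    then show "(\<Sum>b\<in>{a<..Suc n}. f a b + f b a) = (\<Sum>b\<in>{a<..n}. f a b + f b a) + (f a (Suc n) + f (Suc n) a)"
      by simp
  qed
  then show ?case using Suc by (simp add: sum.distrib)
qed simp

definition real_zero_weight where
  "real_zero_weight n \<epsilon> c X p t = totally_zero_weight n \<epsilon> c X p (\<lambda>i j k l. complex_of_real (t i j k l))"

lemma totally_zero_weight_lincomb:
  assumes "totally_zero_weight n \<epsilon> c X p S" "totally_zero_weight n \<epsilon> c X p T"
  shows "totally_zero_weight n \<epsilon> c X p (\<lambda>i j k l. a * S i j k l + b * T i j k l)"
proof -
  obtain C where C: "\<forall>i\<in>coords n \<epsilon>. \<forall>j\<in>coords n \<epsilon>. \<forall>k\<in>coords n \<epsilon>. \<forall>l\<in>coords n \<epsilon>.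
          S i j k l = (\<Sum>w | length w = 4 \<and> set w \<subseteq> legs n \<epsilon> \<and> balanced n w.
               C w * leg_form n c X p (w ! 0) i * leg_form n c X p (w ! 1) j
                   * leg_form n c X p (w ! 2) k * leg_form n c X p (w ! 3) l)"
    using assms(1) unfolding totally_zero_weight_def by (elim exE)
  obtain C' where C': "\<forall>i\<in>coords n \<epsilon>. \<forall>j\<in>coords n \<epsilon>. \<forall>k\<in>coords n \<epsilon>. \<forall>l\<in>coords n \<epsilon>.
          T i j k l = (\<Sum>w | length w = 4 \<and> set w \<subseteq> legs n \<epsilon> \<and> balanced n w.
               C' w * leg_form n c X p (w ! 0) i * leg_form n c X p (w ! 1) j
                   * leg_form n c X p (w ! 2) k * leg_form n c X p (w ! 3) l)"
    using assms(2) unfolding totally_zero_weight_def by (elim exE)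
  show ?thesis unfolding totally_zero_weight_def
  proof (intro exI[of _ "\<lambda>w. a * C w + b * C' w"] ballI)
    fix i j k l assume m: "i \<in> coords n \<epsilon>" "j \<in> coords n \<epsilon>" "k \<in> coords n \<epsilon>" "l \<in> coords n \<epsilon>"
    show "a * S i j k l + b * T i j k l = (\<Sum>w | length w = 4 \<and> set w \<subseteq> legs n \<epsilon> \<and> balanced n w.
               (a * C w + b * C' w) * leg_form n c X p (w ! 0) i * leg_form n c X p (w ! 1) j
                   * leg_form n c X p (w ! 2) k * leg_form n c X p (w ! 3) l)"
      unfolding C[rule_format, OF m] C'[rule_format, OF m] sum_distrib_left sum.distrib[symmetric]
      by (intro sum.cong refl) (simp add: algebra_simps)
  qed
qed

lemma totally_zero_weight_cong:
  assumes "totally_zero_weight n \<epsilon> c X p S"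
    and "\<And>i j k l. i \<in> coords n \<epsilon> \<Longrightarrow> j \<in> coords n \<epsilon> \<Longrightarrow> k \<in> coords n \<epsilon> \<Longrightarrow> l \<in> coords n \<epsilon> \<Longrightarrow> T i j k l = S i j k l"
  shows "totally_zero_weight n \<epsilon> c X p T"
  using assms(1) unfolding totally_zero_weight_def by (simp add: assms(2) cong: ball_cong)

lemma finite_legs: "finite (legs n \<epsilon>)"
  by (simp add: legs_def)

lemma totally_zero_weight_monomial:
  assumes w0: "length w0 = 4" "set w0 \<subseteq> legs n \<epsilon>" "balanced n w0"
  shows "totally_zero_weight n \<epsilon> c X p (\<lambda>i j k l. leg_form n c X p (w0 ! 0) i * leg_form n c X p (w0 ! 1) j
                   * leg_form n c X p (w0 ! 2) k * leg_form n c X p (w0 ! 3) l)"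
  unfolding totally_zero_weight_def
proof (intro exI[of _ "\<lambda>w. if w = w0 then 1 else 0"] ballI)
  fix i j k l
  let ?W = "{w. length w = 4 \<and> set w \<subseteq> legs n \<epsilon> \<and> balanced n w}"
  let ?m = "\<lambda>w. leg_form n c X p (w ! 0) i * leg_form n c X p (w ! 1) j
                   * leg_form n c X p (w ! 2) k * leg_form n c X p (w ! 3) l"
  have fin: "finite ?W"
    by (rule finite_subset[OF _ finite_lists_length_eq[OF finite_legs[of n \<epsilon>], of 4]]) auto
  have "(\<Sum>w\<in>?W. (if w = w0 then 1 else 0) * leg_form n c X p (w ! 0) i * leg_form n c X p (w ! 1) j
                   * leg_form n c X p (w ! 2) k * leg_form n c X p (w ! 3) l) = (\<Sum>w\<in>?W. if w = w0 then ?m w else 0)"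
    by (intro sum.cong refl) auto
  also have "\<dots> = ?m w0" using fin w0 by (subst sum.delta) auto
  finally show "?m w0 = (\<Sum>w\<in>?W. (if w = w0 then 1 else 0) * leg_form n c X p (w ! 0) i * leg_form n c X p (w ! 1) j
                   * leg_form n c X p (w ! 2) k * leg_form n c X p (w ! 3) l)" ..
qed

text \<open>
  The pairs of legs whose product has weight zero, and the two-index forms built from one such pair.
  Products of two of these forms have total weight zero for each distribution of the four indices.
\<close>

definition conjugate_legs :: "nat \<Rightarrow> nat \<Rightarrow> leg \<Rightarrow> leg \<Rightarrow> bool" where
  "conjugate_legs n \<epsilon> l l' \<longleftrightarrow> (\<exists>\<mu>\<in>{1..n}. l = Plus \<mu> \<and> l' = Minus \<mu>) \<or> (\<epsilon> = 1 \<and> l = Zero \<and> l' = Zero)"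

definition conjugate_form where
  "conjugate_form n \<epsilon> c X p B \<longleftrightarrow> (\<exists>l l' \<alpha> \<beta>. conjugate_legs n \<epsilon> l l' \<and> (\<forall>i\<in>coords n \<epsilon>. \<forall>j\<in>coords n \<epsilon>.
     complex_of_real (B i j) = \<alpha> * (leg_form n c X p l i * leg_form n c X p l' j)
       + \<beta> * (leg_form n c X p l' i * leg_form n c X p l j)))"

lemma conjugate_legs_words:
  assumes "conjugate_legs n \<epsilon> l l'" "conjugate_legs n \<epsilon> m m'"
    and "mset w = {#l, l', m, m'#}"
  shows "length w = 4" "set w \<subseteq> legs n \<epsilon>" "balanced n w"
proof -
  have "size (mset w) = 4" "set_mset (mset w) = {l, l', m, m'}" unfolding assms(3) by auto
  then show "length w = 4" "set w \<subseteq> legs n \<epsilon>"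
    using assms(1,2) by (auto simp: conjugate_legs_def legs_def)
  have "count_list w z = count {#l, l', m, m'#} z" for z
    using assms(3) by (metis count_mset)
  then show "balanced n w"
    unfolding balanced_def using assms(1,2) by (auto simp: conjugate_legs_def)
qed

lemma totally_zero_weight_products:
  assumes B: "conjugate_form n \<epsilon> c X p B" and C: "conjugate_form n \<epsilon> c X p C"
  shows "real_zero_weight n \<epsilon> c X p (\<lambda>i j k l. B i j * C k l)"
    and "real_zero_weight n \<epsilon> c X p (\<lambda>i j k l. B i k * C j l)"
    and "real_zero_weight n \<epsilon> c X p (\<lambda>i j k l. B i l * C j k)"
proof -
  let ?L = "leg_form n c X p"
  obtain l1 l2 \<alpha> \<beta> where l: "conjugate_legs n \<epsilon> l1 l2" and B': "\<And>i j. i \<in> coords n \<epsilon> \<Longrightarrow> j \<in> coords n \<epsilon> \<Longrightarrow>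
     complex_of_real (B i j) = \<alpha> * (?L l1 i * ?L l2 j) + \<beta> * (?L l2 i * ?L l1 j)"
    using B unfolding conjugate_form_def by blast
  obtain m1 m2 \<gamma> \<delta> where m: "conjugate_legs n \<epsilon> m1 m2" and C': "\<And>i j. i \<in> coords n \<epsilon> \<Longrightarrow> j \<in> coords n \<epsilon> \<Longrightarrow>
     complex_of_real (C i j) = \<gamma> * (?L m1 i * ?L m2 j) + \<delta> * (?L m2 i * ?L m1 j)"
    using C unfolding conjugate_form_def by blast
  have mono: "totally_zero_weight n \<epsilon> c X p (\<lambda>i j k l. ?L a i * ?L b j * ?L d k * ?L e l)"
    if "mset [a, b, d, e] = {#l1, l2, m1, m2#}" for a b d e
    using totally_zero_weight_monomial[OF conjugate_legs_words[OF l m that], of c X p]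
    by (simp add: numeral_3_eq_3)
  note lin = totally_zero_weight_lincomb
  have "totally_zero_weight n \<epsilon> c X p (\<lambda>i j k l. 1 * ((\<alpha> * \<gamma>) * (?L l1 i * ?L l2 j * ?L m1 k * ?L m2 l)
      + (\<alpha> * \<delta>) * (?L l1 i * ?L l2 j * ?L m2 k * ?L m1 l)) + 1 * ((\<beta> * \<gamma>) * (?L l2 i * ?L l1 j * ?L m1 k * ?L m2 l)
      + (\<beta> * \<delta>) * (?L l2 i * ?L l1 j * ?L m2 k * ?L m1 l)))"
    by (intro lin mono) (simp_all add: add_mset_commute)
  then show "real_zero_weight n \<epsilon> c X p (\<lambda>i j k l. B i j * C k l)"
    unfolding real_zero_weight_def by (rule totally_zero_weight_cong) (simp add: B' C' algebra_simps)
  have "totally_zero_weight n \<epsilon> c X p (\<lambda>i j k l. 1 * ((\<alpha> * \<gamma>) * (?L l1 i * ?L m1 j * ?L l2 k * ?L m2 l)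
      + (\<alpha> * \<delta>) * (?L l1 i * ?L m2 j * ?L l2 k * ?L m1 l)) + 1 * ((\<beta> * \<gamma>) * (?L l2 i * ?L m1 j * ?L l1 k * ?L m2 l)
      + (\<beta> * \<delta>) * (?L l2 i * ?L m2 j * ?L l1 k * ?L m1 l)))"
    by (intro lin mono) (simp_all add: add_mset_commute)
  then show "real_zero_weight n \<epsilon> c X p (\<lambda>i j k l. B i k * C j l)"
    unfolding real_zero_weight_def by (rule totally_zero_weight_cong) (simp add: B' C' algebra_simps)
  have "totally_zero_weight n \<epsilon> c X p (\<lambda>i j k l. 1 * ((\<alpha> * \<gamma>) * (?L l1 i * ?L m1 j * ?L m2 k * ?L l2 l)
      + (\<alpha> * \<delta>) * (?L l1 i * ?L m2 j * ?L m1 k * ?L l2 l)) + 1 * ((\<beta> * \<gamma>) * (?L l2 i * ?L m1 j * ?L m2 k * ?L l1 l)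
      + (\<beta> * \<delta>) * (?L l2 i * ?L m2 j * ?L m1 k * ?L l1 l)))"
    by (intro lin mono) (simp_all add: add_mset_commute)
  then show "real_zero_weight n \<epsilon> c X p (\<lambda>i j k l. B i l * C j k)"
    unfolding real_zero_weight_def by (rule totally_zero_weight_cong) (simp add: B' C' algebra_simps)
qed

lemma real_zero_weight_add:
  "real_zero_weight n \<epsilon> c X p S \<Longrightarrow> real_zero_weight n \<epsilon> c X p T \<Longrightarrow> real_zero_weight n \<epsilon> c X p (\<lambda>i j k l. S i j k l + T i j k l)"
  unfolding real_zero_weight_def by (drule (1) totally_zero_weight_lincomb[of _ _ _ _ _ _ _ 1 1]) simp

lemma real_zero_weight_diff:
  "real_zero_weight n \<epsilon> c X p S \<Longrightarrow> real_zero_weight n \<epsilon> c X p T \<Longrightarrow> real_zero_weight n \<epsilon> c X p (\<lambda>i j k l. S i j k l - T i j k l)"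
  unfolding real_zero_weight_def by (drule (1) totally_zero_weight_lincomb[of _ _ _ _ _ _ _ 1 "-1"]) simp

lemma real_zero_weight_cmult:
  "real_zero_weight n \<epsilon> c X p S \<Longrightarrow> real_zero_weight n \<epsilon> c X p (\<lambda>i j k l. a * S i j k l)"
  unfolding real_zero_weight_def
  using totally_zero_weight_lincomb[of n \<epsilon> c X p "\<lambda>i j k l. complex_of_real (S i j k l)" _ "of_real a" 0] by simp

lemma real_zero_weight_zero: "real_zero_weight n \<epsilon> c X p (\<lambda>i j k l. 0)"
  unfolding real_zero_weight_def totally_zero_weight_def by (rule exI[of _ "\<lambda>_. 0"]) simp

lemma real_zero_weight_sum:
  "(\<And>s. s \<in> A \<Longrightarrow> real_zero_weight n \<epsilon> c X p (f s)) \<Longrightarrow> real_zero_weight n \<epsilon> c X p (\<lambda>i j k l. \<Sum>s\<in>A. f s i j k l)"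
  by (induction A rule: infinite_finite_induct) (simp_all add: real_zero_weight_zero real_zero_weight_add)

lemma real_zero_weight_zero_weight_curvature:
  assumes h: "\<And>a. a \<in> N \<Longrightarrow> conjugate_form n \<epsilon> c X p (h a)"
    and Q: "\<And>a. a \<in> N \<Longrightarrow> conjugate_form n \<epsilon> c X p (Q a)"
  shows "real_zero_weight n \<epsilon> c X p (zero_weight_curvature N s f d h Q)"
  unfolding zero_weight_curvature_def[abs_def]
  by (intro real_zero_weight_add real_zero_weight_sum real_zero_weight_cmult real_zero_weight_diff totally_zero_weight_products h Q)

text \<open>
  The vector \<open>\<partial> / \<partial>\<psi>\<^sub>n\<close> is annihilated by all covectors of the metric except the one of the odd
  dimension, so its length is a multiple of \<open>c\<close>.
\<close>

lemma kerr_domain_c_nonzero: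
  assumes p: "p \<in> kerr_domain n 1 c X J"
  shows "c \<noteq> 0"
proof
  assume c: "c = 0"
  let ?I = "coords n 1" and ?g = "kerr_metric n 1 c X p"
  let ?v = "dpsi n"
  have m: "PsiC n \<in> ?I" and fin: "finite ?I" by (auto simp: coords_def)
  have g: "?g (PsiC n) (PsiC n) = 0"
    unfolding kerr_metric_def using c by (simp add: dx_def dpsi_def)
  have "(\<Sum>a\<in>?I. \<Sum>b\<in>?I. ?g a b * ?v a * ?v b) = (\<Sum>a\<in>?I. if a = PsiC n then (\<Sum>b\<in>?I. if b = PsiC n then ?g a b else 0) else 0)"
    by (intro sum.cong refl) (auto simp: dpsi_def intro!: sum.cong)
  also have "\<dots> = 0" using m fin g by simp
  finally have "(\<Sum>a\<in>?I. \<Sum>b\<in>?I. ?g a b * ?v a * ?v b) = 0" .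
  moreover have "(\<Sum>a\<in>?I. \<Sum>b\<in>?I. ?g a b * ?v a * ?v b) > 0"
    using p m unfolding kerr_domain_def pos_def_def by (auto simp: dpsi_def)
  ultimately show False by simp
qed


section \<open>Positivity and the curvature formula\<close>

context kerr_chart
begin

text \<open>
  Different squares are visible in the factors of \<open>U\<^sub>\<mu>\<close>; for a pair with the label 0 they are visible
  in \<open>A\<^sup>(\<^sup>n\<^sup>)\<close>, the product of all \<open>x\<^sub>\<nu>\<^sup>2\<close>.
\<close>

lemma kerr_domain_dom:
  assumes p: "p \<in> kerr_domain n \<epsilon> c X J"
  shows "p \<in> dom"
  unfolding dom_def
proof (intro CollectI conjI ballI impI)
  fix \<mu> assume "\<mu> \<in> K"
  then show "p (XC \<mu>) \<in> J \<mu>" "X \<mu> (p (XC \<mu>)) \<noteq> 0" using p by (auto simp: kerr_domain_def)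
next
  have K: "u p a \<noteq> u p b" if "a \<in> K" "b \<in> K" "a \<noteq> b" for a b
  proof
    assume "u p a = u p b"
    then have "u p b - u p a = 0" by simp
    then have "(\<Prod>\<nu>\<in>K-{a}. u p \<nu> - u p a) = 0"
      using that by (intro prod_zero) auto
    moreover have "U_fun n a p \<noteq> 0" using p that by (auto simp: kerr_domain_def)
    ultimately show False using U_fun_eq[OF that(1)] by simp
  qed
  have Z: "u p a \<noteq> u p 0" if "a \<in> K" "0 \<in> N" for a
  proof
    assume "u p a = u p 0"
    then have "u p a = 0" by (simp add: x_def)
    then have "(\<Prod>\<nu>\<in>K. u p \<nu>) = 0" using that by (intro prod_zero) auto
    moreover have "A_sym n n p \<noteq> 0" using p that N_zero by (auto simp: kerr_domain_def)
    ultimately show False using A_sym_top by simp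
  qed
  fix a b assume ab: "a \<in> N" "b \<in> N" "a \<noteq> b"
  show "u p a \<noteq> u p b"
  proof (cases "a = 0")
    case True
    then have "b \<in> K" "0 \<in> N" using ab N_K[of b] by auto
    from Z[OF this] show ?thesis unfolding True by (rule not_sym)
  next
    case False
    then have a: "a \<in> K" using ab N_K by blast
    show ?thesis
    proof (cases "b = 0")
      case True
      then show ?thesis using Z[OF a] ab by blast
    next
      case False
      then have "b \<in> K" using ab N_K by blast
      then show ?thesis using K[OF a] ab by blast
    qed
  qed
qed

text \<open>
  The value of the metric on the vector dual to \<open>w\<^sub>A\<close>.
\<close>

lemma lam_pos:
  assumes p: "p \<in> kerr_domain n \<epsilon> c X J" and A: "A \<in> N"
  shows "lam p A > 0"
proof -
  have q: "p \<in> dom" using kerr_domain_dom[OF p] .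
  let ?g = "kerr_metric n \<epsilon> c X p" and ?v = "v p A"
  have eq: "(\<Sum>a\<in>I. \<Sum>b\<in>I. ?g a b * ?v a * ?v b) = ctr I ?v (\<lambda>a. ctr I ?v (\<lambda>b. ?g a b))"
    unfolding ctr_def sum_distrib_left by (intro sum.cong refl) (simp only: mult_ac)
  also have "\<dots> = (\<Sum>B\<in>N. lam p B * (ctr I ?v (w p B) * ctr I ?v (w p B)))"
    unfolding metric_eq by (simp only: ctr_simps dual_v_dx) simp
  also have "\<dots> = (\<Sum>B\<in>N. if B = A then lam p B else 0)"
    by (intro sum.cong refl) (auto simp: dual_v_w[OF q A] kron_def)
  also have "\<dots> = lam p A" using A by simp
  finally have "(\<Sum>a\<in>I. \<Sum>b\<in>I. ?g a b * ?v a * ?v b) = lam p A" .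
  moreover have "\<exists>a\<in>I. ?v a \<noteq> 0"
  proof (rule ccontr)
    assume "\<not> (\<exists>a\<in>I. ?v a \<noteq> 0)"
    then have "ctr I ?v (w p A) = 0" unfolding ctr_def by (intro sum.neutral) auto
    then show False using dual_v_w[OF q A A] by (simp add: kron_def)
  qed
  moreover have "pos_def I ?g" using p unfolding kerr_domain_def by blast
  then have "(\<exists>a\<in>I. ?v a \<noteq> 0) \<longrightarrow> (\<Sum>a\<in>I. \<Sum>b\<in>I. ?g a b * ?v a * ?v b) > 0"
    unfolding pos_def_def by (rule spec)
  ultimately show ?thesis by simp
qed

text \<open>
  The square roots in the orthonormal coframe combine to rational expressions in all products of two
  covectors of the same label; positivity of \<open>\<lambda>\<^sub>\<mu>\<close> is used here.
\<close>

lemma frame_forms: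
  assumes p: "p \<in> kerr_domain n \<epsilon> c X J" and \<mu>: "\<mu> \<in> K"
  shows "e_frame n X \<mu> p i * e_frame n X \<mu> p j = 1 / lam p \<mu> * (dx \<mu> i * dx \<mu> j)"
    and "ehat_frame n X \<mu> p i * ehat_frame n X \<mu> p j = lam p \<mu> * (w p \<mu> i * w p \<mu> j)"
    and "e_frame n X \<mu> p i * ehat_frame n X \<mu> p j = dx \<mu> i * w p \<mu> j"
proof -
  have pos: "lam p \<mu> > 0" using lam_pos[OF p K_N[OF \<mu>]] .
  have e: "e_frame n X \<mu> p a = sqrt (1 / lam p \<mu>) * dx \<mu> a"
    and eh: "ehat_frame n X \<mu> p a = sqrt (lam p \<mu>) * w p \<mu> a" for a
    unfolding e_frame_def ehat_frame_def w_eq_A_sub[OF \<mu>] using \<mu> by (simp_all add: lam_def)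
  have s: "sqrt (1 / lam p \<mu>) * sqrt (1 / lam p \<mu>) = 1 / lam p \<mu>" "sqrt (lam p \<mu>) * sqrt (lam p \<mu>) = lam p \<mu>"
    "sqrt (1 / lam p \<mu>) * sqrt (lam p \<mu>) = 1"
    using pos by (simp_all add: real_sqrt_divide)
  show "e_frame n X \<mu> p i * e_frame n X \<mu> p j = 1 / lam p \<mu> * (dx \<mu> i * dx \<mu> j)"
    unfolding e by (subst s(1)[symmetric]) (simp only: mult_ac)
  show "ehat_frame n X \<mu> p i * ehat_frame n X \<mu> p j = lam p \<mu> * (w p \<mu> i * w p \<mu> j)"
    unfolding eh by (subst s(2)[symmetric]) (simp only: mult_ac)
  have "e_frame n X \<mu> p i * ehat_frame n X \<mu> p j
      = (sqrt (1 / lam p \<mu>) * sqrt (lam p \<mu>)) * (dx \<mu> i * w p \<mu> j)"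
    unfolding e eh by (simp only: mult_ac)
  then show "e_frame n X \<mu> p i * ehat_frame n X \<mu> p j = dx \<mu> i * w p \<mu> j" unfolding s by simp
qed

lemma h_form_eq:
  assumes p: "p \<in> kerr_domain n \<epsilon> c X J" and \<mu>: "\<mu> \<in> K"
  shows "h_form n X \<mu> p = h p \<mu>"
  unfolding h_form_def[abs_def] h_def[abs_def] frame_forms[OF p \<mu>]
  using frame_forms(3)[OF p \<mu>] by (simp add: mult.commute)

lemma Q_form_eq:
  assumes p: "p \<in> kerr_domain n \<epsilon> c X J" and \<mu>: "\<mu> \<in> K"
  shows "Q_form n X \<mu> p = Q p \<mu>"
  unfolding Q_form_def[abs_def] Q_def[abs_def] frame_forms[OF p \<mu>] ..

lemma dx_zero_coords: "i \<in> I \<Longrightarrow> dx 0 i = 0"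
  by (auto simp: coords_def dx_def)

lemma h_zero: "i \<in> I \<Longrightarrow> j \<in> I \<Longrightarrow> h p 0 i j = 0"
  by (simp add: h_def dx_zero_coords)

lemma metric_eq_sum_Q: "i \<in> I \<Longrightarrow> j \<in> I \<Longrightarrow> kerr_metric n \<epsilon> c X p i j = (\<Sum>A\<in>N. Q p A i j)"
proof -
  assume ij: "i \<in> I" "j \<in> I"
  have "(\<Sum>\<mu>\<in>K. 1 / lam p \<mu> * (dx \<mu> i * dx \<mu> j)) = (\<Sum>A\<in>N. 1 / lam p A * (dx A i * dx A j))"
  proof (rule sum.mono_neutral_left)
    show "\<forall>A\<in>N - K. 1 / lam p A * (dx A i * dx A j) = 0"
    proof
      fix A assume "A \<in> N - K"
      then have "A = 0" using N_K by blast
      then show "1 / lam p A * (dx A i * dx A j) = 0" by (simp add: dx_zero_coords ij)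
    qed
  qed (use K_N in auto)
  then show ?thesis unfolding metric_eq Q_def sum.distrib by simp
qed

text \<open>
  With \<open>m\<^sub>\<plusminus> = e\<^sup>\<mu> \<plusminus> \<i> \<eta>\<^sup>\<mu>\<close> one has \<open>h\<^sub>\<mu> = \<i>/2 (m\<^sub>+ m\<^sub>- - m\<^sub>- m\<^sub>+)\<close> and \<open>Q\<^sub>\<mu> = 1/2 (m\<^sub>+ m\<^sub>- + m\<^sub>- m\<^sub>+)\<close>. Here \<open>\<eta>\<^sup>\<mu>\<close> is the
  covector of \<open>ehat_frame\<close>. For the label 0, \<open>h\<^sub>0 = 0\<close> and \<open>Q\<^sub>0\<close> is the square of the single real leg.
\<close>

lemma conjugate_forms:
  assumes p: "p \<in> kerr_domain n \<epsilon> c X J" and A: "A \<in> N"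
  shows "conjugate_form n \<epsilon> c X p (h p A)" "conjugate_form n \<epsilon> c X p (Q p A)"
proof -
  have "conjugate_form n \<epsilon> c X p (h p A) \<and> conjugate_form n \<epsilon> c X p (Q p A)"
  proof (cases "A = 0")
    case True
    then have \<epsilon>1: "\<epsilon> = 1" using A N_zero by simp
    have pos: "lam p 0 > 0" using lam_pos[OF p A] True by simp
    have "ehat0_frame n c p i * ehat0_frame n c p j = lam p 0 * (w p 0 i * w p 0 j)" for i j
    proof -
      have "ehat0_frame n c p a = sqrt (lam p 0) * w p 0 a" for a
        unfolding ehat0_frame_def w_eq_A_sym[OF \<epsilon>1] by (simp add: lam_def)
      then have "ehat0_frame n c p i * ehat0_frame n c p j = (sqrt (lam p 0) * sqrt (lam p 0)) * (w p 0 i * w p 0 j)"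
        by (simp only: mult_ac)
      then show ?thesis using pos by simp
    qed
    then have Q0: "Q p A i j = ehat0_frame n c p i * ehat0_frame n c p j" if "i \<in> I" for i j
      using that True by (simp add: Q_def dx_zero_coords)
    have Z: "conjugate_legs n \<epsilon> Zero Zero" using \<epsilon>1 by (simp add: conjugate_legs_def)
    show ?thesis unfolding conjugate_form_def
      by (intro conjI; rule exI[of _ Zero], rule exI[of _ Zero])
        (rule exI[of _ 0], rule exI[of _ 0], use Z True h_zero in simp,
         rule exI[of _ 1], rule exI[of _ 0], use Z Q0 in simp)
  next
    case False
    then have K: "A \<in> K" using A N_K by blast
    then have P: "conjugate_legs n \<epsilon> (Plus A) (Minus A)" by (auto simp: conjugate_legs_def)
    let ?e = "\<lambda>i. complex_of_real (e_frame n X A p i)" and ?f = "\<lambda>i. complex_of_real (ehat_frame n X A p i)"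
    have h: "complex_of_real (h p A i j) = (\<i> / 2) * (leg_form n c X p (Plus A) i * leg_form n c X p (Minus A) j)
       + (- \<i> / 2) * (leg_form n c X p (Minus A) i * leg_form n c X p (Plus A) j)" for i j
    proof -
      have eq: "complex_of_real (h p A i j) = ?e i * ?f j - ?f i * ?e j"
        by (simp add: h_form_eq[OF p K, symmetric] h_form_def)
      show ?thesis unfolding eq by (simp add: field_simps)
    qed
    have Q: "complex_of_real (Q p A i j) = (1 / 2) * (leg_form n c X p (Plus A) i * leg_form n c X p (Minus A) j)
       + (1 / 2) * (leg_form n c X p (Minus A) i * leg_form n c X p (Plus A) j)" for i j
    proof -
      have eq: "complex_of_real (Q p A i j) = ?e i * ?e j + ?f i * ?f j"
        by (simp add: Q_form_eq[OF p K, symmetric] Q_form_def)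
      show ?thesis unfolding eq by (simp add: field_simps)
    qed
    show ?thesis unfolding conjugate_form_def using P h Q by blast
  qed
  then show "conjugate_form n \<epsilon> c X p (h p A)" "conjugate_form n \<epsilon> c X p (Q p A)" by auto
qed

lemma riemann_totally_zero_weight:
  assumes p: "p \<in> kerr_domain n \<epsilon> c X J"
  shows "totally_zero_weight n \<epsilon> c X p
    (\<lambda>i j k l. complex_of_real (riemann I (kerr_metric n \<epsilon> c X) p i j k l))"
proof -
  note q = kerr_domain_dom[OF p]
  have "real_zero_weight n \<epsilon> c X p (zero_weight_curvature N (S p) (F p) (D p) (h p) (Q p))"
    by (intro real_zero_weight_zero_weight_curvature conjugate_forms p)
  then show ?thesis unfolding real_zero_weight_def
    by (rule totally_zero_weight_cong) (simp add: riemann_eq_zero_weight_curvature[OF q])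
qed

lemma sum_N: "(\<Sum>A\<in>N. f A) = (\<Sum>\<mu>=1..n. f \<mu>) + real \<epsilon> * (f 0 :: real)"
  using \<epsilon> unfolding N_cases by auto

text \<open>
  The sums over ordered pairs are folded to \<open>\<mu> < \<nu>\<close>, and the pairs with the label 0 are split off. The
  rest is the cancellation of all \<open>E\<close>-terms except \<open>E\<^sub>\<mu> (Q\<^sub>\<mu> \<odot> Q\<^sub>0)\<close>. On the diagonal it uses
  \<open>h\<^sub>\<mu> \<odot> h\<^sub>\<mu> = - 3 (Q\<^sub>\<mu> \<odot> Q\<^sub>\<mu>)\<close>, as there is only one algebraic curvature tensor in two dimensions.
\<close>

lemma riemann_formula:
  assumes p: "p \<in> kerr_domain n \<epsilon> c X J" and m: "i \<in> I" "j \<in> I" "k \<in> I" "l \<in> I"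
  shows "riemann I (kerr_metric n \<epsilon> c X) p i j k l =
          (\<Sum>\<mu>=1..n. \<Sum>\<nu>\<in>{\<mu><..n}.
             Omega n \<epsilon> c X \<mu> \<nu> p * odot_antisym (h_form n X \<mu> p) (h_form n X \<nu> p) i j k l
             + alpha n \<epsilon> c X \<mu> \<nu> p * odot_sym (Q_form n X \<mu> p) (Q_form n X \<nu> p) i j k l)
          + (\<Sum>\<mu>=1..n.
             1/2 * Omega n \<epsilon> c X \<mu> \<mu> p * odot_antisym (h_form n X \<mu> p) (h_form n X \<mu> p) i j k l
             + alpha_eps n \<epsilon> c X \<mu> p * odot_sym (Q_form n X \<mu> p) (Q_eps n \<epsilon> c X p) i j k l)"
    (is "_ = (\<Sum>\<mu>=1..n. \<Sum>\<nu>\<in>{\<mu><..n}. ?pair \<mu> \<nu>) + (\<Sum>\<mu>=1..n. ?diag \<mu>)")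
proof -
  note q = kerr_domain_dom[OF p]
  interpret P: kerr_point N "x p" "lam p" "l1 p" "l2 p" by (rule kerr_point[OF q])
  define H where "H \<mu> \<nu> = odot_antisym (h p \<mu>) (h p \<nu>) i j k l" for \<mu> \<nu>
  define G where "G \<mu> \<nu> = odot_sym (Q p \<mu>) (Q p \<nu>) i j k l" for \<mu> \<nu>
  define E where "E \<mu> = real \<epsilon> * E_fun n \<epsilon> c X \<mu> p" for \<mu>
  define Sp where "Sp \<mu> \<nu> = S_fun n \<epsilon> c X \<mu> \<nu> p" for \<mu> \<nu>
  define Fp where "Fp \<mu> \<nu> = F_fun n \<epsilon> c X \<mu> \<nu> p" for \<mu> \<nu>
  define Dp where "Dp \<mu> = D_fun n \<epsilon> c X \<mu> p" for \<mu>
  define hh where "hh a b = 2 * (h p a i j * h p b k l) + h p a i k * h p b j l - h p a i l * h p b j k" for a b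
  define qq where "qq a b = Q p a i k * Q p b j l - Q p a i l * Q p b j k" for a b
  have eps: "real \<epsilon> * real \<epsilon> = real \<epsilon>" using \<epsilon> by auto
  have hh: "hh a b + hh b a = 8 * H a b" for a b
    by (simp add: hh_def H_def odot_antisym_def algebra_simps)
  have qq: "qq a b + qq b a = - 8 * G a b" for a b
    by (simp add: qq_def G_def odot_sym_def algebra_simps)
  have G_sym: "G a b = G b a" for a b
    by (simp add: G_def odot_sym_def algebra_simps)
  have H_self: "H a a = 3 / 4 * (h p a i j * h p a k l)" for a
    by (simp add: H_def odot_antisym_def h_def algebra_simps)
  (* algebraic curvature tensors in dimension two are proportional *)
  have GH: "G a a = - H a a / 3" if "a \<in> K" for a
    using P.lam_nz[OF K_N[OF that]]
    by (simp add: H_self G_def odot_sym_def h_def Q_def field_simps)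
  have h0: "h p 0 s t = 0" if "s \<in> I" "t \<in> I" for s t by (rule h_zero[OF that])
  have "riemann I (kerr_metric n \<epsilon> c X) p i j k l
     = (\<Sum>a\<in>N. \<Sum>b\<in>N. F p a b * hh a b) + (\<Sum>a\<in>N. \<Sum>b\<in>N. S p a b * qq a b)
       + (\<Sum>a\<in>N. D p a * (h p a i j * h p a k l))"
    unfolding riemann_eq_zero_weight_curvature[OF q m] zero_weight_curvature_def hh_def qq_def ..
  also have "(\<Sum>a\<in>N. D p a * (h p a i j * h p a k l)) = (\<Sum>\<mu>=1..n. 4 / 3 * (Dp \<mu> * H \<mu> \<mu>))"
    unfolding sum_N h0[OF m(1,2)] by (simp add: H_self Dp_def D_eq[OF q])
  also have "(\<Sum>a\<in>N. \<Sum>b\<in>N. F p a b * hh a b) = (\<Sum>a=1..n. \<Sum>b=1..n. F p a b * hh a b)"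
    unfolding sum_N by (simp add: hh_def h0 m)
  also have "\<dots> = (\<Sum>\<mu>=1..n. \<Sum>\<nu>\<in>{\<mu><..n}. 8 * (Fp \<mu> \<nu> * H \<mu> \<nu>))"
  proof -
    have "F p a b * hh a b + F p b a * hh b a = 8 * (Fp a b * H a b)" if "a \<in> K" "b \<in> {a<..n}" for a b
    proof -
      have "b \<in> K" "a \<noteq> b" using that by auto
      then have "F p a b = Fp a b" "F p b a = Fp a b"
        unfolding Fp_def using F_eq[OF q that(1), of b] P.Ff_commute[of b a] by auto
      then show ?thesis using hh[of a b] by (metis distrib_left mult.left_commute)
    qed
    then show ?thesis unfolding sum_over_pairs by (simp add: P.Ff_self)
  qed
  also have "(\<Sum>a\<in>N. \<Sum>b\<in>N. S p a b * qq a b) = (\<Sum>a=1..n. \<Sum>b=1..n. S p a b * qq a b)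
      + real \<epsilon> * (\<Sum>\<mu>=1..n. S p \<mu> 0 * (qq \<mu> 0 + qq 0 \<mu>))"
    unfolding sum_N by (simp add: sum.distrib sum_distrib_left algebra_simps P.Sf_commute[of 0])
  also have "(\<Sum>a=1..n. \<Sum>b=1..n. S p a b * qq a b) = (\<Sum>\<mu>=1..n. \<Sum>\<nu>\<in>{\<mu><..n}. - 8 * (Sp \<mu> \<nu> * G \<mu> \<nu>))"
  proof -
    have "S p a b * qq a b + S p b a * qq b a = - 8 * (Sp a b * G a b)" if "a \<in> K" "b \<in> {a<..n}" for a b
    proof -
      have "b \<in> K" "a \<noteq> b" using that by auto
      then have "S p a b = Sp a b" "S p b a = Sp a b"
        unfolding Sp_def using S_eq[OF q that(1), of b] P.Sf_commute[of b a] by auto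
      then show ?thesis using qq[of a b] by (metis distrib_left mult.left_commute)
    qed
    then show ?thesis unfolding sum_over_pairs by (simp add: P.Sf_self)
  qed
  also have "real \<epsilon> * (\<Sum>\<mu>=1..n. S p \<mu> 0 * (qq \<mu> 0 + qq 0 \<mu>)) = (\<Sum>\<mu>=1..n. - 8 * (E \<mu> * G \<mu> 0))"
  proof (cases "\<epsilon> = 0")
    case False
    then have "\<epsilon> = 1" using \<epsilon> by auto
    then show ?thesis using E_eq[OF q] by (simp add: E_def qq sum_negf mult_ac)
  qed (simp add: E_def)
  finally have lhs: "riemann I (kerr_metric n \<epsilon> c X) p i j k l =
      (\<Sum>\<mu>=1..n. \<Sum>\<nu>\<in>{\<mu><..n}. 8 * (Fp \<mu> \<nu> * H \<mu> \<nu>))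
      + ((\<Sum>\<mu>=1..n. \<Sum>\<nu>\<in>{\<mu><..n}. - 8 * (Sp \<mu> \<nu> * G \<mu> \<nu>)) + (\<Sum>\<mu>=1..n. - 8 * (E \<mu> * G \<mu> 0)))
      + (\<Sum>\<mu>=1..n. 4 / 3 * (Dp \<mu> * H \<mu> \<mu>))" .
  have pair: "?pair \<mu> \<nu> = 8 * (Fp \<mu> \<nu> * H \<mu> \<nu>) + - 8 * (Sp \<mu> \<nu> * G \<mu> \<nu>) + 8 * (E \<mu> * G \<mu> \<nu> + E \<nu> * G \<nu> \<mu>)"
    if "\<mu> \<in> {1..n}" "\<nu> \<in> {\<mu><..n}" for \<mu> \<nu>
  proof -
    have "\<nu> \<in> K" using that by auto
    show ?thesis
      unfolding h_form_eq[OF p that(1)] h_form_eq[OF p \<open>\<nu> \<in> K\<close>] Q_form_eq[OF p that(1)] Q_form_eq[OF p \<open>\<nu> \<in> K\<close>]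
      using that G_sym[of \<nu> \<mu>]
      by (simp add: Omega_def alpha_def H_def[symmetric] G_def[symmetric] Fp_def Sp_def E_def algebra_simps)
  qed
  have diag: "?diag \<mu> = 4 / 3 * (Dp \<mu> * H \<mu> \<mu>) + 8 * (E \<mu> * G \<mu> \<mu>) - 8 * (\<Sum>\<nu>=1..n. E \<mu> * G \<mu> \<nu>) - 8 * (E \<mu> * G \<mu> 0)"
    if \<mu>: "\<mu> \<in> {1..n}" for \<mu>
  proof -
    have "odot_sym (Q p \<mu>) (Q_eps n \<epsilon> c X p) i j k l = real \<epsilon> * (\<Sum>A\<in>N. G \<mu> A)"
      by (simp add: odot_sym_def Q_eps_def metric_eq_sum_Q m G_def sum_distrib_left sum_distrib_right
          sum.distrib sum_subtractf algebra_simps)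
    also have "\<dots> = real \<epsilon> * (\<Sum>\<nu>=1..n. G \<mu> \<nu>) + real \<epsilon> * G \<mu> 0"
      unfolding sum_N by (simp add: distrib_left mult.assoc[symmetric] eps)
    finally have "alpha_eps n \<epsilon> c X \<mu> p * odot_sym (Q p \<mu>) (Q_eps n \<epsilon> c X p) i j k l
       = - 8 * (real \<epsilon> * real \<epsilon>) * E_fun n \<epsilon> c X \<mu> p * ((\<Sum>\<nu>=1..n. G \<mu> \<nu>) + G \<mu> 0)"
      by (simp add: alpha_eps_def algebra_simps)
    then have "alpha_eps n \<epsilon> c X \<mu> p * odot_sym (Q p \<mu>) (Q_eps n \<epsilon> c X p) i j k l
       = - 8 * (\<Sum>\<nu>=1..n. E \<mu> * G \<mu> \<nu>) - 8 * (E \<mu> * G \<mu> 0)"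
      unfolding eps E_def sum_distrib_left[symmetric] by (simp add: algebra_simps)
    moreover have "1/2 * Omega n \<epsilon> c X \<mu> \<mu> p * H \<mu> \<mu> = 4 / 3 * (Dp \<mu> * H \<mu> \<mu>) + 8 * (E \<mu> * G \<mu> \<mu>)"
      unfolding GH[OF \<mu>] by (simp add: Omega_def Dp_def E_def algebra_simps)
    ultimately show ?thesis
      unfolding h_form_eq[OF p \<mu>] Q_form_eq[OF p \<mu>] H_def[symmetric] by simp
  qed
  (* the unwanted terms from the metric, which cancel the E-parts of the pair and diagonal terms *)
  have pairs: "(\<Sum>\<mu>=1..n. \<Sum>\<nu>=1..n. E \<mu> * G \<mu> \<nu>) = (\<Sum>\<mu>=1..n. E \<mu> * G \<mu> \<mu>)
     + (\<Sum>\<mu>=1..n. \<Sum>\<nu>\<in>{\<mu><..n}. E \<mu> * G \<mu> \<nu> + E \<nu> * G \<nu> \<mu>)"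
    by (rule sum_over_pairs)
  have "(\<Sum>\<mu>=1..n. \<Sum>\<nu>\<in>{\<mu><..n}. ?pair \<mu> \<nu>) + (\<Sum>\<mu>=1..n. ?diag \<mu>) =
     (\<Sum>\<mu>=1..n. \<Sum>\<nu>\<in>{\<mu><..n}. 8 * (Fp \<mu> \<nu> * H \<mu> \<nu>) + - 8 * (Sp \<mu> \<nu> * G \<mu> \<nu>) + 8 * (E \<mu> * G \<mu> \<nu> + E \<nu> * G \<nu> \<mu>))
     + (\<Sum>\<mu>=1..n. 4 / 3 * (Dp \<mu> * H \<mu> \<mu>) + 8 * (E \<mu> * G \<mu> \<mu>) - 8 * (\<Sum>\<nu>=1..n. E \<mu> * G \<mu> \<nu>) - 8 * (E \<mu> * G \<mu> 0))"
    by (intro arg_cong2[where f = plus] sum.cong refl pair diag)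
  also have "\<dots> = riemann I (kerr_metric n \<epsilon> c X) p i j k l"
    unfolding lhs sum.distrib sum_subtractf sum_distrib_left[symmetric]
    using pairs by (simp add: sum.distrib sum_subtractf sum_distrib_left[symmetric] algebra_simps)
  finally show ?thesis ..
qed

end

theorem theorem2:
  fixes n \<epsilon> :: nat and c :: real and X :: "nat \<Rightarrow> real \<Rightarrow> real"
    and J :: "nat \<Rightarrow> real set" and p :: "coord \<Rightarrow> real"
  assumes "n \<ge> 1" and "\<epsilon> \<in> {0, 1}"
    and "\<And>\<mu>. \<mu> \<in> {1..n} \<Longrightarrow> open (J \<mu>)"
    and "\<And>\<mu>. \<mu> \<in> {1..n} \<Longrightarrow> smooth_fun_on (J \<mu>) (X \<mu>)"
    and "p \<in> kerr_domain n \<epsilon> c X J"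
  shows "riemann_symmetric (coords n \<epsilon>) (riemann (coords n \<epsilon>) (kerr_metric n \<epsilon> c X) p)
    \<and> totally_zero_weight n \<epsilon> c X p
        (\<lambda>i j k l. complex_of_real (riemann (coords n \<epsilon>) (kerr_metric n \<epsilon> c X) p i j k l))
    \<and> (\<forall>i\<in>coords n \<epsilon>. \<forall>j\<in>coords n \<epsilon>. \<forall>k\<in>coords n \<epsilon>. \<forall>l\<in>coords n \<epsilon>.
        riemann (coords n \<epsilon>) (kerr_metric n \<epsilon> c X) p i j k l =
          (\<Sum>\<mu>=1..n. \<Sum>\<nu>\<in>{\<mu><..n}.
             Omega n \<epsilon> c X \<mu> \<nu> p * odot_antisym (h_form n X \<mu> p) (h_form n X \<nu> p) i j k l
             + alpha n \<epsilon> c X \<mu> \<nu> p * odot_sym (Q_form n X \<mu> p) (Q_form n X \<nu> p) i j k l)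
          + (\<Sum>\<mu>=1..n.
             1/2 * Omega n \<epsilon> c X \<mu> \<mu> p * odot_antisym (h_form n X \<mu> p) (h_form n X \<mu> p) i j k l
             + alpha_eps n \<epsilon> c X \<mu> p * odot_sym (Q_form n X \<mu> p) (Q_eps n \<epsilon> c X p) i j k l))"
proof -
  interpret kerr_chart n \<epsilon> c X J
    by unfold_locales (use assms kerr_domain_c_nonzero[of p n c X J] in auto)
  show ?thesis
    using curvature_like_imp_riemann_symmetric[OF riemann_curvature_like[OF kerr_domain_dom[OF assms(5)]]]
      riemann_totally_zero_weight[OF assms(5)] riemann_formula[OF assms(5)] by blast
qed

end
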